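(* Let $(Y_1,\sigma)$ and $(Y_2,\sigma)$ be subshifts of finite type such that $(Y_1,\sigma^\ell)$ and $(Y_2,\sigma^\ell)$ are conjugate for all sufficiently large $\ell$. Let $G$ be a finite group and let $\alpha_1:G\to\mathrm{Aut}(Y_1,\sigma)$ and $\alpha_2:G\to\mathrm{Aut}(Y_2,\sigma)$ be free inert actions of $G$ on $(Y_1,\sigma)$ and $(Y_2,\sigma)$, respectively. Then for every sufficiently large $\ell\in\mathbb{N}$ there is a conjugacy $\varphi$ from $(Y_1,\sigma^\ell)$ to $(Y_2,\sigma^\ell)$ such that $\varphi\circ\alpha_1(g)=\alpha_2(g)\circ\varphi$ for all $g\in G$.
   Context: Subshifts are two-sided: closed shift-invariant subsets of $\mathcal{S}^{\mathbb{Z}}$ for a finite alphabet $\mathcal{S}$, with the left shift $\sigma(x)_i=x_{i+1}$; a subshift of finite type (SFT) is one defined by finitely many forbidden words. $\mathrm{Aut}(X,f)$ is the group of self-homeomorphisms of $X$ commuting with $f$. A conjugacy from $(X,f)$ to $(Y,g)$ is a homeomorphism $\varphi:X\to Y$ with $\varphi\circ f=g\circ\varphi$. An action $\alpha:G\to\mathrm{Aut}(X,\sigma)$ is free if $\alpha(g)(x)\ne x$ for all $x\in X$ and all $g\neq 1_G$. Dimension group and inertness. For a square matrix $A$ over $\mathbb{Z}_+=\{0,1,2,\dots\}$ indexed by a finite set $V$ with no zero rows or columns, the edge shift $X_A$ is the SFT of bi-infinite edge paths in the directed graph with $A_{i,j}$ edges from $i$ to $j$; its dimension group is $D_A=(\mathbb{Z}^V\times\mathbb{Z})/\!\sim$,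 the direct limit of $\mathbb{Z}^V\xrightarrow{A}\mathbb{Z}^V\xrightarrow{A}\cdots$ (row vectors), where $\sim$ is the equivalence relation generated by $(x,n)\sim(xA,n+1)$. The dimension group is functorial: every conjugacy between SFTs induces an isomorphism of dimension groups, and in particular every action of $G$ by automorphisms of an SFT induces an action on its dimension group (the dimension group representation). Concretely, if $X=X_A$ and the action of $G$ is induced by an action of $G$ by graph automorphisms of the graph of $A$, then $g\cdot[(w,n)]=[(gw,n)]$ with $(gw)_i=w_{g^{-1}i}$. Every SFT with a free action of $G$ by automorphisms is conjugate, by a $G$-equivariant conjugacy, to one of this form. The action is called inert if the induced action on the dimension group is trivial. *)

theory Defs
  imports "HOL-Analysis.Function_Topology" "HOL-Algebra.Group_Action"
begin

section \<open>Subshifts and subshifts of finite type\<close>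

text \<open>
  Points are functions on the integers.  The topology is the product of the discrete topologies
  on the whole symbol type; on \<open>S\<^sup>\<int>\<close> it induces the product of the discrete topologies on \<open>S\<close>.
\<close>

definition config_topology :: "(int \<Rightarrow> 'a) topology" where
  "config_topology = product_topology (\<lambda>_. discrete_topology UNIV) UNIV"

definition full_shift :: "'a set \<Rightarrow> (int \<Rightarrow> 'a) set" where
  "full_shift S = {x. \<forall>i. x i \<in> S}"

definition shift :: "(int \<Rightarrow> 'a) \<Rightarrow> (int \<Rightarrow> 'a)" where
  "shift x = (\<lambda>i. x (i + 1))"

definition subshift :: "'a set \<Rightarrow> (int \<Rightarrow> 'a) set \<Rightarrow> bool" where
  "subshift S X \<longleftrightarrow>
     finite S \<and> X \<subseteq> full_shift S \<and> closedin config_topology X \<and> shift ` X = X"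

definition occurs_in :: "'a list \<Rightarrow> (int \<Rightarrow> 'a) \<Rightarrow> bool" where
  "occurs_in w x \<longleftrightarrow> (\<exists>i. \<forall>k<length w. x (i + int k) = w ! k)"

definition SFT :: "'a set \<Rightarrow> (int \<Rightarrow> 'a) set \<Rightarrow> bool" where
  "SFT S X \<longleftrightarrow>
     subshift S X \<and>
     (\<exists>F. finite F \<and> F \<subseteq> lists S \<and> X = {x \<in> full_shift S. \<forall>w\<in>F. \<not> occurs_in w x})"


section \<open>Conjugacies, automorphism groups and actions\<close>

definition conjugacy ::
  "(int \<Rightarrow> 'a) set \<Rightarrow> ((int \<Rightarrow> 'a) \<Rightarrow> (int \<Rightarrow> 'a)) \<Rightarrow>
   (int \<Rightarrow> 'b) set \<Rightarrow> ((int \<Rightarrow> 'b) \<Rightarrow> (int \<Rightarrow> 'b)) \<Rightarrow>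
   ((int \<Rightarrow> 'a) \<Rightarrow> (int \<Rightarrow> 'b)) \<Rightarrow> bool" where
  "conjugacy X f Y g \<phi> \<longleftrightarrow>
     homeomorphic_map (subtopology config_topology X) (subtopology config_topology Y) \<phi> \<and>
     (\<forall>x\<in>X. \<phi> (f x) = g (\<phi> x))"

definition conjugate ::
  "(int \<Rightarrow> 'a) set \<Rightarrow> ((int \<Rightarrow> 'a) \<Rightarrow> (int \<Rightarrow> 'a)) \<Rightarrow>
   (int \<Rightarrow> 'b) set \<Rightarrow> ((int \<Rightarrow> 'b) \<Rightarrow> (int \<Rightarrow> 'b)) \<Rightarrow> bool" where
  "conjugate X f Y g \<longleftrightarrow> (\<exists>\<phi>. conjugacy X f Y g \<phi>)"

definition Aut ::
  "(int \<Rightarrow> 'a) set \<Rightarrow> ((int \<Rightarrow> 'a) \<Rightarrow> (int \<Rightarrow> 'a)) \<Rightarrow> ((int \<Rightarrow> 'a) \<Rightarrow> (int \<Rightarrow> 'a)) monoid" where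
  "Aut X f = (BijGroup X)\<lparr>carrier := {\<phi> \<in> Bij X. conjugacy X f X f \<phi>}\<rparr>"

definition free_action :: "('g, 'm) monoid_scheme \<Rightarrow> 'x set \<Rightarrow> ('g \<Rightarrow> 'x \<Rightarrow> 'x) \<Rightarrow> bool" where
  "free_action G X \<alpha> \<longleftrightarrow> (\<forall>g\<in>carrier G. g \<noteq> \<one>\<^bsub>G\<^esub> \<longrightarrow> (\<forall>x\<in>X. \<alpha> g x \<noteq> x))"


section \<open>Edge shifts\<close>

definition nondegenerate :: "'v set \<Rightarrow> ('v \<Rightarrow> 'v \<Rightarrow> nat) \<Rightarrow> bool" where
  "nondegenerate V A \<longleftrightarrow>
     (\<forall>i\<in>V. \<exists>j\<in>V. A i j \<noteq> 0) \<and> (\<forall>j\<in>V. \<exists>i\<in>V. A i j \<noteq> 0)"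

text \<open>The \<open>A i j\<close> edges from \<open>i\<close> to \<open>j\<close> are the triples \<open>(i, j, k)\<close> with \<open>k < A i j\<close>.\<close>

definition edges :: "'v set \<Rightarrow> ('v \<Rightarrow> 'v \<Rightarrow> nat) \<Rightarrow> ('v \<times> 'v \<times> nat) set" where
  "edges V A = {(i, j, k). i \<in> V \<and> j \<in> V \<and> k < A i j}"

definition src :: "'v \<times> 'v \<times> nat \<Rightarrow> 'v" where
  "src e = fst e"

definition tgt :: "'v \<times> 'v \<times> nat \<Rightarrow> 'v" where
  "tgt e = fst (snd e)"

definition edge_shift :: "'v set \<Rightarrow> ('v \<Rightarrow> 'v \<Rightarrow> nat) \<Rightarrow> (int \<Rightarrow> 'v \<times> 'v \<times> nat) set" where
  "edge_shift V A = {x \<in> full_shift (edges V A). \<forall>i. tgt (x i) = src (x (i + 1))}"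

text \<open>
  An action by graph automorphisms, given by its actions \<open>\<rho>\<close> on vertices and \<open>\<eta>\<close> on edges.
  On bi-infinite paths \<open>g\<close> acts by \<open>(\<lambda>x. \<eta> g \<circ> x)\<close>.
\<close>

definition graph_action ::
  "('g, 'm) monoid_scheme \<Rightarrow> 'v set \<Rightarrow> ('v \<Rightarrow> 'v \<Rightarrow> nat) \<Rightarrow>
   ('g \<Rightarrow> 'v \<Rightarrow> 'v) \<Rightarrow> ('g \<Rightarrow> 'v \<times> 'v \<times> nat \<Rightarrow> 'v \<times> 'v \<times> nat) \<Rightarrow> bool" where
  "graph_action G V A \<rho> \<eta> \<longleftrightarrow>
     group_action G V \<rho> \<and> group_action G (edges V A) \<eta> \<and>
     (\<forall>g\<in>carrier G. \<forall>e\<in>edges V A.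
        src (\<eta> g e) = \<rho> g (src e) \<and> tgt (\<eta> g e) = \<rho> g (tgt e))"


section \<open>The dimension group\<close>

text \<open>Row vectors in \<open>\<int>\<^sup>V\<close> are extensional functions on \<open>V\<close>.\<close>

definition row_vectors :: "'v set \<Rightarrow> ('v \<Rightarrow> int) set" where
  "row_vectors V = (V \<rightarrow>\<^sub>E UNIV)"

definition row_mult :: "'v set \<Rightarrow> ('v \<Rightarrow> int) \<Rightarrow> ('v \<Rightarrow> 'v \<Rightarrow> nat) \<Rightarrow> ('v \<Rightarrow> int)" where
  "row_mult V w A = (\<lambda>j\<in>V. \<Sum>i\<in>V. w i * int (A i j))"

definition dim_step :: "'v set \<Rightarrow> ('v \<Rightarrow> 'v \<Rightarrow> nat) \<Rightarrow> (('v \<Rightarrow> int) \<times> int) rel" where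
  "dim_step V A = {((w, n), (row_mult V w A, n + 1)) | w n. w \<in> row_vectors V}"

text \<open>The equivalence relation on \<open>\<int>\<^sup>V \<times> \<int>\<close> generated by \<open>dim_step\<close>:\<close>

definition dim_equiv :: "'v set \<Rightarrow> ('v \<Rightarrow> 'v \<Rightarrow> nat) \<Rightarrow> (('v \<Rightarrow> int) \<times> int) rel" where
  "dim_equiv V A =
     Id_on (row_vectors V \<times> UNIV) \<union> (dim_step V A \<union> (dim_step V A)\<inverse>)\<^sup>+"

definition dim_class :: "'v set \<Rightarrow> ('v \<Rightarrow> 'v \<Rightarrow> nat) \<Rightarrow> ('v \<Rightarrow> int) \<Rightarrow> int \<Rightarrow> (('v \<Rightarrow> int) \<times> int) set" where
  "dim_class V A w n = dim_equiv V A `` {(w, n)}"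

text \<open>
  Any two classes have representatives \<open>(v, n)\<close>, \<open>(w, n)\<close> at a common level \<open>n\<close>; the class of
  \<open>(v + w, n)\<close> does not depend on their choice, so the union below is a single class.
\<close>

definition dimension_group :: "'v set \<Rightarrow> ('v \<Rightarrow> 'v \<Rightarrow> nat) \<Rightarrow> (('v \<Rightarrow> int) \<times> int) set monoid" where
  "dimension_group V A =
     \<lparr>carrier = (row_vectors V \<times> UNIV) // dim_equiv V A,
      mult = \<lambda>c d. \<Union>{dim_class V A (\<lambda>i\<in>V. v i + w i) n | v w n. (v, n) \<in> c \<and> (w, n) \<in> d},
      one = dim_class V A (\<lambda>i\<in>V. 0) 0\<rparr>"

definition act_vector ::
  "('g, 'm) monoid_scheme \<Rightarrow> 'v set \<Rightarrow> ('g \<Rightarrow> 'v \<Rightarrow> 'v) \<Rightarrow> 'g \<Rightarrow> ('v \<Rightarrow> int) \<Rightarrow> ('v \<Rightarrow> int)" where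
  "act_vector G V \<rho> g w = (\<lambda>i\<in>V. w (\<rho> (inv\<^bsub>G\<^esub> g) i))"

text \<open>The induced action \<open>g \<cdot> [(w, n)] = [(g w, n)]\<close>, written as a map on classes.\<close>

definition dim_action ::
  "('g, 'm) monoid_scheme \<Rightarrow> 'v set \<Rightarrow> ('g \<Rightarrow> 'v \<Rightarrow> 'v) \<Rightarrow> 'g \<Rightarrow>
   (('v \<Rightarrow> int) \<times> int) set \<Rightarrow> (('v \<Rightarrow> int) \<times> int) set" where
  "dim_action G V \<rho> g c = (\<lambda>(w, n). (act_vector G V \<rho> g w, n)) ` c"


section \<open>Inert actions\<close>

text \<open>
  The dimension group representation of a free action on an SFT \<open>Y\<close> is read off from a
  \<open>G\<close>-equivariant conjugacy \<open>\<psi>\<close> from \<open>Y\<close> to an edge shift on which \<open>G\<close> acts by graph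
  automorphisms.  Such a \<open>\<psi>\<close> exists for every free action, and by functoriality of the dimension
  group the triviality of the representation does not depend on its choice.  The vertices are
  taken to be natural numbers, which is no restriction since \<open>V\<close> is finite.
\<close>

definition inert_action ::
  "('g, 'm) monoid_scheme \<Rightarrow> (int \<Rightarrow> 'a) set \<Rightarrow> ('g \<Rightarrow> (int \<Rightarrow> 'a) \<Rightarrow> (int \<Rightarrow> 'a)) \<Rightarrow> bool" where
  "inert_action G Y \<alpha> \<longleftrightarrow>
     (\<exists>(V :: nat set) A \<rho> \<eta> \<psi>.
        finite V \<and> nondegenerate V A \<and> graph_action G V A \<rho> \<eta> \<and>
        conjugacy Y shift (edge_shift V A) shift \<psi> \<and>
        (\<forall>g\<in>carrier G. \<forall>y\<in>Y. \<psi> (\<alpha> g y) = \<eta> g \<circ> \<psi> y) \<and>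
        (\<forall>g\<in>carrier G. \<forall>c\<in>carrier (dimension_group V A). dim_action G V \<rho> g c = c))"

end

theory Submission
  imports Defs "HOL-Number_Theory.Cong"
begin

text \<open>
  Realize the actions on edge shifts of matrices \<open>A\<close> and \<open>B\<close>.  Counting the pasts of images of
  points with a given past turns a conjugacy of \<open>\<sigma>\<^sup>l\<close> into a shift equivalence of \<open>A\<^sup>l\<close> and \<open>B\<^sup>l\<close>.
  The entries of \<open>A\<^sup>i R B\<^sup>j\<close> satisfy a linear recurrence in \<open>i\<close> and \<open>j\<close> that does not depend on \<open>l\<close>;
  comparing them modulo powers of a fixed prime shows that, for a suitable \<open>l\<close>, the same matrices
  multiplied by powers of \<open>A\<close> and \<open>B\<close> form a shift equivalence \<open>(R, S)\<close> of \<open>A\<close> and \<open>B\<close>.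
  Inertness means that the rows of a high power of \<open>A\<close> are constant on the orbits of \<open>G\<close>, so \<open>R\<close> and \<open>S\<close>
  can be taken invariant.

  Now let \<open>G\<close> act freely on the walks of length \<open>N\<close>.  For large \<open>l\<close> one has
  \<open>A\<^sup>l\<^sup>-\<^sup>N = R B\<^sup>N S\<close> and \<open>B\<^sup>l\<^sup>-\<^sup>N = S A\<^sup>N R\<close> after absorbing a power of \<open>A\<close> into \<open>S\<close>.  Cutting a
  bi-infinite path of \<open>A\<close> into alternate pieces of lengths \<open>N\<close> and \<open>l - N\<close>, each piece of length \<open>l - N\<close> can be
  recoded as a walk of length \<open>N\<close> in \<open>B\<close> together with two connecting edges counted by \<open>R\<close> and \<open>S\<close>.
  The recoding may depend on the neighbouring pieces, on which \<open>G\<close> acts freely, so it can be chosen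
  equivariant.  The resulting system treats \<open>A\<close> and \<open>B\<close> symmetrically.
\<close>


section \<open>Integer recurrences in two indices\<close>

text \<open>The given conjugacies are unrelated for different \<open>l\<close> and ignore
  \<open>G\<close>; only the matrices they induce are kept. Such a matrix R intertwines A^l and B^l,
  while one intertwining A and B is wanted. By telescoping, the \<open>l\<close>-step identity says
  that \<open>l\<close> neighbouring one-step defects on an antidiagonal add up to zero. If
  \<open>l\<close> is 1 modulo \<open>p\<close> and both index shifts have period dividing
  \<open>l - 1\<close> modulo \<open>p\<close>, these \<open>l\<close> defects are all congruent, so
  each of them vanishes modulo \<open>p\<close>. The defects divided by \<open>p\<close> satisfy the
  same hypotheses, so they are divisible by every power of \<open>p\<close> and vanish. For this the
  prime must be fixed before \<open>l\<close>, hence a recurrence that knows only A and B. On the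
  side of the group, the obstacle is that connecting edges carry no natural action. When R and S are
  invariant, \<open>G\<close> may leave their labels fixed. Equivariance of the recoding then costs
  nothing: a bijection is chosen for one pair of neighbouring walks in each orbit and transported,
  which is consistent because no such pair has a nontrivial stabilizer.\<close>

lemma integer_dependence:
  fixes u :: "'k \<Rightarrow> 'x \<Rightarrow> int"
  assumes "finite F" "finite K" "card F < card K"
  shows "\<exists>c. (\<exists>k\<in>K. c k \<noteq> 0) \<and> (\<forall>x\<in>F. (\<Sum>k\<in>K. c k * u k x) = 0)"
  using assms
proof (induction F arbitrary: K u rule: finite_induct)
  case empty
  then have "K \<noteq> {}" by auto
  then show ?case by (intro exI[of _ "\<lambda>_. 1"]) auto
next
  case (insert x F)
  show ?case
  proof (cases "\<exists>k0\<in>K. u k0 x \<noteq> 0")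
    case False
    obtain c where c: "\<exists>k\<in>K. c k \<noteq> 0" "\<forall>y\<in>F. (\<Sum>k\<in>K. c k * u k y) = 0"
      using insert.IH[of K u] insert.prems insert.hyps by auto
    have "(\<Sum>k\<in>K. c k * u k x) = 0" using False by (intro sum.neutral) auto
    with c show ?thesis by auto
  next
    case True
    then obtain k0 where k0: "k0 \<in> K" "u k0 x \<noteq> 0" by auto
    define K' where "K' = K - {k0}"
    have K': "finite K'" "card F < card K'" "K = insert k0 K'" "k0 \<notin> K'"
      using insert.prems insert.hyps k0 by (auto simp: K'_def)
    obtain c where c: "\<exists>k\<in>K'. c k \<noteq> 0"
      "\<And>y. y \<in> F \<Longrightarrow> (\<Sum>k\<in>K'. c k * (u k0 x * u k y - u k x * u k0 y)) = 0"
      using insert.IH[of K' "\<lambda>k y. u k0 x * u k y - u k x * u k0 y"] K' by auto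
    \<comment> \<open>A relation among the vectors cross-multiplied by the pivot
      \<open>u k0 x\<close> lifts to the original vectors: old coefficients are scaled by the pivot
      and \<open>k0\<close> collects the rest. No division occurs, and nonzero coefficients stay
      nonzero.\<close>
    define c' where "c' k = (if k = k0 then - (\<Sum>k\<in>K'. c k * u k x) else c k * u k0 x)" for k
    have eq: "(\<Sum>k\<in>K. c' k * u k y) = (\<Sum>k\<in>K'. c k * (u k0 x * u k y - u k x * u k0 y))" for y
    proof -
      have "(\<Sum>k\<in>K. c' k * u k y) = c' k0 * u k0 y + (\<Sum>k\<in>K'. c' k * u k y)"
        using K' by simp
      also have "(\<Sum>k\<in>K'. c' k * u k y) = (\<Sum>k\<in>K'. c k * u k0 x * u k y)"
        using K' by (intro sum.cong) (auto simp: c'_def)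
      also have "c' k0 * u k0 y = - (\<Sum>k\<in>K'. c k * u k x * u k0 y)"
        by (simp add: c'_def sum_distrib_right)
      finally show ?thesis by (simp add: algebra_simps sum_subtractf)
    qed
    have "(\<Sum>k\<in>K'. c k * (u k0 x * u k x - u k x * u k0 x)) = 0" by (intro sum.neutral) auto
    moreover have "\<exists>k\<in>K. c' k \<noteq> 0" using c(1) K' k0 by (auto simp: c'_def)
    ultimately show ?thesis using c(2) eq by (intro exI[of _ c']) auto
  qed
qed

text \<open>The extreme coefficients must be invertible modulo a suitable prime for the recurrence
  to run in both directions, so the zeros at both ends are cut off. Removing the low ones costs the
  delay \<open>r\<close>.\<close>

lemma trim_coefficients:
  fixes c :: "nat \<Rightarrow> int"
  assumes "\<exists>k\<le>n. c k \<noteq> 0"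
  obtains r d q where "q 0 \<noteq> 0" "q d \<noteq> (0::int)" "r + d \<le> n"
    "\<And>g :: nat \<Rightarrow> int. (\<Sum>k\<le>n. c k * g k) = (\<Sum>k\<le>d. q k * g (k + r))"
proof -
  define Z where "Z = {k. k \<le> n \<and> c k \<noteq> 0}"
  have Z: "finite Z" "Z \<noteq> {}" using assms by (auto simp: Z_def)
  define r where "r = Min Z"
  define d where "d = Max Z - r"
  have rM: "r \<in> Z" "Max Z \<in> Z" "r \<le> Max Z" using Z by (auto simp: r_def)
  have "(\<Sum>k\<le>n. c k * g k) = (\<Sum>k\<le>d. c (k + r) * g (k + r))" for g :: "nat \<Rightarrow> int"
  proof -
    have "(\<Sum>k\<le>n. c k * g k) = (\<Sum>k\<in>{r..r+d}. c k * g k)"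
    proof (rule sum.mono_neutral_right)
      show "{r..r + d} \<subseteq> {..n}" using rM by (auto simp: d_def Z_def)
      show "\<forall>i\<in>{..n} - {r..r + d}. c i * g i = 0"
      proof
        fix i assume i: "i \<in> {..n} - {r..r + d}"
        have "i \<notin> Z"
        proof
          assume "i \<in> Z"
          then have "r \<le> i" "i \<le> Max Z" using Z by (auto simp: r_def)
          then show False using i rM by (auto simp: d_def)
        qed
        then show "c i * g i = 0" using i by (auto simp: Z_def)
      qed
    qed simp
    also have "\<dots> = (\<Sum>k\<in>{0..d}. c (k + r) * g (k + r))"
      using sum.shift_bounds_cl_nat_ivl[of "\<lambda>k. c k * g k" 0 r d] by (simp add: add.commute)
    finally show ?thesis by (simp add: atLeast0AtMost)
  qed
  moreover have "c (0 + r) \<noteq> 0" "c (d + r) \<noteq> 0" "r + d \<le> n"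
    using rM by (auto simp: Z_def d_def)
  ultimately show thesis using that[of "\<lambda>k. c (k + r)" d r] by auto
qed

text \<open>Since both extreme coefficients are units modulo \<open>p\<close>, a window of
  \<open>d\<close> consecutive residues determines the sequence to the right and to the left. Two of
  the first \<open>p ^ d + 1\<close> windows coincide, and running the recurrence backward removes
  any preperiod.\<close>

lemma recurrence_periodic_mod:
  fixes g q :: "nat \<Rightarrow> int" and p :: nat
  assumes rec: "\<And>i. int p dvd (\<Sum>k\<le>d. q k * g (i + k))"
    and cop: "coprime (q 0) (int p)" "coprime (q d) (int p)" and p: "p > 0"
    and m: "fact (p ^ d) dvd m"
  shows "[g (i + m) = g i] (mod int p)"
proof -
  define E where "E i j \<longleftrightarrow> (\<forall>k. [g (i + k) = g (j + k)] (mod int p))" for i j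
  have split_last: "(\<Sum>k\<le>d. q k * g (i + k)) = q d * g (i + d) + (\<Sum>k<d. q k * g (i + k))" for i
    by (simp add: lessThan_Suc_atMost[symmetric])
  have split_first: "(\<Sum>k\<le>d. q k * g (i + k)) = q 0 * g i + (\<Sum>k=1..d. q k * g (i + k))" for i
    by (simp add: atMost_atLeast0 sum.atLeast_Suc_atMost)
  have dvd_cong: "[(\<Sum>k\<le>d. q k * g (i + k)) = (\<Sum>k\<le>d. q k * g (j + k))] (mod int p)" for i j
    using rec[of i] rec[of j] by (metis cong_0_iff cong_sym cong_trans)
  have forward: "E i j" if st: "\<forall>k<d. [g (i + k) = g (j + k)] (mod int p)" for i j
    unfolding E_def
  proof
    fix k show "[g (i + k) = g (j + k)] (mod int p)"
    proof (induction k rule: less_induct)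
      case (less k)
      show ?case
      proof (cases "k < d")
        case False
        then obtain e where e: "k = e + d" by (metis add.commute le_iff_add not_less)
        have "[(\<Sum>k<d. q k * g (i + e + k)) = (\<Sum>k<d. q k * g (j + e + k))] (mod int p)"
          using less e by (intro cong_sum cong_mult) (auto simp: add.assoc)
        from cong_diff[OF dvd_cong[of "i + e" "j + e"] this]
        have "[q d * g (i + e + d) = q d * g (j + e + d)] (mod int p)"
          unfolding split_last by simp
        then show ?thesis using cop by (simp add: e cong_mult_lcancel add.assoc)
      qed (use st in auto)
    qed
  qed
  have backward: "E i j" if E: "E (Suc i) (Suc j)" for i j
  proof -
    have sh: "[g (i + Suc k) = g (j + Suc k)] (mod int p)" for k
      using E by (auto simp: E_def)
    have "[(\<Sum>k=1..d. q k * g (i + k)) = (\<Sum>k=1..d. q k * g (j + k))] (mod int p)"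
    proof (intro cong_sum cong_mult cong_refl)
      fix k assume "k \<in> {1..d}"
      then show "[g (i + k) = g (j + k)] (mod int p)" using sh[of "k - 1"] by auto
    qed
    from cong_diff[OF dvd_cong[of i j] this] have "[q 0 * g i = q 0 * g j] (mod int p)"
      unfolding split_first by simp
    then have "[g i = g j] (mod int p)" using cop by (simp add: cong_mult_lcancel)
    then show ?thesis unfolding E_def
      using sh by (metis add_0_right not0_implies_Suc)
  qed
  define s where "s i = map (\<lambda>k. g (i + k) mod int p) [0..<d]" for i
  define L where "L = {xs. set xs \<subseteq> {0..<int p} \<and> length xs = d}"
  have L: "finite L" "card L = p ^ d"
    by (auto simp: L_def finite_lists_length_eq card_lists_length_eq)
  have "s ` {0..p ^ d} \<subseteq> L" using p by (auto simp: s_def L_def)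
  then have "card (s ` {0..p ^ d}) < card {0..p ^ d}"
    using L card_mono[of L "s ` {0..p ^ d}"] by auto
  then have "\<not> inj_on s {0..p ^ d}" using pigeonhole by blast
  then obtain a b where ab: "a < b" "b \<le> p ^ d" "s a = s b"
    unfolding inj_on_def by (metis atLeastAtMost_iff linorder_neqE_nat)
  have "E a b" using ab(3) by (intro forward) (auto simp: s_def cong_def)
  moreover have "E (0 + n) ((b - a) + n) \<Longrightarrow> E 0 (b - a)" for n
    by (induction n) (auto intro: backward)
  ultimately have E: "E 0 (b - a)" using ab(1) by (metis add_0 le_add_diff_inverse2 less_imp_le_nat)
  \<comment> \<open>The period found depends on the sequence but is at most \<open>p ^ d\<close>;
    the factorial makes \<open>m\<close> a multiple of every such number.\<close>
  have "b - a dvd m" using ab m by (intro dvd_trans[OF dvd_fact m]) auto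
  then obtain e where e: "m = (b - a) * e" by (rule dvdE)
  have "[g (i + (b - a) * e) = g i] (mod int p)"
  proof (induction e)
    case (Suc e)
    have "[g (0 + (i + (b - a) * e)) = g ((b - a) + (i + (b - a) * e))] (mod int p)"
      using E unfolding E_def by blast
    then have "[g (i + (b - a) * e) = g (i + (b - a) * Suc e)] (mod int p)"
      by (simp add: ac_simps)
    with Suc show ?case using cong_sym cong_trans by blast
  qed auto
  then show ?thesis using e by simp
qed

text \<open>Going from \<open>(i + l, j)\<close> to \<open>(i, j + l)\<close> one unit at a time
  writes the defect of the \<open>l\<close>-step identity as a sum of one-step defects.\<close>

lemma antidiagonal_telescope:
  fixes f :: "nat \<Rightarrow> nat \<Rightarrow> int"
  shows "(\<Sum>k<l. f (i + (l - 1 - k) + 1) (j + k) - f (i + (l - 1 - k)) (j + k + 1))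
    = f (i + l) j - f i (j + l)"
proof -
  have "(\<Sum>k<l. f (i + (l - 1 - k) + 1) (j + k) - f (i + (l - 1 - k)) (j + k + 1))
    = (\<Sum>k<l. f (i + (l - k)) (j + k) - f (i + (l - Suc k)) (j + Suc k))"
    by (intro sum.cong refl) (auto simp: Suc_diff_Suc)
  also have "\<dots> = f (i + (l - 0)) (j + 0) - f (i + (l - l)) (j + l)"
    using sum_lessThan_telescope'[of "\<lambda>k. f (i + (l - k)) (j + k)" l] by simp
  finally show ?thesis by simp
qed

text \<open>
  The double sequence is compared modulo powers of a prime \<open>p\<close> not dividing the extreme
  coefficients: modulo \<open>p\<close> both shifts are periodic with period dividing \<open>l - 1\<close>.
\<close>

lemma recurrences_unroot:
  fixes q :: "nat \<Rightarrow> int"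
  assumes q: "q 0 \<noteq> 0" "q d \<noteq> 0"
  obtains K where "K > 0"
    "\<And>(f :: nat \<Rightarrow> nat \<Rightarrow> int) m i j. \<lbrakk>\<And>i j. (\<Sum>k\<le>d. q k * f (i + k) j) = 0;
       \<And>i j. (\<Sum>k\<le>d. q k * f i (j + k)) = 0;
       \<And>i j. f (i + (1 + K * m)) j = f i (j + (1 + K * m))\<rbrakk> \<Longrightarrow> f (i + 1) j = f i (j + 1)"
proof -
  \<comment> \<open>This size keeps both extreme coefficients nonzero modulo
    \<open>p\<close>.\<close>
  obtain p :: nat where p: "prime p" "p > nat (\<bar>q 0\<bar> + \<bar>q d\<bar>)" using bigger_prime by blast
  have p0: "p > 1" using p(1) prime_gt_1_nat by blast
  have cop: "coprime x (int p)" if "x \<noteq> 0" "\<bar>x\<bar> < int p" for x :: int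
  proof -
    have "\<not> int p dvd x" using that zdvd_not_zless[of "\<bar>x\<bar>" "int p"] by auto
    then show ?thesis using p(1) prime_imp_coprime[of "int p" x]
      by (simp add: coprime_commute)
  qed
  have c0: "coprime (q 0) (int p)" and cd: "coprime (q d) (int p)"
    using q p(2) by (auto intro!: cop)
  \<comment> \<open>The factor \<open>p\<close> gives \<open>1 + K * m\<close> the residue 1 modulo
    \<open>p\<close>; the factorial makes \<open>K * m\<close> a period in both indices.\<close>
  define K where "K = p * fact (p ^ d)"
  have K0: "K > 0" using p0 by (auto simp: K_def)
  \<comment> \<open>\<open>H\<close> is meant for the one-step defect. Its last clause is what the
    \<open>l\<close>-step identity says about that defect after telescoping, and all clauses are
    homogeneous, so they survive division by \<open>p\<close>.\<close>
  define H where "H l f \<longleftrightarrow> (\<forall>i j. (\<Sum>k\<le>d. q k * f (i + k) j) = 0) \<and>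
    (\<forall>i j. (\<Sum>k\<le>d. q k * f i (j + k)) = 0) \<and>
    (\<forall>i j. (\<Sum>k<l. f (i + (l - 1 - k)) (j + k)) = 0)" for l and f :: "nat \<Rightarrow> nat \<Rightarrow> int"
  have base: "int p dvd f i j" if H: "H (1 + K * m) f" for f i j m
  proof -
    define l where "l = 1 + K * m"
    have H1: "\<And>i j. (\<Sum>k\<le>d. q k * f (i + k) j) = 0"
      and H2: "\<And>i j. (\<Sum>k\<le>d. q k * f i (j + k)) = 0"
      and H3: "\<And>i j. (\<Sum>k<l. f (i + (l - 1 - k)) (j + k)) = 0"
      using H by (auto simp: H_def l_def)
    have per1: "[f (i + K * m) j = f i j] (mod int p)" for i j
      using recurrence_periodic_mod[where g = "\<lambda>i. f i j" and q = q and d = d and p = p]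
        H1 c0 cd p0 by (auto simp: K_def)
    have per2: "[f i (j + K * m) = f i j] (mod int p)" for i j
      using recurrence_periodic_mod[where g = "\<lambda>j. f i j" and q = q and d = d and p = p]
        H2 c0 cd p0 by (auto simp: K_def)
    \<comment> \<open>The antidiagonal sums at \<open>(i + 1, j)\<close> and
      \<open>(i, j + 1)\<close> both vanish, and their difference telescopes.\<close>
    have fl: "f (i + l) j = f i (j + l)" for i j
      using antidiagonal_telescope[of f i l j] H3[of "i + 1" j] H3[of i "j + 1"]
      by (simp add: sum_subtractf add.commute add.left_commute)
    have step: "[f (i + 1) j = f i (j + 1)] (mod int p)" for i j
      using per1[of "i + 1" j] per2[of i "j + 1"] fl[of i j]
      by (simp add: l_def) (metis cong_sym cong_trans)
    have steps: "[f i (j + k) = f (i + k) j] (mod int p)" for i j k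
    proof (induction k arbitrary: i)
      case (Suc k)
      have "[f i (j + k + 1) = f (i + 1) (j + k)] (mod int p)"
        using step[of i "j + k"] by (simp add: cong_sym)
      with Suc[of "i + 1"] show ?case by (simp add: cong_trans)
    qed auto
    have "[f (i + (l - 1 - k)) (j + k) = f i j] (mod int p)" if "k < l" for k
    proof -
      have "[f (i + (l - 1 - k)) (j + k) = f (i + (l - 1 - k) + k) j] (mod int p)" by (rule steps)
      also have "i + (l - 1 - k) + k = i + K * m" using that by (auto simp: l_def)
      finally show ?thesis using per1 cong_trans by blast
    qed
    \<comment> \<open>All \<open>l\<close> summands agree with \<open>f i j\<close> modulo
      \<open>p\<close>, and \<open>l\<close> itself is 1 modulo \<open>p\<close>.\<close>
    then have "[(\<Sum>k<l. f (i + (l - 1 - k)) (j + k)) = (\<Sum>k<l. f i j)] (mod int p)"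
      by (intro cong_sum) auto
    then have "[int l * f i j = 0] (mod int p)" unfolding H3 by (simp add: cong_sym_eq)
    then have "int p dvd int l * f i j" by (simp only: cong_0_iff)
    moreover have "int l = 1 + int p * (fact (p ^ d) * int m)"
      by (simp add: l_def K_def of_nat_fact)
    ultimately have "int p dvd f i j + int p * (fact (p ^ d) * int m * f i j)"
      by (simp add: algebra_simps)
    then show ?thesis by (simp add: dvd_add_left_iff)
  qed
  have all: "int p ^ a dvd f i j" if "H (1 + K * m) f" for f i j m a
    using that
  proof (induction a arbitrary: f i j)
    case (Suc a)
    define f' where "f' i j = f i j div int p" for i j
    have f: "f i j = int p * f' i j" for i j
      using base[OF Suc.prems] by (simp add: f'_def)
    have fac: "(\<Sum>k\<in>A. c k * (int p * h k)) = int p * (\<Sum>k\<in>A. c k * h k)"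
      for A :: "nat set" and c h by (simp add: sum_distrib_left algebra_simps)
    have fac': "(\<Sum>k\<in>A. (int p * h k)) = int p * (\<Sum>k\<in>A. h k)"
      for A :: "nat set" and h by (simp add: sum_distrib_left algebra_simps)
    have "H (1 + K * m) f'" using Suc.prems p0 unfolding H_def f fac fac' by auto
    then have "int p ^ a dvd f' i j" by (rule Suc.IH)
    then show ?case by (simp add: f mult_dvd_mono)
  qed auto
  show thesis
  proof (rule that[OF K0])
    fix f :: "nat \<Rightarrow> nat \<Rightarrow> int" and m i j
    assume 1: "\<And>i j. (\<Sum>k\<le>d. q k * f (i + k) j) = 0"
      and 2: "\<And>i j. (\<Sum>k\<le>d. q k * f i (j + k)) = 0"
      and 3: "\<And>i j. f (i + (1 + K * m)) j = f i (j + (1 + K * m))"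
    define D where "D i j = f (i + 1) j - f i (j + 1)" for i j
    have "H (1 + K * m) D" unfolding H_def
    proof (intro conjI allI)
      fix i j
      show "(\<Sum>k\<le>d. q k * D (i + k) j) = 0" "(\<Sum>k\<le>d. q k * D i (j + k)) = 0"
        using 1[of "i + 1" j] 1[of i "j + 1"] 2[of "i + 1" j] 2[of i "j + 1"]
        by (auto simp: D_def sum_subtractf right_diff_distrib)
      show "(\<Sum>k<1 + K * m. D (i + (1 + K * m - 1 - k)) (j + k)) = 0"
        unfolding D_def using antidiagonal_telescope[of f i "1 + K * m" j] 3[of i j] by simp
    qed
    then have dvd: "int p ^ a dvd D i j" for a by (rule all)
    \<comment> \<open>Divisibility by every power of \<open>p\<close> leaves only zero, since
      \<open>p ^ n\<close> exceeds \<open>n\<close>.\<close>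
    have "D i j = 0"
    proof (rule ccontr)
      assume n0: "D i j \<noteq> 0"
      have "int (nat \<bar>D i j\<bar>) < int (2 ^ nat \<bar>D i j\<bar>)" by (simp only: of_nat_less_iff less_exp)
      also have "\<dots> \<le> int p ^ nat \<bar>D i j\<bar>" using p0 by (simp add: power_mono)
      finally have "\<bar>D i j\<bar> < int p ^ nat \<bar>D i j\<bar>" by simp
      then show False using dvd_imp_le_int[OF n0 dvd[of "nat \<bar>D i j\<bar>"]] p0 by simp
    qed
    then show "f (i + 1) j = f i (j + 1)" by (simp add: D_def)
  qed
qed

section \<open>Matrices and walks\<close>

definition mat_mul :: "'k set \<Rightarrow> ('i \<Rightarrow> 'k \<Rightarrow> nat) \<Rightarrow> ('k \<Rightarrow> 'j \<Rightarrow> nat) \<Rightarrow> 'i \<Rightarrow> 'j \<Rightarrow> nat" where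
  "mat_mul K M N = (\<lambda>i j. \<Sum>k\<in>K. M i k * N k j)"

text \<open>Matrices are total functions that vanish outside their index sets. Thus matrix
  identities are equalities of functions, and walks of length 0 act as an exact identity.\<close>

definition supported :: "'i set \<Rightarrow> 'j set \<Rightarrow> ('i \<Rightarrow> 'j \<Rightarrow> nat) \<Rightarrow> bool" where
  "supported I J M \<longleftrightarrow> (\<forall>i j. M i j \<noteq> 0 \<longrightarrow> i \<in> I \<and> j \<in> J)"

lemma mat_mul_assoc: "mat_mul L (mat_mul K M N) Q = mat_mul K M (mat_mul L N Q)"
proof (intro ext)
  fix i j
  have "mat_mul L (mat_mul K M N) Q i j = (\<Sum>l\<in>L. \<Sum>k\<in>K. M i k * N k l * Q l j)"
    by (simp add: mat_mul_def sum_distrib_right)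
  also have "\<dots> = (\<Sum>k\<in>K. \<Sum>l\<in>L. M i k * N k l * Q l j)" by (rule sum.swap)
  also have "\<dots> = mat_mul K M (mat_mul L N Q) i j"
    by (simp add: mat_mul_def sum_distrib_left mult.assoc)
  finally show "mat_mul L (mat_mul K M N) Q i j = mat_mul K M (mat_mul L N Q) i j" .
qed

lemma supported_mat_mul:
  assumes "supported I K M" "supported K J N"
  shows "supported I J (mat_mul L M N)"
  unfolding supported_def
proof (intro allI impI)
  fix i j assume "mat_mul L M N i j \<noteq> 0"
  then obtain k where "M i k * N k j \<noteq> 0"
    unfolding mat_mul_def by (meson sum.neutral)
  with assms show "i \<in> I \<and> j \<in> J" by (auto simp: supported_def)
qed

lemma supported_zero: "supported I J M \<Longrightarrow> i \<notin> I \<or> j \<notin> J \<Longrightarrow> M i j = 0"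
  by (auto simp: supported_def)

fun walk :: "'v set \<Rightarrow> ('v \<Rightarrow> 'v \<Rightarrow> nat) \<Rightarrow> 'v \<Rightarrow> ('v \<times> 'v \<times> nat) list \<Rightarrow> 'v \<Rightarrow> bool" where
  "walk V A i [] j \<longleftrightarrow> i = j \<and> i \<in> V"
| "walk V A i (e # es) j \<longleftrightarrow> e \<in> edges V A \<and> src e = i \<and> walk V A (tgt e) es j"

definition walks :: "'v set \<Rightarrow> ('v \<Rightarrow> 'v \<Rightarrow> nat) \<Rightarrow> nat \<Rightarrow> 'v \<Rightarrow> 'v \<Rightarrow> ('v \<times> 'v \<times> nat) list set" where
  "walks V A n i j = {es. length es = n \<and> walk V A i es j}"

text \<open>The \<open>n\<close>-th power of the matrix \<open>A\<close> on \<open>V\<close>, taken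
  as the size of a set so that equalities between entries can be turned into bijections.\<close>

definition num_walks :: "'v set \<Rightarrow> ('v \<Rightarrow> 'v \<Rightarrow> nat) \<Rightarrow> nat \<Rightarrow> 'v \<Rightarrow> 'v \<Rightarrow> nat" where
  "num_walks V A n i j = card (walks V A n i j)"

lemma edges_src_tgt: "e \<in> edges V A \<Longrightarrow> src e \<in> V \<and> tgt e \<in> V"
  by (auto simp: edges_def src_def tgt_def)

lemma finite_edges: assumes "finite V" shows "finite (edges V A)"
proof -
  have "edges V A = (\<Union>i\<in>V. \<Union>j\<in>V. (\<lambda>k. (i, j, k)) ` {..<A i j})"
    by (auto simp: edges_def)
  with assms show ?thesis by auto
qed

lemma walk_ends: "walk V A i es j \<Longrightarrow> i \<in> V \<and> j \<in> V"
  by (induction es arbitrary: i) (auto dest: edges_src_tgt)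

lemma walk_edges: "walk V A i es j \<Longrightarrow> set es \<subseteq> edges V A"
  by (induction es arbitrary: i) auto

lemma walk_append: "walk V A i (es @ fs) j \<longleftrightarrow> (\<exists>k. walk V A i es k \<and> walk V A k fs j)"
  by (induction es arbitrary: i) (auto dest: walk_ends)

lemma walk_src: "walk V A i es j \<Longrightarrow> es \<noteq> [] \<Longrightarrow> src (hd es) = i"
  by (cases es) auto

lemma walk_unique_end: "walk V A i es j \<Longrightarrow> walk V A i es j' \<Longrightarrow> j = j'"
  by (induction es arbitrary: i) auto

lemma finite_walks: assumes "finite V" shows "finite (walks V A n i j)"
proof (rule finite_subset)
  show "walks V A n i j \<subseteq> {es. set es \<subseteq> edges V A \<and> length es = n}"
    by (auto simp: walks_def dest: walk_edges)
  show "finite {es. set es \<subseteq> edges V A \<and> length es = n}"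
    by (intro finite_lists_length_eq finite_edges assms)
qed

lemma supported_num_walks: "supported V V (num_walks V A n)"
proof -
  have "walks V A n i j = {}" if "i \<notin> V \<or> j \<notin> V" for i j
    using that by (auto simp: walks_def dest: walk_ends)
  then show ?thesis unfolding supported_def num_walks_def by (metis card.empty)
qed

lemma num_walks_add:
  fixes V :: "'v set"
  assumes "finite V"
  shows "num_walks V A (m + n) = mat_mul V (num_walks V A m) (num_walks V A n)"
proof (intro ext)
  fix i j
  define T where "T k = (\<lambda>(a, b). a @ b) ` (walks V A m i k \<times> walks V A n k j)" for k
  have eq: "walks V A (m + n) i j = (\<Union>k\<in>V. T k)"
  proof (intro Set.set_eqI iffI)
    fix es assume "es \<in> walks V A (m + n) i j"
    then have es: "length es = m + n" "walk V A i es j" by (auto simp: walks_def)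
    then have "walk V A i (take m es @ drop m es) j" by simp
    then obtain k where k: "walk V A i (take m es) k" "walk V A k (drop m es) j"
      unfolding walk_append by blast
    then have "es \<in> T k" using es
      by (auto simp: T_def walks_def intro!: image_eqI[of _ _ "(take m es, drop m es)"])
    then show "es \<in> (\<Union>k\<in>V. T k)" using k walk_ends by fast
  qed (auto simp: T_def walks_def walk_append)
  have fin: "finite (T k)" for k using assms by (auto simp: T_def finite_walks)
  have "card (\<Union>k\<in>V. T k) = (\<Sum>k\<in>V. card (T k))"
  proof (intro card_UN_disjoint assms ballI impI)
    fix k k' :: 'v assume "k \<noteq> k'"
    have "k'' = k" if "es \<in> T k''" "es \<in> T k" for es k k''
    proof -
      have end_take: "walk V A i (take m es) k" if "es \<in> T k" for k
        using that by (auto simp: T_def walks_def)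
      show ?thesis using that end_take walk_unique_end by fast
    qed
    with \<open>k \<noteq> k'\<close> show "T k \<inter> T k' = {}" by blast
  qed (use fin in auto)
  moreover have "card (T k) = num_walks V A m i k * num_walks V A n k j" for k
  proof -
    have "inj_on (\<lambda>(a, b). a @ b) (walks V A m i k \<times> walks V A n k j)"
      by (auto simp: inj_on_def walks_def)
    then show ?thesis by (simp add: T_def card_image card_cartesian_product num_walks_def)
  qed
  ultimately show "num_walks V A (m + n) i j = mat_mul V (num_walks V A m) (num_walks V A n) i j"
    unfolding num_walks_def eq by (simp add: mat_mul_def)
qed

lemma num_walks_0: "num_walks V A 0 i j = (if i = j \<and> i \<in> V then 1 else 0)"
proof -
  have "walks V A 0 i j = (if i = j \<and> i \<in> V then {[]} else {})"
    by (auto simp: walks_def)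
  then show ?thesis by (auto simp: num_walks_def)
qed

lemma num_walks_1:
  assumes "i \<in> V" "j \<in> V"
  shows "num_walks V A 1 i j = A i j"
proof -
  have "walks V A 1 i j = (\<lambda>k. [(i, j, k)]) ` {..<A i j}"
    using assms by (auto simp: walks_def length_Suc_conv edges_def src_def tgt_def)
  then show ?thesis by (simp add: num_walks_def card_image inj_on_def)
qed

lemma num_walks_0_left:
  assumes "finite V" "supported V W M"
  shows "mat_mul V (num_walks V A 0) M = M"
proof (intro ext)
  fix i j
  have "mat_mul V (num_walks V A 0) M i j = (\<Sum>k\<in>V. if k = i then M i j else 0)"
    unfolding mat_mul_def by (intro sum.cong) (auto simp: num_walks_0)
  then show "mat_mul V (num_walks V A 0) M i j = M i j"
    using assms by (auto simp: supported_zero)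
qed

lemma num_walks_0_right:
  assumes "finite V" "supported W V M"
  shows "mat_mul V M (num_walks V A 0) = M"
proof (intro ext)
  fix i j
  have "mat_mul V M (num_walks V A 0) i j = (\<Sum>k\<in>V. if k = j then M i j else 0)"
    unfolding mat_mul_def by (intro sum.cong) (auto simp: num_walks_0)
  then show "mat_mul V M (num_walks V A 0) i j = M i j"
    using assms by (auto simp: supported_zero)
qed

section \<open>Points of edge shifts\<close>

lemma edge_shift_iff:
  "x \<in> edge_shift V A \<longleftrightarrow> (\<forall>i. x i \<in> edges V A) \<and> (\<forall>i. tgt (x i) = src (x (i + 1)))"
  by (auto simp: edge_shift_def full_shift_def)

lemma shift_power: "(shift ^^ n) x = (\<lambda>i. x (i + int n))"
proof (induction n arbitrary: x)
  case (Suc n)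
  show ?case unfolding funpow_Suc_right comp_def Suc.IH
    by (auto simp: shift_def algebra_simps)
qed auto

definition translate :: "int \<Rightarrow> (int \<Rightarrow> 'a) \<Rightarrow> (int \<Rightarrow> 'a)" where
  "translate c x = (\<lambda>i. x (i + c))"

lemma shift_power_translate: "shift ^^ n = translate (int n)"
  by (rule ext) (simp add: shift_power translate_def)

lemma translate_edge_shift: "x \<in> edge_shift V A \<Longrightarrow> translate c x \<in> edge_shift V A"
proof -
  assume x: "x \<in> edge_shift V A"
  have "tgt (x (i + c)) = src (x (i + c + 1))" for i using x by (simp add: edge_shift_iff)
  moreover have "i + c + 1 = i + 1 + c" for i by simp
  ultimately show ?thesis using x unfolding edge_shift_iff translate_def by metis
qed

lemma edge_shift_walk:
  assumes "x \<in> edge_shift V A"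
  shows "walk V A (src (x t)) (map (\<lambda>k. x (t + int k)) [0..<n]) (src (x (t + int n)))"
proof (induction n)
  case 0
  have "x t \<in> edges V A" using assms by (auto simp: edge_shift_iff)
  then show ?case by (auto dest: edges_src_tgt)
next
  case (Suc n)
  have "x (t + int n) \<in> edges V A" "x (t + int n + 1) \<in> edges V A"
    "tgt (x (t + int n)) = src (x (t + int n + 1))"
    using assms by (auto simp: edge_shift_iff)
  then have "walk V A (src (x (t + int n))) [x (t + int n)] (src (x (t + int n + 1)))"
    by (auto dest: edges_src_tgt)
  with Suc show ?case by (auto simp: walk_append algebra_simps)
qed

definition splice :: "int \<Rightarrow> (int \<Rightarrow> 'a) \<Rightarrow> (int \<Rightarrow> 'a) \<Rightarrow> (int \<Rightarrow> 'a)" where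
  "splice t x y = (\<lambda>i. if i < t then x i else y i)"

lemma splice_edge_shift:
  assumes "x \<in> edge_shift V A" "y \<in> edge_shift V A" "src (x t) = src (y t)"
  shows "splice t x y \<in> edge_shift V A"
  unfolding edge_shift_iff
proof (intro conjI allI)
  fix i
  show "splice t x y i \<in> edges V A" using assms by (auto simp: splice_def edge_shift_iff)
  consider "i + 1 < t" | "i + 1 = t" | "t \<le> i" by linarith
  then show "tgt (splice t x y i) = src (splice t x y (i + 1))"
    using assms by cases (auto simp: splice_def edge_shift_iff)
qed

lemma edge_shift_point:
  assumes nd: "nondegenerate V A" and v: "v \<in> V"
  obtains x where "x \<in> edge_shift V A" "src (x t) = v"
proof -
  define nxt where "nxt i = (SOME j. j \<in> V \<and> A i j \<noteq> 0)" for i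
  define prv where "prv j = (SOME i. i \<in> V \<and> A i j \<noteq> 0)" for j
  have nxt: "nxt i \<in> V" "A i (nxt i) \<noteq> 0" if "i \<in> V" for i
    using someI_ex[of "\<lambda>j. j \<in> V \<and> A i j \<noteq> 0"] nd that
    by (auto simp: nxt_def nondegenerate_def)
  have prv: "prv j \<in> V" "A (prv j) j \<noteq> 0" if "j \<in> V" for j
    using someI_ex[of "\<lambda>i. i \<in> V \<and> A i j \<noteq> 0"] nd that
    by (auto simp: prv_def nondegenerate_def)
  define f where "f i = (if 0 \<le> i then (nxt ^^ nat i) v else (prv ^^ nat (- i)) v)" for i :: int
  have nV: "(nxt ^^ n) v \<in> V" for n by (induction n) (auto simp: v nxt)
  have pV: "(prv ^^ n) v \<in> V" for n by (induction n) (auto simp: v prv)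
  have fV: "f i \<in> V" for i by (auto simp: f_def nV pV)
  have fA: "A (f i) (f (i + 1)) \<noteq> 0" for i
  proof (cases "0 \<le> i")
    case True
    then have "nat (i + 1) = Suc (nat i)" by auto
    then show ?thesis using True nxt(2)[OF nV] by (auto simp: f_def)
  next
    case False
    then have "nat (- i) = Suc (nat (- (i + 1)))" by auto
    moreover have "f (i + 1) = (prv ^^ nat (- (i + 1))) v" using False by (auto simp: f_def)
    ultimately have "f i = prv (f (i + 1))" using False by (simp add: f_def)
    then show ?thesis using prv(2)[OF fV] by metis
  qed
  show thesis
  proof (rule that)
    show "(\<lambda>i. (f (i - t), f (i - t + 1), 0)) \<in> edge_shift V A"
      unfolding edge_shift_iff
    proof (intro conjI allI)
      fix i
      show "(f (i - t), f (i - t + 1), 0) \<in> edges V A"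
        using fV fA[of "i - t"] by (auto simp: edges_def)
      have "i - t + 1 = i + 1 - t" by simp
      then have "f (i - t + 1) = f (i + 1 - t)" by (rule arg_cong)
      then show "tgt (f (i - t), f (i - t + 1), 0 :: nat)
        = src (f (i + 1 - t), f (i + 1 - t + 1), 0 :: nat)"
        by (simp only: src_def tgt_def fst_conv snd_conv)
    qed
    show "src ((\<lambda>i. (f (i - t), f (i - t + 1), 0)) t) = v" by (simp add: src_def f_def)
  qed
qed

text \<open>Nondegeneracy supplies a future for the end of any walk, so every walk can follow every
  past that stops at its first vertex. This lets counts of pasts of points be read as counts of
  walks.\<close>

lemma walk_realized:
  assumes nd: "nondegenerate V A"
  shows "\<lbrakk>x \<in> edge_shift V A; walk V A (src (x t)) es j\<rbrakk> \<Longrightarrow>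
    \<exists>y\<in>edge_shift V A. (\<forall>k<t. y k = x k) \<and> (\<forall>k<length es. y (t + int k) = es ! k)
      \<and> src (y (t + int (length es))) = j"
proof (induction es arbitrary: x t)
  case Nil
  then show ?case by (intro bexI[of _ x]) auto
next
  case (Cons e es)
  then have e: "e \<in> edges V A" "src e = src (x t)" "walk V A (tgt e) es j" by auto
  then obtain z where z: "z \<in> edge_shift V A" "src (z (t + 1)) = tgt e"
    using edge_shift_point[OF nd, of "tgt e" "t + 1"] edges_src_tgt by metis
  define z' where "z' = (\<lambda>i. if i < t then x i else if i = t then e else z i)"
  have "z' \<in> edge_shift V A" unfolding edge_shift_iff
  proof (intro conjI allI)
    fix i
    show "z' i \<in> edges V A" using Cons.prems z e by (auto simp: z'_def edge_shift_iff)
    consider "i + 1 < t" | "i + 1 = t" | "i = t" | "t < i" by linarith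
    then show "tgt (z' i) = src (z' (i + 1))"
      using Cons.prems z e by cases (auto simp: z'_def edge_shift_iff)
  qed
  moreover have "src (z' (t + 1)) = tgt e" using z by (simp add: z'_def)
  ultimately obtain y where y: "y \<in> edge_shift V A" "\<forall>k<t + 1. y k = z' k"
    "\<forall>k<length es. y (t + 1 + int k) = es ! k" "src (y (t + 1 + int (length es))) = j"
    using Cons.IH[of z' "t + 1"] e by auto
  have "y (t + int k) = (e # es) ! k" if "k < length (e # es)" for k
    using that y by (cases k) (auto simp: z'_def algebra_simps)
  moreover have "\<forall>k<t. y k = x k" using y(2) by (auto simp: z'_def)
  ultimately show ?case using y by (intro bexI[of _ y]) (auto simp: algebra_simps)
qed

section \<open>Counting images of pasts\<close>

text \<open>\<open>restrict\<close> puts a fixed value from \<open>t\<close> on, so agreement before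
  \<open>t\<close> is equality of functions and pasts can be counted as elements of a set.\<close>

definition past :: "int \<Rightarrow> (int \<Rightarrow> 'a) \<Rightarrow> (int \<Rightarrow> 'a)" where
  "past t x = restrict x {..<t}"

lemma past_eq_iff: "past t x = past t y \<longleftrightarrow> (\<forall>i<t. x i = y i)"
  by (auto simp: past_def restrict_def fun_eq_iff)

text \<open>Locality on half-lines, with a loss \<open>N\<close> that is uniform in
  \<open>t\<close>. It does not speak of the shift, because the maps commute only with some power of
  it.\<close>

definition windowed :: "int \<Rightarrow> (int \<Rightarrow> 'a) set \<Rightarrow> ((int \<Rightarrow> 'a) \<Rightarrow> (int \<Rightarrow> 'b)) \<Rightarrow> bool" where
  "windowed N X \<phi> \<longleftrightarrow> (\<forall>x\<in>X. \<forall>y\<in>X. \<forall>t.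
     ((\<forall>i<t. x i = y i) \<longrightarrow> (\<forall>i<t - N. \<phi> x i = \<phi> y i)) \<and>
     ((\<forall>i\<ge>t. x i = y i) \<longrightarrow> (\<forall>i\<ge>t + N. \<phi> x i = \<phi> y i)))"

lemma windowed_past:
  "\<lbrakk>windowed N X \<phi>; x \<in> X; y \<in> X; \<forall>i<t. x i = y i; i < t - N\<rbrakk> \<Longrightarrow> \<phi> x i = \<phi> y i"
  unfolding windowed_def by blast

lemma windowed_future:
  "\<lbrakk>windowed N X \<phi>; x \<in> X; y \<in> X; \<forall>i\<ge>t. x i = y i; i \<ge> t + N\<rbrakk> \<Longrightarrow> \<phi> x i = \<phi> y i"
  unfolding windowed_def by blast

definition coded :: "int \<Rightarrow> (int \<Rightarrow> 'a) set \<Rightarrow> (int \<Rightarrow> 'b) set \<Rightarrow> ((int \<Rightarrow> 'a) \<Rightarrow> (int \<Rightarrow> 'b)) \<Rightarrow>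
  ((int \<Rightarrow> 'b) \<Rightarrow> (int \<Rightarrow> 'a)) \<Rightarrow> bool" where
  "coded N X Y \<phi> \<phi>' \<longleftrightarrow> N \<ge> 0 \<and> (\<forall>x\<in>X. \<phi> x \<in> Y \<and> \<phi>' (\<phi> x) = x) \<and> (\<forall>y\<in>Y. \<phi>' y \<in> X \<and> \<phi> (\<phi>' y) = y)
     \<and> windowed N X \<phi> \<and> windowed N Y \<phi>'"

lemma coded_sym: "coded N X Y \<phi> \<phi>' \<Longrightarrow> coded N Y X \<phi>' \<phi>"
  by (auto simp: coded_def)

lemma coded_id: "coded 0 X X (\<lambda>x. x) (\<lambda>x. x)"
  by (auto simp: coded_def windowed_def)

lemma coded_past_inverse:
  assumes "coded N X Y \<phi> \<phi>'" "x \<in> X" "y \<in> X" "\<forall>i<m. \<phi> x i = \<phi> y i" "i < m - N"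
  shows "x i = y i"
  using windowed_past[of N Y \<phi>' "\<phi> x" "\<phi> y" m i] assms by (auto simp: coded_def)

text \<open>All points continuing \<open>q\<close> are considered, and the pasts of their images are
  sorted by the vertex \<open>j\<close> reached at time \<open>m\<close>. The sizes of these sets
  are the entries of the matrix representing \<open>\<phi>\<close>.\<close>

definition images ::
  "((int \<Rightarrow> 'a) \<Rightarrow> (int \<Rightarrow> 'v \<times> 'v \<times> nat)) \<Rightarrow> (int \<Rightarrow> 'a) set \<Rightarrow> int \<Rightarrow> int \<Rightarrow> (int \<Rightarrow> 'a) \<Rightarrow> 'v
    \<Rightarrow> (int \<Rightarrow> 'v \<times> 'v \<times> nat) set" where
  "images \<phi> X t m q j = (\<lambda>y. past m (\<phi> y)) ` {y \<in> X. past t y = q \<and> src (\<phi> y m) = j}"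

lemma card_image_same_kernel:
  assumes "\<And>a b. a \<in> S \<Longrightarrow> b \<in> S \<Longrightarrow> f a = f b \<longleftrightarrow> g a = g b"
  shows "card (f ` S) = card (g ` S)"
proof -
  define h where "h u = g (SOME a. a \<in> S \<and> f a = u)" for u
  have h: "h (f a) = g a" if "a \<in> S" for a
  proof -
    have "(SOME b. b \<in> S \<and> f b = f a) \<in> S \<and> f (SOME b. b \<in> S \<and> f b = f a) = f a"
      using that by (intro someI[of "\<lambda>b. b \<in> S \<and> f b = f a" a]) auto
    then show ?thesis using assms that unfolding h_def by blast
  qed
  have "inj_on h (f ` S)" using assms h by (auto simp: inj_on_def)
  moreover have "h ` f ` S = g ` S" using h by (auto simp: image_image)
  ultimately show ?thesis by (metis card_image)
qed

lemma same_past_src: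
  assumes "x \<in> edge_shift V A" "y \<in> edge_shift V A" "past t x = past t y"
  shows "src (x t) = src (y t)"
proof -
  have "x (t - 1) = y (t - 1)" using assms(3) by (simp add: past_eq_iff)
  moreover have "tgt (x (t - 1)) = src (x (t - 1 + 1))" "tgt (y (t - 1)) = src (y (t - 1 + 1))"
    using assms(1,2) unfolding edge_shift_iff by blast+
  ultimately show ?thesis by simp
qed

text \<open>Below \<open>m - 2 * N\<close> the new images agree because the inverse map makes the
  points agree below \<open>m - N\<close>; from \<open>t + N\<close> on they inherit agreement from
  the unchanged futures. The margin \<open>3 * N\<close> makes these two ranges cover everything
  before \<open>m\<close>.\<close>

lemma images_transfer:
  assumes c: "coded N X Y \<phi> \<phi>'" and ab: "a \<in> X" "b \<in> X" "a' \<in> X" "b' \<in> X"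
    and fut: "\<forall>i\<ge>t. a' i = a i" "\<forall>i\<ge>t. b' i = b i" and pst: "\<forall>i<t. a' i = b' i"
    and m: "m \<ge> t + 3 * N" and eq: "past m (\<phi> a) = past m (\<phi> b)"
  shows "past m (\<phi> a') = past m (\<phi> b')"
proof -
  have eq': "\<forall>i<m. \<phi> a i = \<phi> b i" using eq by (simp add: past_eq_iff)
  have "a' i = b' i" if "i < m - N" for i
    using coded_past_inverse[OF c ab(1,2) eq' that] fut pst by (cases "i < t") auto
  then have 1: "\<phi> a' i = \<phi> b' i" if "i < m - N - N" for i
    using windowed_past[of N X \<phi> a' b' "m - N" i] c ab that by (auto simp: coded_def)
  have 2: "\<phi> a' i = \<phi> b' i" if "i \<ge> t + N" "i < m" for i
    using windowed_future[of N X \<phi> a' a t i] windowed_future[of N X \<phi> b' b t i] c ab fut eq' that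
    by (auto simp: coded_def)
  show ?thesis unfolding past_eq_iff
  proof (intro allI impI)
    fix i assume "i < m"
    then show "\<phi> a' i = \<phi> b' i" using 1[of i] 2[of i] m by linarith
  qed
qed

text \<open>Splicing carries the continuations of one past onto those of the other. Applied in both
  directions, \<open>images_transfer\<close> shows that two continuations have images with equal
  pasts before splicing exactly when they have so afterwards.\<close>

lemma images_independent:
  assumes c: "coded N (edge_shift V A) Y \<phi> \<phi>'"
    and x: "x \<in> edge_shift V A" "x' \<in> edge_shift V A" "src (x t) = src (x' t)"
    and m: "m \<ge> t + 3 * N"
  shows "card (images \<phi> (edge_shift V A) t m (past t x) j)
    = card (images \<phi> (edge_shift V A) t m (past t x') j)"
proof -
  define X where "X = edge_shift V A"
  define S where "S x = {y \<in> X. past t y = past t x \<and> src (\<phi> y m) = j}" for x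
  have N0: "N \<ge> 0" using c by (simp add: coded_def)
  have mov: "splice t u y \<in> S u \<and> splice t u y \<in> X"
    if u: "u \<in> X" "v \<in> X" "src (u t) = src (v t)" "y \<in> S v" for u v y
  proof -
    have y: "y \<in> X" "past t y = past t v" "src (\<phi> y m) = j" using u by (auto simp: S_def)
    then have "src (y t) = src (u t)" using u same_past_src[of y V A v t] by (auto simp: X_def)
    then have X: "splice t u y \<in> X"
      using splice_edge_shift[of u V A y t] u y by (auto simp: X_def)
    have "\<phi> (splice t u y) m = \<phi> y m"
      using windowed_future[of N X \<phi> "splice t u y" y t m] c X y m N0
      by (auto simp: coded_def X_def[symmetric] splice_def)
    then show ?thesis using X y by (auto simp: S_def past_eq_iff splice_def)
  qed
  have x': "x \<in> X" "x' \<in> X" using x by (auto simp: X_def)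
  have "splice t x' ` S x = S x'"
  proof (intro equalityI subsetI)
    fix y assume y: "y \<in> S x'"
    then have "splice t x y \<in> S x" using mov[of x x' y] x' x(3) by auto
    moreover have "splice t x' (splice t x y) = y"
      using y by (auto simp: S_def splice_def past_eq_iff)
    ultimately show "y \<in> splice t x' ` S x" by (metis imageI)
  qed (use mov[of x' x] x' x(3) in auto)
  then have "card (images \<phi> X t m (past t x') j) = card ((\<lambda>y. past m (\<phi> (splice t x' y))) ` S x)"
    unfolding images_def S_def[symmetric] by (metis (no_types, lifting) image_cong image_image)
  also have "\<dots> = card ((\<lambda>y. past m (\<phi> y)) ` S x)"
  proof (rule card_image_same_kernel)
    fix a b assume ab: "a \<in> S x" "b \<in> S x"
    have X: "a \<in> X" "b \<in> X" "splice t x' a \<in> X" "splice t x' b \<in> X"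
      using ab mov[of x' x] x' x(3) by (auto simp: S_def)
    have ag: "\<forall>i<t. a i = b i" using ab by (auto simp: S_def past_eq_iff)
    show "past m (\<phi> (splice t x' a)) = past m (\<phi> (splice t x' b)) \<longleftrightarrow> past m (\<phi> a) = past m (\<phi> b)"
      using images_transfer[OF c[folded X_def] X, of t m] ag
        images_transfer[OF c[folded X_def] X(3,4,1,2), of t m] m
      by (auto simp: splice_def)
  qed
  finally show ?thesis by (simp add: images_def S_def X_def)
qed

text \<open>Before \<open>t - N\<close> the image is determined by \<open>q\<close>, so only the
  finitely many coordinates from there up to \<open>m\<close> can vary.\<close>

lemma finite_images:
  assumes c: "coded N X (edge_shift W B) \<phi> \<phi>'" and W: "finite W"
  shows "finite (images \<phi> X t m q j)"
proof -
  define I where "I = {t - N..<m}"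
  define g where "g p = restrict p I" for p :: "int \<Rightarrow> 'b \<times> 'b \<times> nat"
  have "inj_on g (images \<phi> X t m q j)"
  proof (rule inj_onI)
    fix p p' assume p: "p \<in> images \<phi> X t m q j" "p' \<in> images \<phi> X t m q j" "g p = g p'"
    then obtain y y' where y: "p = past m (\<phi> y)" "y \<in> X" "past t y = q"
      "p' = past m (\<phi> y')" "y' \<in> X" "past t y' = q" by (auto simp: images_def)
    have "\<forall>i<t. y i = y' i" using y past_eq_iff[of t y y'] by simp
    then have "\<phi> y i = \<phi> y' i" if "i < t - N" for i
      using windowed_past[of N X \<phi> y y' t i] c y that by (simp add: coded_def)
    moreover have "\<phi> y i = \<phi> y' i" if "i \<ge> t - N" "i < m" for i
      using fun_cong[OF p(3), of i] that y by (auto simp: g_def I_def past_def)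
    ultimately have "\<forall>i<m. \<phi> y i = \<phi> y' i" by (metis not_less)
    then show "p = p'" using y by (simp add: past_eq_iff)
  qed
  moreover have "finite (g ` images \<phi> X t m q j)"
  proof (rule finite_subset)
    show "g ` images \<phi> X t m q j \<subseteq> (I \<rightarrow>\<^sub>E edges W B)"
      using c by (auto simp: images_def g_def I_def past_def coded_def edge_shift_iff)
    show "finite (I \<rightarrow>\<^sub>E edges W B)" by (intro finite_PiE finite_edges W) (auto simp: I_def)
  qed
  ultimately show ?thesis by (metis finite_imageD)
qed

text \<open>The chosen point is harmless when \<open>m \<ge> t + 3 * N\<close>, since the count then
  depends only on its vertex at time \<open>t\<close>. The value 0 off \<open>V\<close> keeps the
  matrix supported.\<close>

definition transition ::
  "((int \<Rightarrow> 'v \<times> 'v \<times> nat) \<Rightarrow> (int \<Rightarrow> 'w \<times> 'w \<times> nat)) \<Rightarrow> 'v set \<Rightarrow> ('v \<Rightarrow> 'v \<Rightarrow> nat) \<Rightarrow>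
    int \<Rightarrow> int \<Rightarrow> 'v \<Rightarrow> 'w \<Rightarrow> nat" where
  "transition \<phi> V A t m i j = (if i \<in> V then
     card (images \<phi> (edge_shift V A) t m (past t (SOME x. x \<in> edge_shift V A \<and> src (x t) = i)) j) else 0)"

lemma some_point:
  assumes "nondegenerate V A" "i \<in> V"
  shows "(SOME x. x \<in> edge_shift V A \<and> src (x t) = i) \<in> edge_shift V A"
    "src ((SOME x. x \<in> edge_shift V A \<and> src (x t) = i) t) = i"
proof -
  have "\<exists>x. x \<in> edge_shift V A \<and> src (x t) = i" using edge_shift_point[OF assms] by metis
  from someI_ex[OF this] show "(SOME x. x \<in> edge_shift V A \<and> src (x t) = i) \<in> edge_shift V A"
    "src ((SOME x. x \<in> edge_shift V A \<and> src (x t) = i) t) = i" by auto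
qed

lemma src_in: "x \<in> edge_shift V A \<Longrightarrow> src (x t) \<in> V"
  using edges_src_tgt[of "x t" V A] by (simp add: edge_shift_iff)

lemma transition_eq:
  assumes "coded N (edge_shift V A) Y \<phi> \<phi>'" "nondegenerate V A"
    "x \<in> edge_shift V A" "m \<ge> t + 3 * N"
  shows "card (images \<phi> (edge_shift V A) t m (past t x) j) = transition \<phi> V A t m (src (x t)) j"
  unfolding transition_def
  using images_independent[OF assms(1,3) some_point(1)[OF assms(2)]] some_point(2)[OF assms(2)]
    src_in[OF assms(3)] assms(4) by auto

text \<open>The past of \<open>\<chi> (\<phi> y)\<close> before \<open>m'\<close> determines that of
  \<open>\<phi> y\<close> before \<open>m\<close>. Sorting by the latter therefore splits the count
  into disjoint pieces, and their sizes depend only on the intermediate vertex at time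
  \<open>m\<close>.\<close>

lemma images_compose:
  assumes c: "coded N1 (edge_shift V A) (edge_shift W B) \<phi> \<phi>'"
    and d: "coded N2 (edge_shift W B) (edge_shift U C) \<chi> \<chi>'"
    and fin: "finite W" "finite U" and nd: "nondegenerate V A" "nondegenerate W B"
    and x: "x \<in> edge_shift V A" and m: "m \<ge> t + 3 * N1" "m' \<ge> m + 3 * N2"
  shows "card (images (\<lambda>y. \<chi> (\<phi> y)) (edge_shift V A) t m' (past t x) j)
    = (\<Sum>k\<in>W. transition \<phi> V A t m (src (x t)) k * transition \<chi> W B m m' k j)"
proof -
  define X where "X = edge_shift V A"
  define Y where "Y = edge_shift W B"
  define Q where "Q k = images \<phi> X t m (past t x) k" for k
  define P where "P q = images \<chi> Y m m' q j" for q
  have N: "N1 \<ge> 0" "N2 \<ge> 0" using c d by (auto simp: coded_def)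
  have Qk: "\<exists>z\<in>Y. q = past m z \<and> src (z m) = k \<and> past t (\<phi>' z) = past t x" if "q \<in> Q k" for q k
  proof -
    from that have "q \<in> images \<phi> X t m (past t x) k" by (simp only: Q_def)
    then obtain y where "y \<in> X" "past t y = past t x" "src (\<phi> y m) = k" "q = past m (\<phi> y)"
      unfolding images_def by blast
    then show ?thesis using c by (intro bexI[of _ "\<phi> y"]) (auto simp: coded_def X_def Y_def)
  qed
  have eq: "images (\<lambda>y. \<chi> (\<phi> y)) X t m' (past t x) j = (\<Union>q\<in>(\<Union>k\<in>W. Q k). P q)"
  proof (intro equalityI subsetI)
    fix p assume "p \<in> images (\<lambda>y. \<chi> (\<phi> y)) X t m' (past t x) j"
    then obtain y where y: "y \<in> X" "past t y = past t x" "src (\<chi> (\<phi> y) m') = j"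
      "p = past m' (\<chi> (\<phi> y))" by (auto simp: images_def)
    then have "\<phi> y \<in> Y" using c by (auto simp: coded_def X_def Y_def)
    then have "p \<in> P (past m (\<phi> y))" "past m (\<phi> y) \<in> Q (src (\<phi> y m))" "src (\<phi> y m) \<in> W"
      using y src_in[of "\<phi> y" W B m] by (auto simp: P_def Q_def images_def Y_def)
    then show "p \<in> (\<Union>q\<in>(\<Union>k\<in>W. Q k). P q)" by blast
  next
    fix p assume "p \<in> (\<Union>q\<in>(\<Union>k\<in>W. Q k). P q)"
    then obtain k q where kq: "q \<in> Q k" "p \<in> P q" by blast
    obtain z where z: "z \<in> Y" "q = past m z" "past t (\<phi>' z) = past t x" using Qk[OF kq(1)] by blast
    obtain z' where z': "z' \<in> Y" "past m z' = past m z" "src (\<chi> z' m') = j" "p = past m' (\<chi> z')"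
      using kq z by (auto simp: P_def images_def)
    \<comment> \<open>A change of the intermediate point from \<open>m\<close> on does not reach its
      preimage before \<open>t\<close>, so every continuation of an intermediate past still comes
      from the past of \<open>x\<close>.\<close>
    have "\<phi>' z' i = \<phi>' z i" if "i < t" for i
      using windowed_past[of N1 Y \<phi>' z' z m i] c z z' that m N past_eq_iff[of m z' z]
      by (auto simp: coded_def Y_def)
    then have "past t (\<phi>' z') = past t x" using z(3) by (simp add: past_eq_iff)
    moreover have "\<phi>' z' \<in> X" "\<phi> (\<phi>' z') = z'" using z' c by (auto simp: coded_def X_def Y_def)
    ultimately show "p \<in> images (\<lambda>y. \<chi> (\<phi> y)) X t m' (past t x) j"
      using z' unfolding images_def by (intro image_eqI[of _ _ "\<phi>' z'"]) auto
  qed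
  have disjP: "q = q'" if pq: "q \<in> Q k" "q' \<in> Q k'" "p \<in> P q" "p \<in> P q'" for q q' k k' p
  proof -
    obtain z where z: "z \<in> Y" "past m z = q" "p = past m' (\<chi> z)"
      using pq(3) unfolding P_def images_def by blast
    obtain z' where z': "z' \<in> Y" "past m z' = q'" "p = past m' (\<chi> z')"
      using pq(4) unfolding P_def images_def by blast
    have "\<forall>i<m'. \<chi> z i = \<chi> z' i" using z z' by (simp add: past_eq_iff[symmetric])
    then have "z i = z' i" if "i < m" for i
      using coded_past_inverse[OF d, of z z' m' i] z z' that m N by (auto simp: Y_def)
    then show ?thesis using z z' past_eq_iff[of m z z'] by simp
  qed
  have finQ: "finite (Q k)" for k unfolding Q_def X_def by (rule finite_images[OF c fin(1)])
  have finP: "finite (P q)" for q unfolding P_def Y_def by (rule finite_images[OF d fin(2)])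
  have disjQ: "k = k'" if q: "q \<in> Q k" "q \<in> Q k'" for k k' q
  proof -
    obtain z where z: "z \<in> Y" "q = past m z" "src (z m) = k" using Qk[OF q(1)] by blast
    obtain z' where z': "z' \<in> Y" "q = past m z'" "src (z' m) = k'" using Qk[OF q(2)] by blast
    show ?thesis using same_past_src[of z W B z' m] z z' by (simp add: Y_def)
  qed
  have cardP: "card (P q) = transition \<chi> W B m m' k j" if qk: "q \<in> Q k" for q k
  proof -
    obtain z where "z \<in> Y" "q = past m z" "src (z m) = k" using Qk[OF qk] by blast
    then show ?thesis using transition_eq[OF d nd(2) _ m(2), of z j] by (simp add: P_def Y_def)
  qed
  have cardQ: "card (Q k) = transition \<phi> V A t m (src (x t)) k" for k
    using transition_eq[OF c nd(1) x m(1)] by (simp add: Q_def X_def)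
  have "card (images (\<lambda>y. \<chi> (\<phi> y)) X t m' (past t x) j) = (\<Sum>q\<in>(\<Union>k\<in>W. Q k). card (P q))"
    unfolding eq
  proof (intro card_UN_disjoint ballI impI)
    fix q q' assume q: "q \<in> (\<Union>k\<in>W. Q k)" "q' \<in> (\<Union>k\<in>W. Q k)" "q \<noteq> q'"
    then show "P q \<inter> P q' = {}" using disjP by blast
  qed (use fin finQ finP in auto)
  also have "\<dots> = (\<Sum>k\<in>W. \<Sum>q\<in>Q k. card (P q))"
  proof (intro sum.UNION_disjoint ballI impI fin finQ)
    fix k k' assume "k \<in> W" "k' \<in> W" "k \<noteq> k'"
    then show "Q k \<inter> Q k' = {}" using disjQ by blast
  qed
  also have "\<dots> = (\<Sum>k\<in>W. transition \<phi> V A t m (src (x t)) k * transition \<chi> W B m m' k j)"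
    by (intro sum.cong) (auto simp: cardP cardQ)
  finally show ?thesis by (simp add: X_def)
qed

lemma transition_compose:
  assumes c: "coded N1 (edge_shift V A) (edge_shift W B) \<phi> \<phi>'"
    and d: "coded N2 (edge_shift W B) (edge_shift U C) \<chi> \<chi>'"
    and fin: "finite W" "finite U" and nd: "nondegenerate V A" "nondegenerate W B"
    and m: "m \<ge> t + 3 * N1" "m' \<ge> m + 3 * N2"
  shows "transition (\<lambda>y. \<chi> (\<phi> y)) V A t m'
    = mat_mul W (transition \<phi> V A t m) (transition \<chi> W B m m')"
proof (intro ext)
  fix i j
  show "transition (\<lambda>y. \<chi> (\<phi> y)) V A t m' i j
    = mat_mul W (transition \<phi> V A t m) (transition \<chi> W B m m') i j"
  proof (cases "i \<in> V")
    case True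
    then show ?thesis
      using images_compose[OF c d fin nd some_point(1)[OF nd(1) True] m] some_point(2)[OF nd(1) True]
      by (simp add: transition_def[of "\<lambda>y. \<chi> (\<phi> y)"] mat_mul_def)
  qed (simp add: transition_def mat_mul_def)
qed

text \<open>An extension of a given past from \<open>t\<close> to \<open>t + n\<close> is just a
  walk of length \<open>n\<close> starting at its end vertex.\<close>

lemma images_identity:
  assumes nd: "nondegenerate V A" and x: "x \<in> edge_shift V A"
  shows "card (images (\<lambda>x. x) (edge_shift V A) t (t + int n) (past t x) j) = num_walks V A n (src (x t)) j"
proof -
  define S where "S = {y \<in> edge_shift V A. past t y = past t x \<and> src (y (t + int n)) = j}"
  define g where "g y = map (\<lambda>k. y (t + int k)) [0..<n]" for y :: "int \<Rightarrow> 'a \<times> 'a \<times> nat"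
  have "past (t + int n) a = past (t + int n) b \<longleftrightarrow> g a = g b" if "a \<in> S" "b \<in> S" for a b
  proof -
    have ag: "a i = b i" if "i < t" for i
      using \<open>a \<in> S\<close> \<open>b \<in> S\<close> that by (auto simp: S_def past_eq_iff)
    have "past (t + int n) a = past (t + int n) b" if "g a = g b"
      unfolding past_eq_iff
    proof (intro allI impI)
      fix i assume i: "i < t + int n"
      show "a i = b i"
      proof (cases "i < t")
        case False
        then have "nat (i - t) < n" "i = t + int (nat (i - t))" using i by auto
        moreover have "\<forall>k<n. a (t + int k) = b (t + int k)" using that by (auto simp: g_def)
        ultimately show ?thesis by metis
      qed (use ag in auto)
    qed
    then show ?thesis by (auto simp: g_def past_eq_iff)
  qed
  then have "card (images (\<lambda>x. x) (edge_shift V A) t (t + int n) (past t x) j) = card (g ` S)"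
    unfolding images_def S_def[symmetric] by (rule card_image_same_kernel)
  also have "g ` S = walks V A n (src (x t)) j"
  proof (intro equalityI subsetI)
    fix es assume "es \<in> g ` S"
    then obtain y where "y \<in> S" "es = g y" by auto
    then show "es \<in> walks V A n (src (x t)) j"
      using edge_shift_walk[of y V A t n] same_past_src[of y V A x t] x
      by (auto simp: S_def g_def walks_def)
  next
    fix es assume "es \<in> walks V A n (src (x t)) j"
    then have es: "length es = n" "walk V A (src (x t)) es j" by (auto simp: walks_def)
    obtain y where "y \<in> edge_shift V A" "\<forall>k<t. y k = x k" "\<forall>k<length es. y (t + int k) = es ! k"
      "src (y (t + int (length es))) = j"
      using walk_realized[OF nd x es(2)] by blast
    then have "y \<in> S" "g y = es" using es by (auto simp: S_def past_eq_iff g_def intro!: nth_equalityI)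
    then show "es \<in> g ` S" by blast
  qed
  finally show ?thesis by (simp add: num_walks_def)
qed

lemma transition_identity:
  assumes "nondegenerate V A"
  shows "transition (\<lambda>x. x) V A t (t + int n) = num_walks V A n"
proof (intro ext)
  fix i j
  show "transition (\<lambda>x. x) V A t (t + int n) i j = num_walks V A n i j"
  proof (cases "i \<in> V")
    case True
    then show ?thesis
      using images_identity[OF assms some_point(1)[OF assms True, of t], of t n j]
        some_point(2)[OF assms True, of t] by (simp add: transition_def)
  next
    case False
    then show ?thesis
      using supported_zero[OF supported_num_walks, of i V j A n] by (simp add: transition_def)
  qed
qed

lemma images_cong:
  assumes "\<And>x. x \<in> X \<Longrightarrow> \<phi> x = \<chi> x"
  shows "images \<phi> X = images \<chi> X"
  unfolding images_def using assms by (intro ext image_cong) auto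

lemma transition_cong:
  assumes "\<And>x. x \<in> edge_shift V A \<Longrightarrow> \<phi> x = \<chi> x"
  shows "transition \<phi> V A = transition \<chi> V A"
  unfolding transition_def using images_cong[of "edge_shift V A" \<phi> \<chi>, OF assms]
  by (simp cong: if_cong)

lemma supported_transition:
  assumes "coded N (edge_shift V A) (edge_shift W B) \<phi> \<phi>'" "nondegenerate V A"
  shows "supported V W (transition \<phi> V A t m)"
  unfolding supported_def
proof (intro allI impI)
  fix i j assume "transition \<phi> V A t m i j \<noteq> 0"
  then have "i \<in> V" and ne: "images \<phi> (edge_shift V A) t m
      (past t (SOME x. x \<in> edge_shift V A \<and> src (x t) = i)) j \<noteq> {}"
    by (auto simp: transition_def split: if_splits)
  from ne obtain y where "y \<in> edge_shift V A" "src (\<phi> y m) = j"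
    by (auto simp: images_def)
  then show "i \<in> V \<and> j \<in> W"
    using \<open>i \<in> V\<close> assms(1) src_in[of "\<phi> y" W B m] by (auto simp: coded_def)
qed

lemma translate_translate: "translate c (translate d x) = translate (c + d) x"
  by (simp add: translate_def algebra_simps fun_eq_iff)

lemma images_translate:
  assumes com: "\<And>x. x \<in> edge_shift V A \<Longrightarrow> \<phi> (translate c x) = translate c (\<phi> x)"
  shows "card (images \<phi> (edge_shift V A) t m (past t (translate c x)) j)
    = card (images \<phi> (edge_shift V A) (t + c) (m + c) (past (t + c) x) j)"
proof -
  define X where "X = edge_shift V A"
  define S where "S = {y \<in> X. past (t + c) y = past (t + c) x \<and> src (\<phi> y (m + c)) = j}"
  define S' where "S' = {y \<in> X. past t y = past t (translate c x) \<and> src (\<phi> y m) = j}"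
  have com': "\<phi> (translate c y) m = \<phi> y (m + c)" if "y \<in> X" for y m
    using com[of y] that by (simp add: translate_def X_def)
  have tr: "past t (translate c a) = past t (translate c b) \<longleftrightarrow> past (t + c) a = past (t + c) b"
    for t and a b :: "int \<Rightarrow> 'd"
  proof -
    have "a i = b i" if "\<forall>i<t. a (i + c) = b (i + c)" "i < t + c" for i
      using that(1)[rule_format, of "i - c"] that(2) by simp
    then show ?thesis by (auto simp: past_eq_iff translate_def)
  qed
  have "S' = translate c ` S"
  proof (intro equalityI subsetI)
    fix y assume y: "y \<in> S'"
    have X: "translate (- c) y \<in> X" using y translate_edge_shift by (auto simp: S'_def X_def)
    have yy: "translate c (translate (- c) y) = y" by (simp add: translate_def)
    have "past (t + c) (translate (- c) y) = past (t + c) x"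
      using y tr[of t "translate (- c) y" x] yy by (simp add: S'_def)
    moreover have "src (\<phi> (translate (- c) y) (m + c)) = j"
      using com'[OF X, of m] yy y by (simp add: S'_def)
    ultimately have "translate (- c) y \<in> S" using X by (simp add: S_def)
    then show "y \<in> translate c ` S" using yy by (metis imageI)
  qed (auto simp: S_def S'_def X_def tr com' translate_edge_shift)
  then have "card (images \<phi> X t m (past t (translate c x)) j)
      = card ((\<lambda>y. past m (\<phi> (translate c y))) ` S)"
    unfolding images_def S'_def[symmetric] by (simp add: image_image)
  also have "\<dots> = card ((\<lambda>y. past (m + c) (\<phi> y)) ` S)"
  proof (rule card_image_same_kernel)
    fix a b assume "a \<in> S" "b \<in> S"
    then have "\<phi> (translate c a) = translate c (\<phi> a)" "\<phi> (translate c b) = translate c (\<phi> b)"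
      using com by (auto simp: S_def X_def)
    then show "past m (\<phi> (translate c a)) = past m (\<phi> (translate c b)) \<longleftrightarrow>
      past (m + c) (\<phi> a) = past (m + c) (\<phi> b)"
      unfolding past_eq_iff translate_def
      by (metis add_strict_right_mono diff_add_cancel diff_less_eq)
  qed
  finally show ?thesis by (simp add: images_def S_def X_def)
qed

text \<open>Moving both times by \<open>c\<close> does not change the matrix. This is where
  commuting with \<open>shift ^^ l\<close> becomes an intertwining of the \<open>l\<close>-th
  powers.\<close>

lemma transition_translate:
  assumes c: "coded N (edge_shift V A) Y \<phi> \<phi>'" and nd: "nondegenerate V A"
    and com: "\<And>x. x \<in> edge_shift V A \<Longrightarrow> \<phi> (translate c x) = translate c (\<phi> x)"
    and m: "m \<ge> t + 3 * N"
  shows "transition \<phi> V A (t + c) (m + c) = transition \<phi> V A t m"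
proof (intro ext)
  fix i j
  show "transition \<phi> V A (t + c) (m + c) i j = transition \<phi> V A t m i j"
  proof (cases "i \<in> V")
    case True
    obtain x where x: "x \<in> edge_shift V A" "src (x (t + c)) = i"
      using edge_shift_point[OF nd True] by metis
    then have "src (translate c x t) = i" by (simp add: translate_def)
    then show ?thesis
      using images_translate[of V A \<phi> c t m x j] com x(2)
        transition_eq[OF c nd translate_edge_shift[OF x(1)] m, of c j]
        transition_eq[OF c nd x(1), of "t + c" "m + c" j] m by simp
  qed (simp add: transition_def)
qed

section \<open>Shift equivalence\<close>

text \<open>Shift equivalence of the \<open>l\<close>-th powers, with a lag \<open>c\<close>
  measured in single steps and not in multiples of \<open>l\<close>. For \<open>l = 1\<close> it is
  shift equivalence in the sense of Williams.\<close>

definition shift_equivalence ::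
  "'v set \<Rightarrow> ('v \<Rightarrow> 'v \<Rightarrow> nat) \<Rightarrow> 'w set \<Rightarrow> ('w \<Rightarrow> 'w \<Rightarrow> nat) \<Rightarrow> nat \<Rightarrow> nat \<Rightarrow>
    ('v \<Rightarrow> 'w \<Rightarrow> nat) \<Rightarrow> ('w \<Rightarrow> 'v \<Rightarrow> nat) \<Rightarrow> bool" where
  "shift_equivalence V A W B l c R S \<longleftrightarrow> supported V W R \<and> supported W V S \<and>
     mat_mul V (num_walks V A l) R = mat_mul W R (num_walks W B l) \<and>
     mat_mul W (num_walks W B l) S = mat_mul V S (num_walks V A l) \<and>
     mat_mul W R S = num_walks V A c \<and> mat_mul V S R = num_walks W B c"

lemma shift_equivalence_sym:
  "shift_equivalence V A W B l c R S \<Longrightarrow> shift_equivalence W B V A l c S R"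
  by (auto simp: shift_equivalence_def)

lemma windowed_mono:
  assumes "windowed N X \<phi>" "N \<le> M"
  shows "windowed M X \<phi>"
proof -
  have "i < t - N" if "i < t - M" for i t :: int using that assms(2) by linarith
  moreover have "t + N \<le> i" if "t + M \<le> i" for i t :: int using that assms(2) by linarith
  ultimately show ?thesis using assms(1) unfolding windowed_def by meson
qed

lemma coded_mono: "coded N X Y \<phi> \<phi>' \<Longrightarrow> N \<le> M \<Longrightarrow> coded M X Y \<phi> \<phi>'"
  unfolding coded_def using windowed_mono[of N X \<phi> M] windowed_mono[of N Y \<phi>' M] by auto

lemma translate_multiple:
  assumes com: "\<And>x. x \<in> edge_shift V A \<Longrightarrow> \<phi> (translate c x) = translate c (\<phi> x)"
    and x: "x \<in> edge_shift V A"
  shows "\<phi> (translate (c * int n) x) = translate (c * int n) (\<phi> x)"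
proof (induction n)
  case 0
  then show ?case by (simp add: translate_def)
next
  case (Suc n)
  have eq: "translate (c * int (Suc n)) z = translate c (translate (c * int n) z)" for z :: "int \<Rightarrow> 'x"
    by (simp add: translate_translate algebra_simps)
  show ?case by (simp only: eq com[OF translate_edge_shift[OF x]] Suc.IH)
qed

lemma coded_commute_inverse:
  assumes c: "coded N (edge_shift V A) (edge_shift W B) \<phi> \<phi>'"
    and com: "\<And>x. x \<in> edge_shift V A \<Longrightarrow> \<phi> (translate c x) = translate c (\<phi> x)"
    and y: "y \<in> edge_shift W B"
  shows "\<phi>' (translate c y) = translate c (\<phi>' y)"
proof -
  have "\<phi>' y \<in> edge_shift V A" "\<phi> (\<phi>' y) = y" using c y by (auto simp: coded_def)
  then have "\<phi> (translate c (\<phi>' y)) = translate c y" "translate c (\<phi>' y) \<in> edge_shift V A"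
    using com translate_edge_shift by metis+
  then show ?thesis using c by (metis coded_def)
qed

text \<open>Each identity computes the matrix of one map between two times in two ways: walking
  before applying the map or after it, and \<open>\<phi>\<close> followed by \<open>\<phi>'\<close>
  or simply walking.\<close>

lemma coded_shift_equivalence:
  assumes c: "coded N (edge_shift V A) (edge_shift W B) \<phi> \<phi>'" and l: "l > 0"
    and com: "\<And>x. x \<in> edge_shift V A \<Longrightarrow> \<phi> (translate (int l) x) = translate (int l) (\<phi> x)"
    and fin: "finite V" "finite W" and nd: "nondegenerate V A" "nondegenerate W B"
  shows "\<exists>R S c. shift_equivalence V A W B l c R S"
proof -
  define n where "n = nat N"
  have N: "N = int n" using c by (simp add: n_def coded_def)
  \<comment> \<open>The loss \<open>N\<close> is enlarged to \<open>l * n\<close>, so that the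
    required margin of three losses equals \<open>s\<close> and is a multiple of
    \<open>l\<close>.\<close>
  define s where "s = l * (3 * n)"
  have "N \<le> int (l * n)" using l by (simp only: N of_nat_le_iff) simp
  with c have c': "coded (int (l * n)) (edge_shift V A) (edge_shift W B) \<phi> \<phi>'" by (rule coded_mono)
  note d' = coded_sym[OF c']
  have com': "\<phi>' (translate (int l) x) = translate (int l) (\<phi>' x)" if "x \<in> edge_shift W B" for x
    using coded_commute_inverse[OF c com that] .
  have s3: "int s = 3 * int (l * n)" by (simp add: s_def)
  define R where "R = transition \<phi> V A 0 (int s)"
  define S where "S = transition \<phi>' W B (int s) (int s + int s)"
  have supp: "supported V W R" "supported W V S"
    using supported_transition[OF c' nd(1)] supported_transition[OF d' nd(2)]
    by (auto simp: R_def S_def)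
  have RB: "mat_mul V (num_walks V A l) R = mat_mul W R (num_walks W B l)"
  proof -
    have "mat_mul V (transition (\<lambda>x. x) V A 0 (int l)) (transition \<phi> V A (int l) (int s + int l))
        = transition \<phi> V A 0 (int s + int l)"
      by (rule transition_compose[OF coded_id c' fin nd(1,1), symmetric]) (auto simp: s3)
    also have "\<dots> = mat_mul W (transition \<phi> V A 0 (int s)) (transition (\<lambda>x. x) W B (int s) (int s + int l))"
      by (rule transition_compose[OF c' coded_id fin(2,2) nd]) (auto simp: s3)
    also have "transition (\<lambda>x. x) W B (int s) (int s + int l) = num_walks W B l"
      by (rule transition_identity[OF nd(2)])
    also have "transition (\<lambda>x. x) V A 0 (int l) = num_walks V A l"
      using transition_identity[OF nd(1), of 0 l] by simp
    also have "transition \<phi> V A (int l) (int s + int l) = R"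
      using transition_translate[OF c' nd(1) com, where t = 0 and m = "int s"] by (simp add: R_def s3)
    finally show ?thesis by (simp add: R_def)
  qed
  have SA: "mat_mul W (num_walks W B l) S = mat_mul V S (num_walks V A l)"
  proof -
    have "mat_mul W (transition (\<lambda>x. x) W B (int s) (int s + int l))
        (transition \<phi>' W B (int s + int l) (int s + int s + int l))
        = transition \<phi>' W B (int s) (int s + int s + int l)"
      by (rule transition_compose[OF coded_id d' fin(2,1) nd(2,2), symmetric]) (auto simp: s3)
    also have "\<dots> = mat_mul V (transition \<phi>' W B (int s) (int s + int s))
        (transition (\<lambda>x. x) V A (int s + int s) (int s + int s + int l))"
      by (rule transition_compose[OF d' coded_id fin(1,1) nd(2,1)]) (auto simp: s3)
    also have "transition (\<lambda>x. x) V A (int s + int s) (int s + int s + int l) = num_walks V A l"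
      by (rule transition_identity[OF nd(1)])
    also have "transition (\<lambda>x. x) W B (int s) (int s + int l) = num_walks W B l"
      by (rule transition_identity[OF nd(2)])
    also have "transition \<phi>' W B (int s + int l) (int s + int s + int l) = S"
      using transition_translate[OF d' nd(2) com', where t = "int s" and m = "int s + int s"]
      by (simp add: S_def s3)
    finally show ?thesis by (simp add: S_def)
  qed
  have RS: "mat_mul W R S = num_walks V A (2 * s)"
  proof -
    have "mat_mul W R S = transition (\<lambda>y. \<phi>' (\<phi> y)) V A 0 (int s + int s)"
      unfolding R_def S_def
      by (rule transition_compose[OF c' d' fin(2,1) nd, symmetric]) (auto simp: s3)
    also have "transition (\<lambda>y. \<phi>' (\<phi> y)) V A = transition (\<lambda>y. y) V A"
      using c by (intro transition_cong) (auto simp: coded_def)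
    also have "transition (\<lambda>y. y) V A 0 (int s + int s) = num_walks V A (2 * s)"
      using transition_identity[OF nd(1), of 0 "2 * s"] by simp
    finally show ?thesis .
  qed
  have SR: "mat_mul V S R = num_walks W B (2 * s)"
  proof -
    have com2: "\<phi> (translate (int s + int s) x) = translate (int s + int s) (\<phi> x)"
      if "x \<in> edge_shift V A" for x
      using translate_multiple[where \<phi> = \<phi> and c = "int l", OF com that, of "6 * n"] by (simp add: s_def algebra_simps)
    \<comment> \<open>\<open>S\<close> ends at time \<open>2 * s\<close>, so \<open>R\<close> is
      moved there from time 0; this is possible because \<open>2 * s\<close> is a multiple of
      \<open>l\<close>.\<close>
    have R: "R = transition \<phi> V A (int s + int s) (int s + int s + int s)"
      using transition_translate[OF c' nd(1) com2, where t = 0 and m = "int s"]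
      by (simp add: R_def s3 algebra_simps)
    have "mat_mul V S R = transition (\<lambda>y. \<phi> (\<phi>' y)) W B (int s) (int s + int s + int s)"
      unfolding R S_def
      by (rule transition_compose[OF d' c' fin nd(2,1), symmetric]) (auto simp: s3)
    also have "transition (\<lambda>y. \<phi> (\<phi>' y)) W B = transition (\<lambda>y. y) W B"
      using c by (intro transition_cong) (auto simp: coded_def)
    also have "transition (\<lambda>y. y) W B (int s) (int s + int s + int s) = num_walks W B (2 * s)"
      using transition_identity[OF nd(2), of "int s" "2 * s"] by (simp add: algebra_simps)
    finally show ?thesis .
  qed
  show ?thesis using supp RB SA RS SR unfolding shift_equivalence_def by blast
qed

section \<open>From the powers of two matrices back to the matrices themselves\<close>

lemma walks_recurrence:
  assumes fin: "finite V" "finite W"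
  obtains r d and q :: "nat \<Rightarrow> int" where "q 0 \<noteq> 0" "q d \<noteq> 0"
    "\<And>i v v'. (\<Sum>k\<le>d. q k * int (num_walks V A (i + k + r) v v')) = 0"
    "\<And>i w w'. (\<Sum>k\<le>d. q k * int (num_walks W B (i + k + r) w w')) = 0"
proof -
  \<comment> \<open>The coordinates are all entries of both matrices. The powers from 0 to
    \<open>n\<close> are one more than the coordinates, so a single integer relation holds for
    \<open>A\<close> and \<open>B\<close> simultaneously.\<close>
  define F where "F = (V \<times> V) <+> (W \<times> W)"
  define n where "n = card F"
  define u where "u k x = (case x of Inl p \<Rightarrow> int (num_walks V A k (fst p) (snd p))
     | Inr p \<Rightarrow> int (num_walks W B k (fst p) (snd p)))" for k x
  obtain c where c: "\<exists>k\<in>{..n}. c k \<noteq> 0" "\<And>x. x \<in> F \<Longrightarrow> (\<Sum>k\<in>{..n}. c k * u k x) = 0"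
    using integer_dependence[of F "{..n}" u] fin by (auto simp: F_def n_def)
  have rec: "(\<Sum>k\<le>n. c k * int (num_walks U C (i + k) v v')) = 0"
    if U: "finite U" and c': "\<And>v v'. v \<in> U \<Longrightarrow> v' \<in> U \<Longrightarrow> (\<Sum>k\<le>n. c k * int (num_walks U C k v v')) = 0"
    for U and C :: "'x \<Rightarrow> 'x \<Rightarrow> nat" and i v v'
  proof (cases "v' \<in> U")
    case True
    have "(\<Sum>k\<le>n. c k * int (num_walks U C (i + k) v v'))
      = (\<Sum>k\<le>n. \<Sum>x\<in>U. int (num_walks U C i v x) * (c k * int (num_walks U C k x v')))"
      by (simp add: num_walks_add[OF U] mat_mul_def sum_distrib_left mult.left_commute)
    also have "\<dots> = (\<Sum>x\<in>U. \<Sum>k\<le>n. int (num_walks U C i v x) * (c k * int (num_walks U C k x v')))"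
      by (rule sum.swap)
    also have "\<dots> = (\<Sum>x\<in>U. int (num_walks U C i v x) * (\<Sum>k\<le>n. c k * int (num_walks U C k x v')))"
      by (simp add: sum_distrib_left)
    also have "\<dots> = 0" using c' True by (intro sum.neutral) auto
    finally show ?thesis .
  next
    case False
    then have "num_walks U C k v v' = 0" for k
      using supported_num_walks[of U C k] by (auto simp: supported_def)
    then show ?thesis by simp
  qed
  have cA: "(\<Sum>k\<le>n. c k * int (num_walks V A k v v')) = 0" if "v \<in> V" "v' \<in> V" for v v'
    using c(2)[of "Inl (v, v')"] that by (auto simp: F_def u_def)
  have cB: "(\<Sum>k\<le>n. c k * int (num_walks W B k v v')) = 0" if "v \<in> W" "v' \<in> W" for v v'
    using c(2)[of "Inr (v, v')"] that by (auto simp: F_def u_def)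
  have "\<exists>k\<le>n. c k \<noteq> 0" using c(1) by auto
  then obtain r d q where q: "q 0 \<noteq> 0" "q d \<noteq> (0::int)" "r + d \<le> n"
    and qs: "\<And>g :: nat \<Rightarrow> int. (\<Sum>k\<le>n. c k * g k) = (\<Sum>k\<le>d. q k * g (k + r))"
    by (rule trim_coefficients[of n c]) blast
  show thesis
    using that[of q d r, OF q(1,2)] rec[OF fin(1) cA] rec[OF fin(2) cB]
    unfolding qs by (simp add: add.assoc)
qed

lemma shift_equivalence_multiple:
  assumes "finite V" "finite W" "shift_equivalence V A W B l c R S"
  shows "mat_mul V (num_walks V A (l * k)) R = mat_mul W R (num_walks W B (l * k))"
proof (induction k)
  case 0
  have "supported V W R" using assms(3) by (simp add: shift_equivalence_def)
  then show ?case
    using num_walks_0_left[OF assms(1), of W R A] num_walks_0_right[OF assms(2), of V R B] by simp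
next
  case (Suc k)
  have "mat_mul V (num_walks V A (l * Suc k)) R
    = mat_mul V (num_walks V A (l * k)) (mat_mul V (num_walks V A l) R)"
    using num_walks_add[OF assms(1), of A "l * k" l] by (simp add: mat_mul_assoc add.commute)
  also have "\<dots> = mat_mul W (mat_mul V (num_walks V A (l * k)) R) (num_walks W B l)"
    using assms(3) by (simp add: mat_mul_assoc shift_equivalence_def)
  also have "\<dots> = mat_mul W R (num_walks W B (l * Suc k))"
    unfolding Suc using num_walks_add[OF assms(2), of B "l * k" l] by (simp add: mat_mul_assoc add.commute)
  finally show ?case .
qed

text \<open>Each entry of the product of a power of A, the matrix R and a power of B is a double
  sequence to which \<open>recurrences_unroot\<close> applies. The constants \<open>K\<close> and
  \<open>r\<close> come from the common recurrence alone, so they serve matrices R that appear only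
  after \<open>l\<close> has been chosen.\<close>

lemma intertwiner_unroot:
  assumes fin: "finite V" "finite W"
  obtains K r where "K > 0"
    "\<And>R m i j. mat_mul V (num_walks V A (1 + K * m)) R = mat_mul W R (num_walks W B (1 + K * m)) \<Longrightarrow>
      mat_mul V (num_walks V A (i + 1 + r)) (mat_mul W R (num_walks W B (j + r)))
      = mat_mul V (num_walks V A (i + r)) (mat_mul W R (num_walks W B (j + 1 + r)))"
proof -
  obtain r d and q :: "nat \<Rightarrow> int" where q: "q 0 \<noteq> 0" "q d \<noteq> 0"
    and qA: "\<And>i v v'. (\<Sum>k\<le>d. q k * int (num_walks V A (i + k + r) v v')) = 0"
    and qB: "\<And>i w w'. (\<Sum>k\<le>d. q k * int (num_walks W B (i + k + r) w w')) = 0"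
    by (rule walks_recurrence[OF fin, of A B]) blast
  show thesis
  proof (rule recurrences_unroot[of q d, OF q])
    fix K :: nat assume K: "K > 0"
    "\<And>(f :: nat \<Rightarrow> nat \<Rightarrow> int) m i j. \<lbrakk>\<And>i j. (\<Sum>k\<le>d. q k * f (i + k) j) = 0;
       \<And>i j. (\<Sum>k\<le>d. q k * f i (j + k)) = 0;
       \<And>i j. f (i + (1 + K * m)) j = f i (j + (1 + K * m))\<rbrakk> \<Longrightarrow> f (i + 1) j = f i (j + 1)"
    show thesis
    proof (rule that[OF K(1)])
      fix R m i j
      assume R: "mat_mul V (num_walks V A (1 + K * m)) R = mat_mul W R (num_walks W B (1 + K * m))"
      define F where "F i j = mat_mul V (num_walks V A (i + r)) (mat_mul W R (num_walks W B (j + r)))"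
        for i j
      have "int (F (i + 1) j v w) = int (F i (j + 1) v w)" for v w
      proof (rule K(2)[of "\<lambda>i j. int (F i j v w)" m i j])
        fix i j
        have "(\<Sum>k\<le>d. q k * int (F (i + k) j v w)) = (\<Sum>k\<le>d. \<Sum>x\<in>V.
            q k * int (num_walks V A (i + k + r) v x) * int (mat_mul W R (num_walks W B (j + r)) x w))"
          unfolding F_def by (subst mat_mul_def) (simp add: sum_distrib_left mult.assoc)
        also have "\<dots> = (\<Sum>x\<in>V. (\<Sum>k\<le>d. q k * int (num_walks V A (i + k + r) v x))
            * int (mat_mul W R (num_walks W B (j + r)) x w))"
          by (subst sum.swap) (simp add: sum_distrib_right)
        finally show "(\<Sum>k\<le>d. q k * int (F (i + k) j v w)) = 0" by (simp add: qA)
        have "(\<Sum>k\<le>d. q k * int (F i (j + k) v w)) = (\<Sum>k\<le>d. \<Sum>x\<in>W.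
            int (mat_mul V (num_walks V A (i + r)) R v x) * (q k * int (num_walks W B (j + k + r) x w)))"
          unfolding F_def mat_mul_assoc[symmetric]
          by (subst mat_mul_def) (simp add: sum_distrib_left mult.left_commute)
        also have "\<dots> = (\<Sum>x\<in>W. int (mat_mul V (num_walks V A (i + r)) R v x) *
            (\<Sum>k\<le>d. q k * int (num_walks W B (j + k + r) x w)))"
          by (subst sum.swap) (simp add: sum_distrib_left)
        finally show "(\<Sum>k\<le>d. q k * int (F i (j + k) v w)) = 0" by (simp add: qB)
        define l where "l = 1 + K * m"
        have "F (i + l) j = mat_mul V (num_walks V A (i + r)) (mat_mul W (mat_mul V (num_walks V A l) R)
            (num_walks W B (j + r)))"
          using num_walks_add[OF fin(1), of A "i + r" l] by (simp add: F_def mat_mul_assoc ac_simps)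
        also have "\<dots> = F i (j + l)"
          unfolding R[folded l_def] using num_walks_add[OF fin(2), of B l "j + r"]
          by (simp add: F_def mat_mul_assoc ac_simps)
        finally show "int (F (i + (1 + K * m)) j v w) = int (F i (j + (1 + K * m)) v w)"
          by (simp add: l_def)
      qed
      then have "F (i + 1) j = F i (j + 1)" by (intro ext) simp
      then show "mat_mul V (num_walks V A (i + 1 + r)) (mat_mul W R (num_walks W B (j + r)))
        = mat_mul V (num_walks V A (i + r)) (mat_mul W R (num_walks W B (j + 1 + r)))"
        by (simp add: F_def)
    qed
  qed
qed

text \<open>As \<open>2 * n\<close> is a multiple of \<open>l\<close>, the middle power can cross
  \<open>S\<close>: A^n R B^(2n) S A^n = A^n R S A^(3n), which is a power of exponent
  \<open>4 * n + c\<close>. The case \<open>l = 1\<close> serves again later, where widening makes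
  the matrices invariant under \<open>G\<close>.\<close>

lemma shift_equivalence_widen:
  assumes fin: "finite V" "finite W" and se: "shift_equivalence V A W B l c R S"
    and com: "mat_mul V (num_walks V A (1 + n)) (mat_mul W R (num_walks W B n))
      = mat_mul V (num_walks V A n) (mat_mul W R (num_walks W B (n + 1)))"
    and com': "mat_mul W (num_walks W B (1 + n)) (mat_mul V S (num_walks V A n))
      = mat_mul W (num_walks W B n) (mat_mul V S (num_walks V A (n + 1)))"
    and n: "l dvd n"
  shows "shift_equivalence V A W B 1 (4 * n + c)
     (mat_mul V (num_walks V A n) (mat_mul W R (num_walks W B n)))
     (mat_mul W (num_walks W B n) (mat_mul V S (num_walks V A n)))"
proof -
  have supp: "supported V W R" "supported W V S" using se by (auto simp: shift_equivalence_def)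
  have A: "mat_mul V (num_walks V A a) (mat_mul V (num_walks V A b) M) = mat_mul V (num_walks V A (a + b)) M"
    for a b and M :: "'a \<Rightarrow> 'x \<Rightarrow> nat"
    by (simp add: num_walks_add[OF fin(1)] mat_mul_assoc)
  have B: "mat_mul W (num_walks W B a) (mat_mul W (num_walks W B b) M) = mat_mul W (num_walks W B (a + b)) M"
    for a b and M :: "'b \<Rightarrow> 'x \<Rightarrow> nat"
    by (simp add: num_walks_add[OF fin(2)] mat_mul_assoc)
  note assoc = mat_mul_assoc num_walks_add[OF fin(1), symmetric] num_walks_add[OF fin(2), symmetric] A B
  obtain k where k: "2 * n = l * k" using n by (metis dvd_def dvd_mult)
  have R2: "mat_mul V (num_walks V A (2 * n)) R = mat_mul W R (num_walks W B (2 * n))"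
    unfolding k by (rule shift_equivalence_multiple[OF fin se])
  have S2: "mat_mul W (num_walks W B (2 * n)) S = mat_mul V S (num_walks V A (2 * n))"
    unfolding k by (rule shift_equivalence_multiple[OF fin(2,1) shift_equivalence_sym[OF se]])
  have RS: "mat_mul W R S = num_walks V A c" "mat_mul V S R = num_walks W B c"
    using se by (auto simp: shift_equivalence_def)
  have "mat_mul W (mat_mul V (num_walks V A n) (mat_mul W R (num_walks W B n)))
     (mat_mul W (num_walks W B n) (mat_mul V S (num_walks V A n)))
    = mat_mul V (num_walks V A n) (mat_mul W R
        (mat_mul V (mat_mul W (num_walks W B (2 * n)) S) (num_walks V A n)))"
    by (simp add: assoc mult_2)
  also have "\<dots> = mat_mul V (num_walks V A n) (mat_mul V (mat_mul W R S) (num_walks V A (2 * n + n)))"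
    unfolding S2 by (simp add: assoc)
  also have "\<dots> = num_walks V A (4 * n + c)" unfolding RS by (simp add: assoc algebra_simps)
  finally have 1: "mat_mul W (mat_mul V (num_walks V A n) (mat_mul W R (num_walks W B n)))
     (mat_mul W (num_walks W B n) (mat_mul V S (num_walks V A n))) = num_walks V A (4 * n + c)" .
  have "mat_mul V (mat_mul W (num_walks W B n) (mat_mul V S (num_walks V A n)))
     (mat_mul V (num_walks V A n) (mat_mul W R (num_walks W B n)))
    = mat_mul W (num_walks W B n) (mat_mul V S
        (mat_mul W (mat_mul V (num_walks V A (2 * n)) R) (num_walks W B n)))"
    by (simp add: assoc mult_2)
  also have "\<dots> = mat_mul W (num_walks W B n) (mat_mul W (mat_mul V S R) (num_walks W B (2 * n + n)))"
    unfolding R2 by (simp add: assoc)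
  also have "\<dots> = num_walks W B (4 * n + c)" unfolding RS by (simp add: assoc algebra_simps)
  finally have 2: "mat_mul V (mat_mul W (num_walks W B n) (mat_mul V S (num_walks V A n)))
     (mat_mul V (num_walks V A n) (mat_mul W R (num_walks W B n))) = num_walks W B (4 * n + c)" .
  show ?thesis unfolding shift_equivalence_def
    using 1 2 com com' supp
    by (auto simp: assoc intro!: supported_mat_mul supported_num_walks)
qed

lemma shift_equivalence_unroot:
  assumes fin: "finite V" "finite W"
  obtains K where "K > 0" "\<And>m c R S. shift_equivalence V A W B (1 + K * m) c R S \<Longrightarrow>
    \<exists>R S c. shift_equivalence V A W B 1 c R S"
proof -
  obtain K1 r1 where K1: "K1 > 0" "\<And>R m i j.
      mat_mul V (num_walks V A (1 + K1 * m)) R = mat_mul W R (num_walks W B (1 + K1 * m)) \<Longrightarrow>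
      mat_mul V (num_walks V A (i + 1 + r1)) (mat_mul W R (num_walks W B (j + r1)))
      = mat_mul V (num_walks V A (i + r1)) (mat_mul W R (num_walks W B (j + 1 + r1)))"
    by (rule intertwiner_unroot[OF fin, of A B]) blast
  obtain K2 r2 where K2: "K2 > 0" "\<And>R m i j.
      mat_mul W (num_walks W B (1 + K2 * m)) R = mat_mul V R (num_walks V A (1 + K2 * m)) \<Longrightarrow>
      mat_mul W (num_walks W B (i + 1 + r2)) (mat_mul V R (num_walks V A (j + r2)))
      = mat_mul W (num_walks W B (i + r2)) (mat_mul V R (num_walks V A (j + 1 + r2)))"
    by (rule intertwiner_unroot[OF fin(2,1), of B A]) blast
  show thesis
  \<comment> \<open>A multiple of both constants, so that one exponent serves \<open>R\<close> and
    \<open>S\<close> together.\<close>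
  proof (rule that[of "K1 * K2"])
    fix m c R S
    assume se: "shift_equivalence V A W B (1 + K1 * K2 * m) c R S"
    define l where "l = 1 + K1 * K2 * m"
    \<comment> \<open>At least both delays, and a multiple of \<open>l\<close> as widening
      requires.\<close>
    define n where "n = l * (r1 + r2)"
    have "r1 + r2 \<le> n" by (simp add: n_def l_def)
    then obtain i1 i2 where i: "n = i1 + r1" "n = i2 + r2"
      by (metis add.commute le_add1 le_add2 le_trans le_iff_add)
    have R: "mat_mul V (num_walks V A l) R = mat_mul W R (num_walks W B l)"
      and S: "mat_mul W (num_walks W B l) S = mat_mul V S (num_walks V A l)"
      using se by (auto simp: shift_equivalence_def l_def)
    have 1: "mat_mul V (num_walks V A (1 + n)) (mat_mul W R (num_walks W B n))
      = mat_mul V (num_walks V A n) (mat_mul W R (num_walks W B (n + 1)))"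
      using K1(2)[of "K2 * m" R i1 i1] R i by (simp add: l_def mult.assoc)
    have 2: "mat_mul W (num_walks W B (1 + n)) (mat_mul V S (num_walks V A n))
      = mat_mul W (num_walks W B n) (mat_mul V S (num_walks V A (n + 1)))"
      using K2(2)[of "K1 * m" S i2 i2] S i by (simp add: l_def mult.left_commute mult.assoc)
    have "l dvd n" by (simp add: n_def)
    from shift_equivalence_widen[OF fin se[folded l_def] 1 2 this]
    show "\<exists>R S c. shift_equivalence V A W B 1 c R S" by blast
  qed (use K1 K2 in auto)
qed

theorem shift_equivalence_of_eventual_conjugacy:
  assumes fin: "finite V" "finite W" and nd: "nondegenerate V A" "nondegenerate W B"
    and ev: "\<forall>\<^sub>F l in sequentially. \<exists>N \<phi> \<phi>'. coded N (edge_shift V A) (edge_shift W B) \<phi> \<phi>' \<and>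
      (\<forall>x\<in>edge_shift V A. \<phi> (translate (int l) x) = translate (int l) (\<phi> x))"
  shows "\<exists>R S c. shift_equivalence V A W B 1 c R S"
proof -
  obtain K where K: "K > 0" "\<And>m c R S. shift_equivalence V A W B (1 + K * m) c R S \<Longrightarrow>
    \<exists>R S c. shift_equivalence V A W B 1 c R S"
    by (rule shift_equivalence_unroot[OF fin, of A B]) (rule that)
  obtain l0 where l0: "\<And>l. l \<ge> l0 \<Longrightarrow> \<exists>N \<phi> \<phi>'. coded N (edge_shift V A) (edge_shift W B) \<phi> \<phi>' \<and>
      (\<forall>x\<in>edge_shift V A. \<phi> (translate (int l) x) = translate (int l) (\<phi> x))"
    using ev unfolding eventually_sequentially by blast
  \<comment> \<open>\<open>K\<close> depends on the two matrices only, so a single conjugacy, for an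
    exponent congruent to 1 modulo \<open>K\<close>, is enough.\<close>
  have "1 + K * l0 \<ge> l0" using K(1) by (cases K) auto
  from l0[OF this] obtain N \<phi> \<phi>' where "coded N (edge_shift V A) (edge_shift W B) \<phi> \<phi>'"
    "\<forall>x\<in>edge_shift V A. \<phi> (translate (int (1 + K * l0)) x) = translate (int (1 + K * l0)) (\<phi> x)"
    by blast
  from coded_shift_equivalence[OF this(1) _ _ fin nd, of "1 + K * l0"] this(2)
  show ?thesis using K(2) by auto
qed

section \<open>Continuity and finite windows\<close>

text \<open>Continuity in combinatorial form. The window may depend on the coordinate, as the maps
  are not sliding block codes for the shift itself.\<close>

definition finite_window :: "(int \<Rightarrow> 'a) set \<Rightarrow> ((int \<Rightarrow> 'a) \<Rightarrow> (int \<Rightarrow> 'b)) \<Rightarrow> bool" where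
  "finite_window X \<phi> \<longleftrightarrow>
     (\<forall>i. \<exists>F. finite F \<and> (\<forall>x\<in>X. \<forall>y\<in>X. (\<forall>k\<in>F. x k = y k) \<longrightarrow> \<phi> x i = \<phi> y i))"

text \<open>With the inverse carried along, composing, inverting and taking powers stay elementary.
  Topology then enters only on translating the given conjugacies and on translating the final one
  back.\<close>

definition local_conjugacy ::
  "(int \<Rightarrow> 'a) set \<Rightarrow> ((int \<Rightarrow> 'a) \<Rightarrow> (int \<Rightarrow> 'a)) \<Rightarrow> (int \<Rightarrow> 'b) set \<Rightarrow> ((int \<Rightarrow> 'b) \<Rightarrow> (int \<Rightarrow> 'b)) \<Rightarrow>
   ((int \<Rightarrow> 'a) \<Rightarrow> (int \<Rightarrow> 'b)) \<Rightarrow> ((int \<Rightarrow> 'b) \<Rightarrow> (int \<Rightarrow> 'a)) \<Rightarrow> bool" where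
  "local_conjugacy X f Y g \<phi> \<phi>' \<longleftrightarrow>
     (\<forall>x\<in>X. \<phi> x \<in> Y \<and> \<phi>' (\<phi> x) = x \<and> \<phi> (f x) = g (\<phi> x)) \<and> (\<forall>y\<in>Y. \<phi>' y \<in> X \<and> \<phi> (\<phi>' y) = y) \<and>
     finite_window X \<phi> \<and> finite_window Y \<phi>'"

lemma finite_windowE:
  assumes "finite_window X \<phi>"
  obtains F where "\<And>i. finite (F i)"
    "\<And>i x y. \<lbrakk>x \<in> X; y \<in> X; \<forall>k\<in>F i. x k = y k\<rbrakk> \<Longrightarrow> \<phi> x i = \<phi> y i"
proof -
  from choice[OF assms[unfolded finite_window_def]] obtain F where
    F: "\<forall>i. finite (F i) \<and> (\<forall>x\<in>X. \<forall>y\<in>X. (\<forall>k\<in>F i. x k = y k) \<longrightarrow> \<phi> x i = \<phi> y i)" ..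
  show thesis
  proof (rule that[of F])
    show "finite (F i)" for i using F by blast
    show "\<phi> x i = \<phi> y i" if "x \<in> X" "y \<in> X" "\<forall>k\<in>F i. x k = y k" for i x y
      using F that by blast
  qed
qed

lemma openin_cylinder: assumes "finite F" shows "openin config_topology {y. \<forall>k\<in>F. y k = x k}"
proof -
  have "{y. \<forall>k\<in>F. y k = x k} = PiE UNIV (\<lambda>k. if k \<in> F then {x k} else UNIV)"
    by (auto simp: PiE_def Pi_def split: if_splits)
  moreover have "{i. (if i \<in> F then {x i} else UNIV) \<noteq> UNIV} \<subseteq> F" by auto
  ultimately show ?thesis
    using assms finite_subset unfolding config_topology_def by (simp add: openin_PiE_gen)
qed

lemma topspace_config [simp]: "topspace config_topology = UNIV"
  by (simp add: config_topology_def)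

lemma finite_window_continuous:
  assumes "finite_window X \<phi>" "\<And>x. x \<in> X \<Longrightarrow> \<phi> x \<in> Y"
  shows "continuous_map (subtopology config_topology X) (subtopology config_topology Y) \<phi>"
proof -
  have "continuous_map (subtopology config_topology X) (discrete_topology UNIV) (\<lambda>x. \<phi> x i)" for i
  proof -
    obtain E where E: "\<And>i. finite (E i)"
      "\<And>i x y. \<lbrakk>x \<in> X; y \<in> X; \<forall>k\<in>E i. x k = y k\<rbrakk> \<Longrightarrow> \<phi> x i = \<phi> y i"
      by (rule finite_windowE[OF assms(1)]) (rule that)
    define F where "F = E i"
    have F: "finite F" "\<And>x y. \<lbrakk>x \<in> X; y \<in> X; \<forall>k\<in>F. x k = y k\<rbrakk> \<Longrightarrow> \<phi> x i = \<phi> y i"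
      unfolding F_def by (fact E)+
    have "openin (subtopology config_topology X) {x \<in> X. \<phi> x i \<in> U}" for U
    proof (subst openin_subopen, intro ballI)
      fix x assume x: "x \<in> {x \<in> X. \<phi> x i \<in> U}"
      show "\<exists>T. openin (subtopology config_topology X) T \<and> x \<in> T \<and> T \<subseteq> {x \<in> X. \<phi> x i \<in> U}"
      proof (intro exI conjI)
        show "openin (subtopology config_topology X) ({y. \<forall>k\<in>F. y k = x k} \<inter> X)"
          by (intro openin_subtopology_Int openin_cylinder F)
        have "\<phi> y i \<in> U" if "y \<in> X" "\<forall>k\<in>F. y k = x k" for y
          using F(2)[OF that(1) _ that(2)] x by auto
        then show "{y. \<forall>k\<in>F. y k = x k} \<inter> X \<subseteq> {x \<in> X. \<phi> x i \<in> U}" by auto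
      qed (use x in auto)
    qed
    then show ?thesis by (simp add: continuous_map_def)
  qed
  then have "continuous_map (subtopology config_topology X) config_topology \<phi>"
    unfolding config_topology_def[where 'a = 'b] continuous_map_componentwise_UNIV by blast
  then show ?thesis using assms(2) by (auto simp: continuous_map_in_subtopology)
qed

text \<open>Every point has a cylinder around it on which the coordinate is constant. Finitely many
  of these cover \<open>X\<close>, and the union of the sets of positions that define them is a
  window for all points.\<close>

lemma continuous_finite_window:
  assumes comp: "compactin config_topology X"
    and cont: "continuous_map (subtopology config_topology X) (subtopology config_topology Y) \<phi>"
  shows "finite_window X \<phi>"
  unfolding finite_window_def
proof
  fix i
  have "continuous_map (subtopology config_topology X) config_topology \<phi>"
    using cont by (simp add: continuous_map_in_subtopology)
  then have ci: "continuous_map (subtopology config_topology X) (discrete_topology UNIV) (\<lambda>x. \<phi> x i)"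
    unfolding config_topology_def[where 'a = 'b] continuous_map_componentwise_UNIV by blast
  have "\<exists>F. finite F \<and> (\<forall>y\<in>X. (\<forall>k\<in>F. y k = x k) \<longrightarrow> \<phi> y i = \<phi> x i)" if x: "x \<in> X" for x
  proof -
    have "\<forall>U. openin (subtopology config_topology X) {y \<in> X. \<phi> y i \<in> U}"
      using ci by (simp add: continuous_map_def)
    then have "openin (subtopology config_topology X) {y \<in> X. \<phi> y i \<in> {\<phi> x i}}" by (rule spec)
    then obtain T where T: "openin config_topology T" "{y \<in> X. \<phi> y i \<in> {\<phi> x i}} = T \<inter> X"
      unfolding openin_subtopology by blast
    have "x \<in> T" using x T(2) by blast
    then obtain U where U: "finite {k. U k \<noteq> UNIV}" "x \<in> PiE UNIV U" "PiE UNIV U \<subseteq> T"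
      using T(1) unfolding config_topology_def openin_product_topology_alt by auto
    have "\<phi> y i = \<phi> x i" if "y \<in> X" "\<forall>k\<in>{k. U k \<noteq> UNIV}. y k = x k" for y
    proof -
      have "y k \<in> U k" for k
        using that(2) U(2) by (cases "U k = UNIV") (auto simp: PiE_def Pi_def)
      then have "y \<in> T \<inter> X" using U(3) that(1) by (auto simp: PiE_def Pi_def)
      then show ?thesis using T(2) by blast
    qed
    then show ?thesis using U(1) by blast
  qed
  then obtain F where F: "\<And>x. x \<in> X \<Longrightarrow> finite (F x)"
    "\<And>x y. x \<in> X \<Longrightarrow> y \<in> X \<Longrightarrow> \<forall>k\<in>F x. y k = x k \<Longrightarrow> \<phi> y i = \<phi> x i" by metis
  define C where "C x = {y. \<forall>k\<in>F x. y k = x k}" for x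
  have "\<forall>U\<in>C ` X. openin config_topology U" using openin_cylinder F(1) by (auto simp: C_def)
  moreover have "X \<subseteq> \<Union> (C ` X)" by (auto simp: C_def)
  ultimately obtain \<F> where "finite \<F>" "\<F> \<subseteq> C ` X" "X \<subseteq> \<Union> \<F>"
    using comp unfolding compactin_def by meson
  then obtain D where D: "finite D" "D \<subseteq> X" "X \<subseteq> \<Union> (C ` D)" by (metis finite_subset_image)
  show "\<exists>F. finite F \<and> (\<forall>x\<in>X. \<forall>y\<in>X. (\<forall>k\<in>F. x k = y k) \<longrightarrow> \<phi> x i = \<phi> y i)"
  proof (intro exI conjI ballI impI)
    show "finite (\<Union>x\<in>D. F x)" using D F(1) by blast
    fix y z assume yz: "y \<in> X" "z \<in> X" "\<forall>k\<in>(\<Union>x\<in>D. F x). y k = z k"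
    obtain x where x: "x \<in> D" "y \<in> C x" using D yz by blast
    then have "\<forall>k\<in>F x. y k = x k" "\<forall>k\<in>F x. z k = x k" using yz by (auto simp: C_def)
    then show "\<phi> y i = \<phi> z i" using F(2)[of x y] F(2)[of x z] x D yz by auto
  qed
qed

lemma subshift_compact: assumes "subshift S Y" shows "compactin config_topology Y"
proof (rule closed_compactin)
  show "compactin config_topology (full_shift S)"
  proof -
    have "full_shift S = PiE UNIV (\<lambda>_. S)" by (auto simp: full_shift_def)
    moreover have "compactin (discrete_topology UNIV) S"
      using assms by (simp add: subshift_def compactin_discrete_topology)
    ultimately show ?thesis unfolding config_topology_def by (simp add: compactin_PiE)
  qed
qed (use assms in \<open>auto simp: subshift_def\<close>)

text \<open>\<open>Y\<close> is compact as the image of \<open>X\<close>, so the inverse has finite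
  windows as well.\<close>

lemma conjugacy_local:
  assumes "conjugacy X f Y g \<phi>" "compactin config_topology X"
  obtains \<phi>' where "local_conjugacy X f Y g \<phi> \<phi>'"
proof -
  obtain \<phi>' where h: "homeomorphic_maps (subtopology config_topology X) (subtopology config_topology Y) \<phi> \<phi>'"
    using assms(1) unfolding conjugacy_def homeomorphic_map_maps by blast
  then have 1: "\<phi> x \<in> Y \<and> \<phi>' (\<phi> x) = x" if "x \<in> X" for x
    using that by (auto simp: homeomorphic_maps_def continuous_map_in_subtopology)
  have 2: "\<phi>' y \<in> X \<and> \<phi> (\<phi>' y) = y" if "y \<in> Y" for y
    using that h by (auto simp: homeomorphic_maps_def continuous_map_in_subtopology)
  have "compactin (subtopology config_topology X) X"
    using assms(2) by (simp add: compactin_subtopology)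
  then have "compactin (subtopology config_topology Y) (\<phi> ` X)"
    using h image_compactin unfolding homeomorphic_maps_def by blast
  moreover have "\<phi> ` X = Y" using 1 2 by (metis image_eqI image_subsetI subsetI subset_antisym)
  ultimately have "compactin config_topology Y" by (simp add: compactin_subtopology)
  then have "finite_window X \<phi>" "finite_window Y \<phi>'"
    using h assms(2) continuous_finite_window unfolding homeomorphic_maps_def by blast+
  then have "local_conjugacy X f Y g \<phi> \<phi>'"
    using 1 2 assms(1) by (auto simp: local_conjugacy_def conjugacy_def)
  then show thesis by (rule that)
qed

lemma local_conjugacy_imp_conjugacy:
  assumes "local_conjugacy X f Y g \<phi> \<phi>'"
  shows "conjugacy X f Y g \<phi>"
proof -
  have "homeomorphic_maps (subtopology config_topology X) (subtopology config_topology Y) \<phi> \<phi>'"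
    using assms finite_window_continuous[of X \<phi> Y] finite_window_continuous[of Y \<phi>' X]
    by (auto simp: homeomorphic_maps_def local_conjugacy_def)
  then show ?thesis using assms homeomorphic_maps_imp_map
    unfolding conjugacy_def local_conjugacy_def by blast
qed

lemma local_conjugacy_sym:
  assumes "local_conjugacy X f Y g \<phi> \<phi>'" "\<And>x. x \<in> X \<Longrightarrow> f x \<in> X"
  shows "local_conjugacy Y g X f \<phi>' \<phi>"
proof -
  have "\<phi>' (g y) = f (\<phi>' y)" if "y \<in> Y" for y
    using assms that unfolding local_conjugacy_def by metis
  then show ?thesis using assms(1) by (auto simp: local_conjugacy_def)
qed

lemma finite_window_comp:
  assumes "finite_window X \<phi>" "finite_window Y \<chi>" "\<And>x. x \<in> X \<Longrightarrow> \<phi> x \<in> Y"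
  shows "finite_window X (\<lambda>x. \<chi> (\<phi> x))"
  unfolding finite_window_def
proof
  fix i
  obtain F where F: "\<And>i. finite (F i)"
    "\<And>i x y. \<lbrakk>x \<in> Y; y \<in> Y; \<forall>k\<in>F i. x k = y k\<rbrakk> \<Longrightarrow> \<chi> x i = \<chi> y i"
    by (rule finite_windowE[OF assms(2)]) (rule that)
  obtain E where E: "\<And>k. finite (E k)"
    "\<And>k x y. \<lbrakk>x \<in> X; y \<in> X; \<forall>j\<in>E k. x j = y j\<rbrakk> \<Longrightarrow> \<phi> x k = \<phi> y k"
    by (rule finite_windowE[OF assms(1)]) (rule that)
  show "\<exists>F. finite F \<and> (\<forall>x\<in>X. \<forall>y\<in>X. (\<forall>k\<in>F. x k = y k) \<longrightarrow> \<chi> (\<phi> x) i = \<chi> (\<phi> y) i)"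
  proof (intro exI conjI ballI impI)
    show "finite (\<Union>k\<in>F i. E k)" using F(1) E(1) by blast
    fix x y assume xy: "x \<in> X" "y \<in> X" "\<forall>j\<in>(\<Union>k\<in>F i. E k). x j = y j"
    show "\<chi> (\<phi> x) i = \<chi> (\<phi> y) i"
      by (rule F(2)[OF assms(3) assms(3)]) (use xy in \<open>auto intro: E(2)\<close>)
  qed
qed

lemma local_conjugacy_comp:
  assumes "local_conjugacy X f Y g \<phi> \<phi>'" "local_conjugacy Y g Z h \<chi> \<chi>'"
  shows "local_conjugacy X f Z h (\<lambda>x. \<chi> (\<phi> x)) (\<lambda>z. \<phi>' (\<chi>' z))"
  using assms finite_window_comp[of X \<phi> Y \<chi>] finite_window_comp[of Z \<chi>' Y \<phi>']
  by (auto simp: local_conjugacy_def)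

lemma local_conjugacy_funpow:
  assumes "local_conjugacy X f Y g \<phi> \<phi>'" "\<And>x. x \<in> X \<Longrightarrow> f x \<in> X"
  shows "local_conjugacy X (f ^^ l) Y (g ^^ l) \<phi> \<phi>'"
proof -
  have "(f ^^ l) x \<in> X \<and> \<phi> ((f ^^ l) x) = (g ^^ l) (\<phi> x)" if "x \<in> X" for x
    using that assms by (induction l) (auto simp: local_conjugacy_def)
  then show ?thesis using assms(1) by (auto simp: local_conjugacy_def)
qed

text \<open>Commuting with translation by \<open>l\<close> reduces all windows to those of the
  coordinates from 0 to \<open>l - 1\<close>, which have a common bound.\<close>

lemma finite_window_windowed:
  assumes fw: "finite_window (edge_shift V A) \<phi>" and l: "l > 0"
    and com: "\<And>x. x \<in> edge_shift V A \<Longrightarrow> \<phi> (translate (int l) x) = translate (int l) (\<phi> x)"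
  shows "\<exists>N\<ge>0. windowed N (edge_shift V A) \<phi>"
proof -
  define X where "X = edge_shift V A"
  obtain F where F: "\<And>i. finite (F i)"
    "\<And>i x y. \<lbrakk>x \<in> X; y \<in> X; \<forall>k\<in>F i. x k = y k\<rbrakk> \<Longrightarrow> \<phi> x i = \<phi> y i"
    by (rule finite_windowE[OF fw[folded X_def]]) (rule that)
  define E where "E = (\<Union>i\<in>{0..<int l}. F i)"
  have "finite E" using F(1) by (auto simp: E_def)
  then obtain M where M: "\<And>k. k \<in> E \<Longrightarrow> \<bar>k\<bar> \<le> M"
    by (metis finite_imageI Max_ge imageI)
  \<comment> \<open>\<open>M\<close> bounds the windows relative to the start of a period;
    \<open>int l\<close> covers the offset of a coordinate within its period.\<close>
  define N where "N = \<bar>M\<bar> + int l"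
  have com_all: "\<phi> (translate (int l * q) x) = translate (int l * q) (\<phi> x)" if x: "x \<in> X" for q x
  proof (cases "q \<ge> 0")
    case True
    define n where "n = nat q"
    have "q = int n" using True by (simp add: n_def)
    then show ?thesis
      using translate_multiple[where \<phi> = \<phi> and c = "int l" and x = x and n = n, OF com] x by (simp add: X_def)
  next
    case False
    define n where "n = nat (- q)"
    have n: "q = - int n" using False by (simp add: n_def)
    define z where "z = translate (int l * q) x"
    have z: "z \<in> X" using x translate_edge_shift by (auto simp: z_def X_def)
    have "translate (int l * int n) z = x" by (simp add: z_def n translate_def)
    then have "\<phi> x = translate (int l * int n) (\<phi> z)"
      using translate_multiple[where \<phi> = \<phi> and c = "int l" and x = z and n = n, OF com] z by (simp add: X_def)
    then have "translate (int l * q) (\<phi> x) = \<phi> z" by (simp add: n translate_def)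
    then show ?thesis by (simp only: z_def)
  qed
  have key: "\<phi> x i = \<phi> y i" if xy: "x \<in> X" "y \<in> X" "\<And>k. i - N \<le> k \<Longrightarrow> k < i + N \<Longrightarrow> x k = y k" for x y i
  proof -
    define q where "q = i div int l"
    define r where "r = i mod int l"
    have i: "i = int l * q + r" by (simp add: q_def r_def)
    have r: "0 \<le> r" "r < int l" using l by (auto simp: r_def)
    have "translate (int l * q) x \<in> X" "translate (int l * q) y \<in> X"
      using xy translate_edge_shift by (auto simp: X_def)
    moreover have "translate (int l * q) x k = translate (int l * q) y k" if "k \<in> F r" for k
    proof -
      have "k \<in> E" using that r by (auto simp: E_def)
      then have "\<bar>k\<bar> \<le> M" by (rule M)
      then have "x (int l * q + k) = y (int l * q + k)"
        using r by (intro xy(3)) (auto simp: i N_def)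
      then show ?thesis by (simp add: translate_def add.commute)
    qed
    ultimately have "\<phi> (translate (int l * q) x) r = \<phi> (translate (int l * q) y) r"
      using F(2)[of "translate (int l * q) x" "translate (int l * q) y" r] by blast
    then show ?thesis using com_all xy by (simp add: translate_def i add.commute)
  qed
  have "windowed N X \<phi>" unfolding windowed_def
  proof (intro ballI allI conjI impI)
    fix x y t i
    assume "x \<in> X" "y \<in> X" "\<forall>i<t. x i = y i" "i < t - N"
    then show "\<phi> x i = \<phi> y i" by (intro key) auto
  next
    fix x y t i
    assume "x \<in> X" "y \<in> X" "\<forall>i\<ge>t. x i = y i" "t + N \<le> i"
    then show "\<phi> x i = \<phi> y i" by (intro key) auto
  qed
  then show ?thesis by (intro exI[of _ N]) (auto simp: N_def X_def)
qed

lemma shift_edge_shift: "x \<in> edge_shift V A \<Longrightarrow> (shift ^^ l) x \<in> edge_shift V A"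
  by (simp add: shift_power_translate translate_edge_shift)

lemma local_conjugacy_coded:
  assumes lc: "local_conjugacy (edge_shift V A) (shift ^^ l) (edge_shift W B) (shift ^^ l) \<phi> \<phi>'" and l: "l > 0"
  shows "\<exists>N. coded N (edge_shift V A) (edge_shift W B) \<phi> \<phi>' \<and>
    (\<forall>x\<in>edge_shift V A. \<phi> (translate (int l) x) = translate (int l) (\<phi> x))"
proof -
  have com: "\<phi> (translate (int l) x) = translate (int l) (\<phi> x)" if "x \<in> edge_shift V A" for x
    using lc that by (simp add: local_conjugacy_def shift_power_translate)
  have com': "\<phi>' (translate (int l) x) = translate (int l) (\<phi>' x)" if "x \<in> edge_shift W B" for x
    using local_conjugacy_sym[OF lc shift_edge_shift] that
    by (simp add: local_conjugacy_def shift_power_translate)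
  have fw: "finite_window (edge_shift V A) \<phi>" "finite_window (edge_shift W B) \<phi>'"
    using lc by (auto simp: local_conjugacy_def)
  obtain N where N: "N \<ge> 0" "windowed N (edge_shift V A) \<phi>"
    using finite_window_windowed[OF fw(1) l com] by blast
  obtain N' where N': "N' \<ge> 0" "windowed N' (edge_shift W B) \<phi>'"
    using finite_window_windowed[OF fw(2) l com'] by blast
  have "coded (max N N') (edge_shift V A) (edge_shift W B) \<phi> \<phi>'"
    using lc N N' windowed_mono[OF N(2), of "max N N'"] windowed_mono[OF N'(2), of "max N N'"]
    by (auto simp: coded_def local_conjugacy_def)
  then show ?thesis using com by blast
qed

section \<open>Actions by graph automorphisms\<close>

locale graph_automorphisms =
  fixes G :: "('g, 'm) monoid_scheme" (structure) and V :: "'v set" and A \<rho> \<eta>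
  assumes graph_action: "graph_action G V A \<rho> \<eta>"
begin

sublocale verts: group_action G V \<rho>
  using graph_action by (simp add: graph_action_def)

sublocale edgs: group_action G "edges V A" \<eta>
  using graph_action by (simp add: graph_action_def)

lemma is_group: "group G"
  using verts.group_hom group_hom.axioms(1) by blast

lemma vert_in: "g \<in> carrier G \<Longrightarrow> v \<in> V \<Longrightarrow> \<rho> g v \<in> V"
  by (rule verts.element_image) auto

lemma edge_in: "g \<in> carrier G \<Longrightarrow> e \<in> edges V A \<Longrightarrow> \<eta> g e \<in> edges V A"
  by (rule edgs.element_image) auto

lemma edge_ends:
  "g \<in> carrier G \<Longrightarrow> e \<in> edges V A \<Longrightarrow> src (\<eta> g e) = \<rho> g (src e) \<and> tgt (\<eta> g e) = \<rho> g (tgt e)"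
  using graph_action by (auto simp: graph_action_def)

lemma vert_inv: "g \<in> carrier G \<Longrightarrow> v \<in> V \<Longrightarrow> \<rho> (inv g) (\<rho> g v) = v"
  using verts.orbit_sym_aux by blast

lemma vert_inv': "g \<in> carrier G \<Longrightarrow> v \<in> V \<Longrightarrow> \<rho> g (\<rho> (inv g) v) = v"
  using vert_inv[of "inv g" v] is_group by (simp add: group.inv_inv)

lemma edge_inv: "g \<in> carrier G \<Longrightarrow> e \<in> edges V A \<Longrightarrow> \<eta> (inv g) (\<eta> g e) = e"
  using edgs.orbit_sym_aux by blast

lemma edge_one: "e \<in> edges V A \<Longrightarrow> \<eta> \<one> e = e"
  using edgs.id_eq_one by (metis restrict_apply')

lemma walk_map:
  "g \<in> carrier G \<Longrightarrow> walk V A i es j \<Longrightarrow> walk V A (\<rho> g i) (map (\<eta> g) es) (\<rho> g j)"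
  by (induction es arbitrary: i) (auto simp: vert_in edge_in edge_ends)

lemma walks_map:
  "g \<in> carrier G \<Longrightarrow> es \<in> walks V A n i j \<Longrightarrow> map (\<eta> g) es \<in> walks V A n (\<rho> g i) (\<rho> g j)"
  by (simp add: walks_def walk_map)

lemma map_one: "set es \<subseteq> edges V A \<Longrightarrow> map (\<eta> \<one>) es = es"
  by (rule map_idI) (auto simp: edge_one)

lemma map_mult:
  "\<lbrakk>g \<in> carrier G; h \<in> carrier G; set es \<subseteq> edges V A\<rbrakk> \<Longrightarrow>
    map (\<eta> (g \<otimes> h)) es = map (\<eta> g) (map (\<eta> h) es)"
  by (auto simp: edgs.composition_rule subset_iff)

lemma map_inv:
  "g \<in> carrier G \<Longrightarrow> set es \<subseteq> edges V A \<Longrightarrow> map (\<eta> (inv g)) (map (\<eta> g) es) = es"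
  unfolding map_map by (rule map_idI) (simp add: edge_inv subsetD)

lemma edge_shift_map: "g \<in> carrier G \<Longrightarrow> x \<in> edge_shift V A \<Longrightarrow> \<eta> g \<circ> x \<in> edge_shift V A"
  by (auto simp: edge_shift_iff edge_in edge_ends)

lemma num_walks_diagonal:
  assumes g: "g \<in> carrier G" and ij: "i \<in> V" "j \<in> V" and fin: "finite V"
  shows "num_walks V A n (\<rho> g i) (\<rho> g j) = num_walks V A n i j"
proof -
  have le: "num_walks V A n i j \<le> num_walks V A n (\<rho> g i) (\<rho> g j)" if "g \<in> carrier G" for g i j
    unfolding num_walks_def
  proof (rule card_inj_on_le[of "map (\<eta> g)"])
    show "inj_on (map (\<eta> g)) (walks V A n i j)"
    proof (rule inj_onI)
      fix es fs assume "es \<in> walks V A n i j" "fs \<in> walks V A n i j" "map (\<eta> g) es = map (\<eta> g) fs"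
      then show "es = fs" using map_inv[OF that] by (metis (no_types, lifting) mem_Collect_eq walk_edges walks_def)
    qed
  qed (use that fin in \<open>auto simp: walks_map finite_walks\<close>)
  have "inv g \<in> carrier G" using g is_group by simp
  from le[OF this, of "\<rho> g i" "\<rho> g j"] le[OF g, of i j] show ?thesis
    using g ij by (simp add: vert_inv)
qed

end

text \<open>The row vector \<open>w\<close> times the \<open>n\<close>-th power, with value 0 off
  \<open>V\<close>, whereas \<open>row_mult\<close> is extensional. Only the values of
  \<open>w\<close> on \<open>V\<close> enter, so the two conventions can be combined.\<close>

definition row_power :: "'v set \<Rightarrow> ('v \<Rightarrow> 'v \<Rightarrow> nat) \<Rightarrow> nat \<Rightarrow> ('v \<Rightarrow> int) \<Rightarrow> 'v \<Rightarrow> int" where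
  "row_power V A n w = (\<lambda>j. \<Sum>i\<in>V. w i * int (num_walks V A n i j))"

lemma row_power_add:
  assumes "finite V"
  shows "row_power V A (m + n) w = row_power V A n (row_power V A m w)"
proof
  fix j
  have "row_power V A (m + n) w j
    = (\<Sum>i\<in>V. \<Sum>k\<in>V. w i * int (num_walks V A m i k) * int (num_walks V A n k j))"
    by (simp add: row_power_def num_walks_add[OF assms] mat_mul_def sum_distrib_left mult.assoc)
  also have "\<dots> = (\<Sum>k\<in>V. \<Sum>i\<in>V. w i * int (num_walks V A m i k) * int (num_walks V A n k j))"
    by (rule sum.swap)
  finally show "row_power V A (m + n) w j = row_power V A n (row_power V A m w) j"
    by (simp add: row_power_def sum_distrib_right)
qed

lemma row_power_row_mult:
  assumes "finite V"
  shows "row_power V A n (row_mult V w A) = row_power V A (Suc n) w"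
proof -
  have "row_power V A 1 w i = row_mult V w A i" if "i \<in> V" for i
    using that by (auto simp: row_power_def row_mult_def num_walks_1[simplified] intro!: sum.cong)
  then have "row_power V A n (row_power V A 1 w) = row_power V A n (row_mult V w A)"
    by (auto simp: row_power_def[of V A n] intro!: sum.cong ext)
  then show ?thesis using row_power_add[OF assms, of A 1 n w] by simp
qed

text \<open>Becoming equal at a common level is an equivalence relation containing
  \<open>dim_step\<close>, hence it contains the one generated. This turns equality in the direct
  limit into an equation between matrix powers.\<close>

lemma dim_equiv_row_power:
  assumes fin: "finite V" and eq: "((v, a), (w, b)) \<in> dim_equiv V A"
  shows "\<exists>m n. a + int m = b + int n \<and> row_power V A m v = row_power V A n w"
proof -
  define E where "E p q \<longleftrightarrow> (\<exists>m n. snd p + int m = snd q + int n \<and>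
    row_power V A m (fst p) = row_power V A n (fst q))" for p q :: "('a \<Rightarrow> int) \<times> int"
  have refl: "E p p" for p unfolding E_def by blast
  have sym: "E q p" if "E p q" for p q using that unfolding E_def by metis
  have trans: "E p r" if E: "E p q" "E q r" for p q r
  proof -
    obtain m n where 1: "snd p + int m = snd q + int n" "row_power V A m (fst p) = row_power V A n (fst q)"
      using E(1) unfolding E_def by blast
    obtain m' n' where 2: "snd q + int m' = snd r + int n'" "row_power V A m' (fst q) = row_power V A n' (fst r)"
      using E(2) unfolding E_def by blast
    have "row_power V A (m + m') (fst p) = row_power V A (n + m') (fst q)"
      unfolding row_power_add[OF fin] 1 ..
    also have "\<dots> = row_power V A (n' + n) (fst r)"
      unfolding add.commute[of n m'] row_power_add[OF fin] 2 ..
    finally show ?thesis unfolding E_def using 1(1) 2(1)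
      by (intro exI[of _ "m + m'"] exI[of _ "n' + n"]) auto
  qed
  have step: "E p q" if pq: "(p, q) \<in> dim_step V A" for p q
  proof -
    obtain w n where "p = (w, n)" "q = (row_mult V w A, n + 1)"
      using pq unfolding dim_step_def by auto
    then show ?thesis unfolding E_def
      using row_power_row_mult[OF fin, of A 0 w] by (intro exI[of _ 1] exI[of _ 0]) auto
  qed
  have "E p q" if "(p, q) \<in> (dim_step V A \<union> (dim_step V A)\<inverse>)\<^sup>+" for p q
    using that
  proof (induction rule: trancl_induct)
    case (base y)
    then show ?case using step sym by blast
  next
    case (step y z)
    then have "E y z" using \<open>\<And>p q. (p, q) \<in> dim_step V A \<Longrightarrow> E p q\<close> sym by blast
    with step show ?case using trans by blast
  qed
  then have "E (v, a) (w, b)" using eq refl unfolding dim_equiv_def by blast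
  then show ?thesis by (simp add: E_def)
qed

lemma walk_consecutive:
  "walk V A i es j \<Longrightarrow> Suc k < length es \<Longrightarrow> tgt (es ! k) = src (es ! Suc k)"
proof (induction es arbitrary: i k)
  case (Cons e es)
  show ?case
  proof (cases k)
    case 0
    then show ?thesis using Cons.prems walk_src[of V A "tgt e" es j] by (cases es) auto
  next
    case (Suc k')
    then show ?thesis using Cons.prems Cons.IH[of "tgt e" k'] by auto
  qed
qed auto

context graph_automorphisms
begin

text \<open>Inertness identifies the classes of the unit vectors at \<open>v\<close> and at
  \<open>\<rho> g v\<close>. Both sit at level 0, so the same power carries them to one vector,
  which means that two rows of that power coincide.\<close>

lemma inert_row:
  assumes fin: "finite V" and g: "g \<in> carrier G" and v: "v \<in> V"
    and inert: "\<And>c. c \<in> carrier (dimension_group V A) \<Longrightarrow> dim_action G V \<rho> g c = c"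
  shows "\<exists>n. \<forall>j. num_walks V A n (\<rho> g v) j = num_walks V A n v j"
proof -
  define e where "e v = (\<lambda>i\<in>V. if i = v then 1 else 0 :: int)" for v
  have e: "e v \<in> row_vectors V" for v by (auto simp: e_def row_vectors_def)
  define c where "c = dim_class V A (e v) 0"
  have refl: "(e v, 0) \<in> c" using e by (auto simp: c_def dim_class_def dim_equiv_def)
  have "c \<in> carrier (dimension_group V A)"
    using e by (auto simp: c_def dim_class_def dimension_group_def quotient_def)
  then have "dim_action G V \<rho> g c = c" by (rule inert)
  moreover have "(act_vector G V \<rho> g (e v), 0) \<in> dim_action G V \<rho> g c"
    using refl by (force simp: dim_action_def)
  moreover have "act_vector G V \<rho> g (e v) = e (\<rho> g v)"
  proof
    fix i
    have "inv g \<in> carrier G" using g is_group by simp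
    then have "\<rho> (inv g) i = v \<longleftrightarrow> i = \<rho> g v" "\<rho> (inv g) i \<in> V" if "i \<in> V"
      using vert_inv[OF g v] vert_inv'[OF g that] vert_in that by auto
    then show "act_vector G V \<rho> g (e v) i = e (\<rho> g v) i"
      by (auto simp: act_vector_def e_def)
  qed
  ultimately have "((e v, 0), (e (\<rho> g v), 0)) \<in> dim_equiv V A"
    by (simp add: c_def dim_class_def)
  from dim_equiv_row_power[OF fin this] obtain n where
    n: "row_power V A n (e v) = row_power V A n (e (\<rho> g v))" by auto
  have row: "row_power V A n (e u) j = int (num_walks V A n u j)" if "u \<in> V" for u j
  proof -
    have "row_power V A n (e u) j = (\<Sum>i\<in>V. if i = u then int (num_walks V A n u j) else 0)"
      unfolding row_power_def by (intro sum.cong) (auto simp: e_def)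
    then show ?thesis using fin that by simp
  qed
  have "int (num_walks V A n (\<rho> g v) j) = int (num_walks V A n v j)" for j
    using fun_cong[OF n, of j] row[OF v] row[OF vert_in[OF g v]] by simp
  then show ?thesis by auto
qed

lemma inert_num_walks:
  assumes fin: "finite V" "finite (carrier G)"
    and inert: "\<And>g c. g \<in> carrier G \<Longrightarrow> c \<in> carrier (dimension_group V A) \<Longrightarrow> dim_action G V \<rho> g c = c"
  obtains N where "\<And>n g v j. \<lbrakk>n \<ge> N; g \<in> carrier G; v \<in> V\<rbrakk> \<Longrightarrow>
      num_walks V A n (\<rho> g v) j = num_walks V A n v j"
    "\<And>n g i v. \<lbrakk>n \<ge> N; g \<in> carrier G; v \<in> V\<rbrakk> \<Longrightarrow>
      num_walks V A n i (\<rho> g v) = num_walks V A n i v"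
proof -
  define n where "n g v = (SOME n. \<forall>j. num_walks V A n (\<rho> g v) j = num_walks V A n v j)" for g v
  have n: "num_walks V A (n g v) (\<rho> g v) j = num_walks V A (n g v) v j"
    if "g \<in> carrier G" "v \<in> V" for g v j
    using someI_ex[OF inert_row[OF fin(1) that inert[OF that(1)]]] unfolding n_def by blast
  \<comment> \<open>Any common upper bound will do: rows that agree keep agreeing under
    multiplication on the right.\<close>
  define N where "N = (\<Sum>g\<in>carrier G. \<Sum>v\<in>V. n g v)"
  have le: "n g v \<le> N" if "g \<in> carrier G" "v \<in> V" for g v
  proof -
    have "n g v \<le> (\<Sum>v\<in>V. n g v)" using that fin by (intro member_le_sum) auto
    also have "\<dots> \<le> N" unfolding N_def
      using that fin by (intro member_le_sum[of g _ "\<lambda>g. \<Sum>v\<in>V. n g v"]) auto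
    finally show ?thesis .
  qed
  have row: "num_walks V A m (\<rho> g v) j = num_walks V A m v j"
    if m: "m \<ge> N" "g \<in> carrier G" "v \<in> V" for m g v j
  proof -
    obtain k where k: "m = n g v + k" using le[OF m(2,3)] m(1) le_iff_add le_trans by metis
    show ?thesis unfolding k num_walks_add[OF fin(1)] by (simp add: mat_mul_def n m)
  qed
  \<comment> \<open>Columns follow from rows, since the entries are also invariant when
    \<open>g\<close> moves both indices at once.\<close>
  have col: "num_walks V A m i (\<rho> g v) = num_walks V A m i v"
    if m: "m \<ge> N" "g \<in> carrier G" "v \<in> V" for m g v i
  proof (cases "i \<in> V")
    case True
    have ig: "inv g \<in> carrier G" using m(2) is_group by simp
    have "num_walks V A m i (\<rho> g v) = num_walks V A m (\<rho> g (\<rho> (inv g) i)) (\<rho> g v)"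
      using vert_inv'[OF m(2) True] by simp
    also have "\<dots> = num_walks V A m (\<rho> (inv g) i) v"
      using num_walks_diagonal[OF m(2) vert_in[OF ig True] m(3) fin(1)] .
    also have "\<dots> = num_walks V A m i v" using row[OF m(1) ig True] .
    finally show ?thesis .
  next
    case False
    then have "num_walks V A m i u = 0" for u
      using supported_zero[OF supported_num_walks] by metis
    then show ?thesis by simp
  qed
  show thesis by (rule that[of N]) (fact row, fact col)
qed

text \<open>A walk longer than the number of edges repeats an edge. If \<open>g\<close> fixed the
  walk, it would fix the periodic point that runs around the loop between two occurrences.\<close>

lemma free_on_walks:
  assumes free: "\<And>x. x \<in> edge_shift V A \<Longrightarrow> \<eta> g \<circ> x \<noteq> x"
    and fin: "finite V" and w: "walk V A i es j" and len: "length es > card (edges V A)"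
  shows "map (\<eta> g) es \<noteq> es"
proof
  assume fixed: "map (\<eta> g) es = es"
  have "card (set es) \<le> card (edges V A)"
    using walk_edges[OF w] fin finite_edges card_mono by blast
  then have "\<not> distinct es" using len distinct_card by fastforce
  then obtain a b where ab: "a < b" "b < length es" "es ! a = es ! b"
    unfolding distinct_conv_nth by (metis linorder_neqE_nat)
  define p where "p = b - a"
  have p: "p > 0" using ab by (simp add: p_def)
  define x where "x i = es ! (a + nat (i mod int p))" for i
  have r: "a + nat (i mod int p) < b" for i
  proof -
    have "nat (i mod int p) < p" using p by (simp add: nat_less_iff)
    moreover have "b = a + p" using ab by (simp add: p_def)
    ultimately show ?thesis by linarith
  qed
  have "x \<in> edge_shift V A" unfolding edge_shift_iff
  proof (intro conjI allI)
    fix i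
    have lt: "a + nat (i mod int p) < length es" using r[of i] ab by linarith
    then show "x i \<in> edges V A" using walk_edges[OF w] by (auto simp: x_def)
    have c: "tgt (x i) = src (es ! Suc (a + nat (i mod int p)))"
      unfolding x_def using walk_consecutive[OF w] r[of i] ab by simp
    show "tgt (x i) = src (x (i + 1))"
    proof (cases "i mod int p + 1 = int p")
      \<comment> \<open>Here the loop closes: the next edge of the walk is \<open>es ! b\<close>,
        which equals \<open>es ! a\<close>.\<close>
      case True
      then have "(i + 1) mod int p = 0" by (metis mod_add_left_eq mod_self)
      moreover have "Suc (a + nat (i mod int p)) = b" using True ab by (simp add: p_def)
      ultimately show ?thesis using c ab by (simp add: x_def)
    next
      case False
      have "0 \<le> i mod int p" "i mod int p < int p" using p by auto
      then have "(i mod int p + 1) mod int p = i mod int p + 1" using False by (intro mod_pos_pos_trivial) auto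
      then have "(i + 1) mod int p = i mod int p + 1" by (metis mod_add_left_eq)
      then have "nat ((i + 1) mod int p) = Suc (nat (i mod int p))" using p by (simp add: nat_add_distrib)
      then show ?thesis using c by (simp add: x_def)
    qed
  qed
  moreover have "\<eta> g \<circ> x = x"
  proof
    fix i
    have "a + nat (i mod int p) < length es" using r[of i] ab by linarith
    then show "(\<eta> g \<circ> x) i = x i" using fixed by (metis comp_apply nth_map x_def)
  qed
  ultimately show False using free by blast
qed

end

section \<open>Equivariant bijections and interlaced blocks\<close>

text \<open>A bijection is chosen at one representative of each orbit in \<open>Z\<close> and
  transported along the orbit. Freeness makes the transporting element unique, so no stabilizer has
  to be respected by the chosen bijection.\<close>

lemma equivariant_bijection:
  fixes G (structure) and Z :: "'z set" and a :: "'g \<Rightarrow> 'z \<Rightarrow> 'z"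
    and P :: "'z \<Rightarrow> 'u set" and Q :: "'z \<Rightarrow> 't set"
  assumes G: "group G"
    and a_in: "\<And>g z. \<lbrakk>g \<in> carrier G; z \<in> Z\<rbrakk> \<Longrightarrow> a g z \<in> Z"
    and a_one: "\<And>z. z \<in> Z \<Longrightarrow> a \<one> z = z"
    and a_mult: "\<And>g h z. \<lbrakk>g \<in> carrier G; h \<in> carrier G; z \<in> Z\<rbrakk> \<Longrightarrow> a (g \<otimes> h) z = a g (a h z)"
    and free: "\<And>g z. \<lbrakk>g \<in> carrier G; z \<in> Z; a g z = z\<rbrakk> \<Longrightarrow> g = \<one>"
    and p_in: "\<And>g z u. \<lbrakk>g \<in> carrier G; z \<in> Z; u \<in> P z\<rbrakk> \<Longrightarrow> p g u \<in> P (a g z)"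
    and p_one: "\<And>z u. \<lbrakk>z \<in> Z; u \<in> P z\<rbrakk> \<Longrightarrow> p \<one> u = u"
    and p_mult: "\<And>g h z u. \<lbrakk>g \<in> carrier G; h \<in> carrier G; z \<in> Z; u \<in> P z\<rbrakk> \<Longrightarrow> p (g \<otimes> h) u = p g (p h u)"
    and q_in: "\<And>g z u. \<lbrakk>g \<in> carrier G; z \<in> Z; u \<in> Q z\<rbrakk> \<Longrightarrow> q g u \<in> Q (a g z)"
    and q_one: "\<And>z u. \<lbrakk>z \<in> Z; u \<in> Q z\<rbrakk> \<Longrightarrow> q \<one> u = u"
    and q_mult: "\<And>g h z u. \<lbrakk>g \<in> carrier G; h \<in> carrier G; z \<in> Z; u \<in> Q z\<rbrakk> \<Longrightarrow> q (g \<otimes> h) u = q g (q h u)"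
    and card: "\<And>z. z \<in> Z \<Longrightarrow> finite (P z) \<and> finite (Q z) \<and> card (P z) = card (Q z)"
  shows "\<exists>\<Phi>. (\<forall>z\<in>Z. bij_betw (\<Phi> z) (P z) (Q z)) \<and>
    (\<forall>g\<in>carrier G. \<forall>z\<in>Z. \<forall>u\<in>P z. \<Phi> (a g z) (p g u) = q g (\<Phi> z u))"
proof -
  interpret group G by (rule G)
  define Orb where "Orb z = {y \<in> Z. \<exists>g\<in>carrier G. a g y = z}" for z
  \<comment> \<open>All points of an orbit have the same set \<open>Orb z\<close>, so choosing from
    this set gives them the same representative.\<close>
  define rep where "rep z = (SOME y. y \<in> Orb z)" for z
  define h where "h z = (SOME g. g \<in> carrier G \<and> a g (rep z) = z)" for z
  define \<beta> where "\<beta> z = (SOME b. bij_betw b (P z) (Q z))" for z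
  define \<Phi> where "\<Phi> z u = q (h z) (\<beta> (rep z) (p (inv (h z)) u))" for z u
  have rep: "rep z \<in> Z" and h: "h z \<in> carrier G" "a (h z) (rep z) = z" if z: "z \<in> Z" for z
  proof -
    have "z \<in> Orb z" unfolding Orb_def using z a_one[OF z] one_closed by blast
    then have "rep z \<in> Orb z" unfolding rep_def by (rule someI)
    then have "rep z \<in> Z" "\<exists>g. g \<in> carrier G \<and> a g (rep z) = z" by (auto simp: Orb_def)
    then show "rep z \<in> Z" "h z \<in> carrier G" "a (h z) (rep z) = z"
      using someI_ex[of "\<lambda>g. g \<in> carrier G \<and> a g (rep z) = z"] by (auto simp: h_def)
  qed
  have Orb: "Orb (a g z) = Orb z" if g: "g \<in> carrier G" and z: "z \<in> Z" for g z
  proof -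
    have "\<exists>k\<in>carrier G. a k y = a g z" if "y \<in> Z" "k \<in> carrier G" "a k y = z" for y k
      using that g a_mult[of g k y] by (intro bexI[of _ "g \<otimes> k"]) auto
    moreover have "\<exists>k\<in>carrier G. a k y = z" if "y \<in> Z" "k \<in> carrier G" "a k y = a g z" for y k
    proof (intro bexI)
      have "a (inv g \<otimes> k) y = a (inv g) (a g z)" using that g a_mult[of "inv g" k y] by simp
      also have "\<dots> = z" using g z a_mult[of "inv g" g z] a_one by simp
      finally show "a (inv g \<otimes> k) y = z" .
    qed (use that g in auto)
    ultimately show ?thesis unfolding Orb_def by blast
  qed
  \<comment> \<open>Both elements carry the representative to \<open>a g z\<close>, so freeness
    forces them to be equal.\<close>
  have h_act: "h (a g z) = g \<otimes> h z" if g: "g \<in> carrier G" and z: "z \<in> Z" for g z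
  proof -
    have az: "a g z \<in> Z" using a_in g z by blast
    have rz: "rep (a g z) = rep z" by (simp add: rep_def Orb[OF g z])
    define k where "k = h (a g z)"
    have k: "k \<in> carrier G" "a k (rep z) = a g z" using h[OF az] rz by (auto simp: k_def)
    have gh: "g \<otimes> h z \<in> carrier G" using g h[OF z] by simp
    have "a (inv k \<otimes> (g \<otimes> h z)) (rep z) = a (inv k) (a g (a (h z) (rep z)))"
      using k gh g h[OF z] rep[OF z] a_mult by (simp add: a_mult)
    also have "\<dots> = a (inv k) (a k (rep z))" using h(2)[OF z] k by simp
    also have "\<dots> = rep z" using k rep[OF z] a_mult[of "inv k" k "rep z"] a_one by simp
    finally have "inv k \<otimes> (g \<otimes> h z) = \<one>" using free k gh rep[OF z] by simp
    then show ?thesis using k gh by (metis inv_equality inv_inv inv_closed k_def)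
  qed
  have a_inv: "a (inv g) (a g z) = z" if "g \<in> carrier G" "z \<in> Z" for g z
    using that a_mult[of "inv g" g z] a_one by simp
  have p_inv: "p (inv g) (p g u) = u" if "g \<in> carrier G" "z \<in> Z" "u \<in> P z" for g z u
    using that p_mult[of "inv g" g z u] p_one by simp
  have q_inv: "q (inv g) (q g u) = u" if "g \<in> carrier G" "z \<in> Z" "u \<in> Q z" for g z u
    using that q_mult[of "inv g" g z u] q_one by simp
  have p_bij: "bij_betw (p (inv (h z))) (P z) (P (rep z))" if z: "z \<in> Z" for z
  proof (rule bij_betw_byWitness[where f' = "p (h z)"])
    have r: "a (inv (h z)) z = rep z" using a_inv[OF h(1)[OF z] rep[OF z]] h(2)[OF z] by simp
    show "\<forall>u\<in>P z. p (h z) (p (inv (h z)) u) = u"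
      using p_inv[of "inv (h z)" z] h(1)[OF z] z by simp
    show "\<forall>u\<in>P (rep z). p (inv (h z)) (p (h z) u) = u" using p_inv h(1)[OF z] rep[OF z] by blast
    show "p (inv (h z)) ` P z \<subseteq> P (rep z)" using p_in[of "inv (h z)" z] h(1)[OF z] z r by auto
    show "p (h z) ` P (rep z) \<subseteq> P z" using p_in[of "h z" "rep z"] h[OF z] rep[OF z] by auto
  qed
  have q_bij: "bij_betw (q (h z)) (Q (rep z)) (Q z)" if z: "z \<in> Z" for z
  proof (rule bij_betw_byWitness[where f' = "q (inv (h z))"])
    have r: "a (inv (h z)) z = rep z" using a_inv[OF h(1)[OF z] rep[OF z]] h(2)[OF z] by simp
    show "\<forall>u\<in>Q z. q (h z) (q (inv (h z)) u) = u"
      using q_inv[of "inv (h z)" z] h(1)[OF z] z by simp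
    show "\<forall>u\<in>Q (rep z). q (inv (h z)) (q (h z) u) = u" using q_inv h(1)[OF z] rep[OF z] by blast
    show "q (inv (h z)) ` Q z \<subseteq> Q (rep z)" using q_in[of "inv (h z)" z] h(1)[OF z] z r by auto
    show "q (h z) ` Q (rep z) \<subseteq> Q z" using q_in[of "h z" "rep z"] h[OF z] rep[OF z] by auto
  qed
  have \<beta>: "bij_betw (\<beta> z) (P z) (Q z)" if "z \<in> Z" for z
    unfolding \<beta>_def using card[OF that] finite_same_card_bij by (intro someI_ex[of "\<lambda>b. bij_betw b (P z) (Q z)"]) blast
  have bij: "bij_betw (\<Phi> z) (P z) (Q z)" if z: "z \<in> Z" for z
  proof -
    have "bij_betw (q (h z) \<circ> (\<beta> (rep z) \<circ> p (inv (h z)))) (P z) (Q z)"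
      by (rule bij_betw_trans[OF bij_betw_trans[OF p_bij[OF z] \<beta>[OF rep[OF z]]] q_bij[OF z]])
    then show ?thesis by (simp add: \<Phi>_def[abs_def] comp_def)
  qed
  have equi: "\<Phi> (a g z) (p g u) = q g (\<Phi> z u)" if g: "g \<in> carrier G" and z: "z \<in> Z" and u: "u \<in> P z" for g z u
  proof -
    have rz: "rep (a g z) = rep z" by (simp add: rep_def Orb[OF g z])
    have hz: "h z \<in> carrier G" using h(1)[OF z] .
    have "inv (g \<otimes> h z) \<otimes> g = inv (h z)" using g hz by (simp add: inv_mult_group m_assoc)
    then have 1: "p (inv (g \<otimes> h z)) (p g u) = p (inv (h z)) u"
      using p_mult[of "inv (g \<otimes> h z)" g z u] g hz z u by simp
    have "p (inv (h z)) u \<in> P (rep z)" using p_bij[OF z] u bij_betwE by blast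
    then have "\<beta> (rep z) (p (inv (h z)) u) \<in> Q (rep z)" using \<beta>[OF rep[OF z]] bij_betwE by blast
    then have "q (g \<otimes> h z) (\<beta> (rep z) (p (inv (h z)) u)) = q g (\<Phi> z u)"
      using q_mult[OF g hz rep[OF z]] by (simp add: \<Phi>_def)
    then show ?thesis unfolding \<Phi>_def[of "a g z"] rz h_act[OF g z] 1 .
  qed
  show ?thesis by (intro exI[of _ \<Phi>] conjI ballI) (auto simp: bij equi)
qed

section \<open>Cutting points into blocks and gluing them again\<close>

definition block :: "nat \<Rightarrow> int \<Rightarrow> (int \<Rightarrow> 'a) \<Rightarrow> 'a list" where
  "block n t x = map (\<lambda>k. x (t + int k)) [0..<n]"

definition concat_blocks :: "nat \<Rightarrow> (int \<Rightarrow> 'a list) \<Rightarrow> int \<Rightarrow> 'a" where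
  "concat_blocks l c i = c (i div int l) ! nat (i mod int l)"

lemma length_block [simp]: "length (block n t x) = n"
  by (simp add: block_def)

lemma block_add: "block (m + n) t x = block m t x @ block n (t + int m) x"
  by (rule nth_equalityI) (auto simp: block_def nth_append algebra_simps)

lemma block_translate: "block n t (translate c x) = block n (t + c) x"
  by (simp add: block_def translate_def algebra_simps)

lemma block_map: "block n t (f \<circ> x) = map f (block n t x)"
  by (simp add: block_def)

lemma block_concat_blocks:
  assumes "l > 0" "\<And>k. length (c k) = l"
  shows "block l (int l * k) (concat_blocks l c) = c k"
proof (rule nth_equalityI)
  fix i assume "i < length (block l (int l * k) (concat_blocks l c))"
  then have i: "i < l" by simp
  then have "(int l * k + int i) div int l = k" "(int l * k + int i) mod int l = int i"
    using assms(1) by auto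
  then show "block l (int l * k) (concat_blocks l c) ! i = c k ! i"
    using i by (simp add: block_def concat_blocks_def)
qed (simp add: assms)

lemma concat_blocks_block:
  assumes "l > 0"
  shows "concat_blocks l (\<lambda>k. block l (int l * k) x) = x"
proof
  fix i :: int
  have "0 \<le> i mod int l" "i mod int l < int l" using assms by auto
  then have "nat (i mod int l) < l" "int l * (i div int l) + int (nat (i mod int l)) = i" by auto
  then show "concat_blocks l (\<lambda>k. block l (int l * k) x) i = x i"
    by (simp add: concat_blocks_def block_def)
qed

lemma walk_tgt: "walk V A i es j \<Longrightarrow> es \<noteq> [] \<Longrightarrow> tgt (last es) = j"
proof (induction es arbitrary: i)
  case (Cons e es)
  then show ?case by (cases es) auto
qed auto

lemma concat_blocks_edge_shift:
  assumes l: "l > 0" "\<And>k. length (c k) = l" and w: "\<And>k. walk V A (p k) (c k) (p (k + 1))"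
  shows "concat_blocks l c \<in> edge_shift V A"
  unfolding edge_shift_iff
proof (intro conjI allI)
  fix i
  define k where "k = i div int l"
  define m where "m = nat (i mod int l)"
  have "0 \<le> i mod int l" "i mod int l < int l" using l by auto
  then have m: "m < l" "i = int l * k + int m" by (auto simp: m_def k_def)
  have "set (c k) \<subseteq> edges V A" using walk_edges[OF w] .
  then show "concat_blocks l c i \<in> edges V A"
    using m l by (auto simp: concat_blocks_def k_def[symmetric] m_def[symmetric])
  have ci: "concat_blocks l c i = c k ! m" by (simp add: concat_blocks_def k_def m_def)
  show "tgt (concat_blocks l c i) = src (concat_blocks l c (i + 1))"
  proof (cases "Suc m < l")
    case True
    have "i + 1 = int l * k + int (Suc m)" using m by simp
    then have "(i + 1) div int l = k" "(i + 1) mod int l = int (Suc m)"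
      using True l by (simp_all only: div_mult_self4 mod_mult_self4) auto
    then have "concat_blocks l c (i + 1) = c k ! Suc m" by (simp only: concat_blocks_def nat_int)
    then show ?thesis using walk_consecutive[OF w[of k], of m] True l ci by simp
  next
    case False
    then have ml: "m = l - 1" using m by auto
    then have "i + 1 = int l * (k + 1)" using m l by (auto simp: algebra_simps of_nat_diff)
    then have "(i + 1) div int l = k + 1" "(i + 1) mod int l = 0" using l by auto
    then have "concat_blocks l c (i + 1) = c (k + 1) ! 0" by (simp add: concat_blocks_def)
    moreover have ne: "c k \<noteq> []" "c (k + 1) \<noteq> []" using l by (metis length_0_conv less_numeral_extra(3))+
    ultimately show ?thesis
      using walk_tgt[OF w[of k]] walk_src[OF w[of "k + 1"]] ci ml l
      by (simp add: last_conv_nth hd_conv_nth)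
  qed
qed

text \<open>The end vertices are read off the first and the last edge, so a walk needs no separate
  vertex data. This is meaningful for \<open>N > 0\<close>, when the list is nonempty.\<close>

definition paths :: "'v set \<Rightarrow> ('v \<Rightarrow> 'v \<Rightarrow> nat) \<Rightarrow> nat \<Rightarrow> ('v \<times> 'v \<times> nat) list set" where
  "paths V A N = {es. length es = N \<and> walk V A (src (hd es)) es (tgt (last es))}"

lemma walk_paths: "walk V A i es j \<Longrightarrow> es \<noteq> [] \<Longrightarrow>
    es \<in> paths V A (length es) \<and> src (hd es) = i \<and> tgt (last es) = j"
  using walk_src[of V A i es j] walk_tgt[of V A i es j] by (simp add: paths_def)

lemma paths_edges: "es \<in> paths V A N \<Longrightarrow> set es \<subseteq> edges V A"
  by (auto simp: paths_def dest: walk_edges)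

lemma paths_ends: "es \<in> paths V A N \<Longrightarrow> src (hd es) \<in> V \<and> tgt (last es) \<in> V"
  by (auto simp: paths_def dest: walk_ends)

text \<open>Detours from \<open>i\<close> to \<open>j\<close> through the other graph: an edge of R,
  a walk of length \<open>N\<close>, an edge of S. They are counted by the product of the three
  matrices; \<open>r\<close> and \<open>s\<close> are mere labels of parallel edges.\<close>

definition connections :: "'w set \<Rightarrow> ('w \<Rightarrow> 'w \<Rightarrow> nat) \<Rightarrow> nat \<Rightarrow> ('v \<Rightarrow> 'w \<Rightarrow> nat) \<Rightarrow> ('w \<Rightarrow> 'v \<Rightarrow> nat) \<Rightarrow>
    'v \<Rightarrow> 'v \<Rightarrow> (nat \<times> ('w \<times> 'w \<times> nat) list \<times> nat) set" where
  "connections W B N R S i j =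
     {(r, w, s). w \<in> paths W B N \<and> r < R i (src (hd w)) \<and> s < S (tgt (last w)) j}"

lemma card_connections:
  assumes W: "finite W" and N: "N > 0"
  shows "finite (connections W B N R S i j)"
    "card (connections W B N R S i j) = mat_mul W R (mat_mul W (num_walks W B N) S) i j"
proof -
  define T where "T ab = {..<R i (fst ab)} \<times> walks W B N (fst ab) (snd ab) \<times> {..<S (snd ab) j}" for ab
  have wp: "w \<in> walks W B N a b \<longleftrightarrow> w \<in> paths W B N \<and> src (hd w) = a \<and> tgt (last w) = b" for w a b
  proof -
    have "w \<noteq> []" if "length w = N" using that N by auto
    then show ?thesis using walk_paths[of W B a w b] by (auto simp: walks_def paths_def)
  qed
  have eq: "connections W B N R S i j = (\<Union>ab\<in>W \<times> W. T ab)"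
  proof (intro equalityI subsetI)
    fix t assume "t \<in> connections W B N R S i j"
    then obtain r w s where "t = (r, w, s)" "w \<in> paths W B N" "r < R i (src (hd w))" "s < S (tgt (last w)) j"
      by (auto simp: connections_def)
    then show "t \<in> (\<Union>ab\<in>W \<times> W. T ab)" using paths_ends[of w W B N]
      by (intro UN_I[of "(src (hd w), tgt (last w))"]) (auto simp: T_def wp)
  qed (auto simp: T_def wp connections_def)
  have fin: "finite (T ab)" for ab by (simp add: T_def finite_walks[OF W])
  show "finite (connections W B N R S i j)" unfolding eq using W fin by blast
  have "card (connections W B N R S i j) = (\<Sum>ab\<in>W \<times> W. card (T ab))"
    unfolding eq
  proof (intro card_UN_disjoint ballI impI)
    fix ab cd :: "'a \<times> 'a" assume "ab \<noteq> cd"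
    then show "T ab \<inter> T cd = {}" by (cases ab; cases cd) (auto simp: T_def wp)
  qed (use W fin in auto)
  also have "\<dots> = (\<Sum>ab\<in>W \<times> W. R i (fst ab) * (num_walks W B N (fst ab) (snd ab) * S (snd ab) j))"
    by (simp add: T_def card_cartesian_product num_walks_def)
  also have "\<dots> = mat_mul W R (mat_mul W (num_walks W B N) S) i j"
    by (simp add: mat_mul_def sum.cartesian_product sum_distrib_left case_prod_unfold)
  finally show "card (connections W B N R S i j) = mat_mul W R (mat_mul W (num_walks W B N) S) i j" .
qed

text \<open>A bi-infinite chain of walks of length \<open>N\<close>, alternately in \<open>A\<close>
  and in \<open>B\<close>, joined by edges of R and S. One symbol holds a walk in \<open>A\<close>
  together with the detour to the next such walk.\<close>

definition interlaced :: "'v set \<Rightarrow> ('v \<Rightarrow> 'v \<Rightarrow> nat) \<Rightarrow> 'w set \<Rightarrow> ('w \<Rightarrow> 'w \<Rightarrow> nat) \<Rightarrow> nat \<Rightarrow>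
    ('v \<Rightarrow> 'w \<Rightarrow> nat) \<Rightarrow> ('w \<Rightarrow> 'v \<Rightarrow> nat) \<Rightarrow>
    (int \<Rightarrow> ('v \<times> 'v \<times> nat) list \<times> nat \<times> ('w \<times> 'w \<times> nat) list \<times> nat) set" where
  "interlaced V A W B N R S = {y. \<forall>k. fst (y k) \<in> paths V A N \<and>
     snd (y k) \<in> connections W B N R S (tgt (last (fst (y k)))) (src (hd (fst (y (k + 1)))))}"

text \<open>The labels of the connecting edges stay fixed, which is consistent when R and S are
  invariant under \<open>G\<close>.\<close>

definition pair_map :: "('a \<Rightarrow> 'c) \<Rightarrow> ('b \<Rightarrow> 'd) \<Rightarrow> 'a list \<times> nat \<times> 'b list \<times> nat \<Rightarrow> 'c list \<times> nat \<times> 'd list \<times> nat" where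
  "pair_map f h = (\<lambda>(v, r, w, s). (map f v, r, map h w, s))"

text \<open>The same chain, cut in front of the walks in \<open>B\<close>; the walk in
  \<open>A\<close> that now belongs to symbol \<open>k\<close> is the one from position
  \<open>k + 1\<close>.\<close>

definition exchange :: "(int \<Rightarrow> 'a \<times> 'r \<times> 'b \<times> 's) \<Rightarrow> int \<Rightarrow> 'b \<times> 's \<times> 'a \<times> 'r" where
  "exchange y = (\<lambda>k. (fst (snd (snd (y k))), snd (snd (snd (y k))), fst (y (k + 1)), fst (snd (y (k + 1)))))"

lemma connections_iff: "t \<in> connections W B N R S i j \<longleftrightarrow> fst (snd t) \<in> paths W B N \<and>
    fst t < R i (src (hd (fst (snd t)))) \<and> snd (snd t) < S (tgt (last (fst (snd t)))) j"
  by (cases t) (simp add: connections_def)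

lemma exchange_interlaced:
  "y \<in> interlaced V A W B N R S \<Longrightarrow> exchange y \<in> interlaced W B V A N S R"
  by (simp add: interlaced_def exchange_def connections_iff)

lemma translate_interlaced:
  "y \<in> interlaced V A W B N R S \<Longrightarrow> translate c y \<in> interlaced V A W B N R S"
proof -
  assume y: "y \<in> interlaced V A W B N R S"
  show ?thesis unfolding interlaced_def translate_def mem_Collect_eq
  proof
    fix k
    have "fst (y (k + c)) \<in> paths V A N \<and> snd (y (k + c)) \<in>
        connections W B N R S (tgt (last (fst (y (k + c))))) (src (hd (fst (y (k + c + 1)))))"
      using y by (simp add: interlaced_def)
    then show "fst (y (k + c)) \<in> paths V A N \<and> snd (y (k + c)) \<in>
        connections W B N R S (tgt (last (fst (y (k + c))))) (src (hd (fst (y (k + 1 + c)))))"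
      by (simp add: add.commute add.left_commute)
  qed
qed

text \<open>Exchanging twice returns the chain advanced by one symbol, which
  \<open>translate (-1)\<close> undoes.\<close>

lemma exchange_local_conjugacy:
  "local_conjugacy (interlaced V A W B N R S) shift (interlaced W B V A N S R) shift
     exchange (\<lambda>y. translate (-1) (exchange y))"
  unfolding local_conjugacy_def
proof (intro conjI ballI)
  fix y assume "y \<in> interlaced V A W B N R S"
  then show "exchange y \<in> interlaced W B V A N S R" by (rule exchange_interlaced)
  show "translate (-1) (exchange (exchange y)) = y" "exchange (shift y) = shift (exchange y)"
    by (auto simp: translate_def exchange_def shift_def)
next
  fix y assume "y \<in> interlaced W B V A N S R"
  then show "translate (-1) (exchange y) \<in> interlaced V A W B N R S"
    by (intro translate_interlaced exchange_interlaced)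
  show "exchange (translate (-1) (exchange y)) = y"
    by (auto simp: translate_def exchange_def)
next
  show "finite_window (interlaced V A W B N R S) exchange"
    unfolding finite_window_def
  proof
    fix i
    show "\<exists>F. finite F \<and> (\<forall>x\<in>interlaced V A W B N R S. \<forall>y\<in>interlaced V A W B N R S.
        (\<forall>k\<in>F. x k = y k) \<longrightarrow> exchange x i = exchange y i)"
      by (intro exI[of _ "{i, i + 1}"]) (auto simp: exchange_def)
  qed
  show "finite_window (interlaced W B V A N S R) (\<lambda>y. translate (-1) (exchange y))"
    unfolding finite_window_def
  proof
    fix i
    show "\<exists>F. finite F \<and> (\<forall>x\<in>interlaced W B V A N S R. \<forall>y\<in>interlaced W B V A N S R.
        (\<forall>k\<in>F. x k = y k) \<longrightarrow> translate (-1) (exchange x) i = translate (-1) (exchange y) i)"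
      by (intro exI[of _ "{i - 1, i}"]) (auto simp: exchange_def translate_def)
  qed
qed

lemma exchange_pair_map: "exchange (pair_map f h \<circ> y) = pair_map h f \<circ> exchange y"
  by (auto simp: exchange_def pair_map_def fun_eq_iff split: prod.splits)

lemma edge_shift_paths:
  assumes "x \<in> edge_shift V A" "n > 0"
  shows "block n t x \<in> paths V A n" "src (hd (block n t x)) = src (x t)"
    "tgt (last (block n t x)) = src (x (t + int n))"
proof -
  have "block n t x \<noteq> []" using assms(2) by (auto simp: block_def)
  from walk_paths[OF edge_shift_walk[OF assms(1), folded block_def] this]
  show "block n t x \<in> paths V A n" "src (hd (block n t x)) = src (x t)"
    "tgt (last (block n t x)) = src (x (t + int n))" by simp_all
qed

text \<open>By \<open>count\<close>, a gap of length \<open>L\<close> between two walks of length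
  \<open>N\<close> has as many fillings as there are detours. The bijection is indexed by the two
  enclosing walks and not by their end vertices, because \<open>G\<close> acts freely on walks of
  length \<open>N\<close> but may fix vertices.\<close>

lemma interlaced_code:
  fixes G (structure) and V :: "'v set" and W :: "'w set"
  assumes A: "graph_automorphisms G V A \<rho> \<eta>" and B: "graph_automorphisms G W B \<rho>' \<eta>'"
    and fin: "finite V" "finite W" and N: "N > 0"
    and free: "\<And>g es. \<lbrakk>g \<in> carrier G; es \<in> paths V A N; map (\<eta> g) es = es\<rbrakk> \<Longrightarrow> g = \<one>"
    and R: "\<And>g i a. \<lbrakk>g \<in> carrier G; i \<in> V; a \<in> W\<rbrakk> \<Longrightarrow> R (\<rho> g i) (\<rho>' g a) = R i a"
    and S: "\<And>g i a. \<lbrakk>g \<in> carrier G; i \<in> V; a \<in> W\<rbrakk> \<Longrightarrow> S (\<rho>' g a) (\<rho> g i) = S a i"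
    and count: "num_walks V A L = mat_mul W R (mat_mul W (num_walks W B N) S)"
  shows "\<exists>enc dec. local_conjugacy (edge_shift V A) (shift ^^ (N + L)) (interlaced V A W B N R S) shift enc dec \<and>
    (\<forall>g\<in>carrier G. \<forall>x\<in>edge_shift V A. enc (\<eta> g \<circ> x) = pair_map (\<eta> g) (\<eta>' g) \<circ> enc x)"
proof -
  interpret A: graph_automorphisms G V A \<rho> \<eta> by (rule A)
  interpret B: graph_automorphisms G W B \<rho>' \<eta>' by (rule B)
  define Z where "Z = paths V A N \<times> paths V A N"
  define P where "P z = walks V A L (tgt (last (fst z))) (src (hd (snd z)))"
    for z :: "('v \<times> 'v \<times> nat) list \<times> ('v \<times> 'v \<times> nat) list"
  define Q where "Q z = connections W B N R S (tgt (last (fst z))) (src (hd (snd z)))"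
    for z :: "('v \<times> 'v \<times> nat) list \<times> ('v \<times> 'v \<times> nat) list"
  define a where "a g z = (map (\<eta> g) (fst z), map (\<eta> g) (snd z))" for g z
  define q where "q g t = (fst t, map (\<eta>' g) (fst (snd t)), snd (snd t))" for g and t :: "nat \<times> ('w \<times> 'w \<times> nat) list \<times> nat"
  have ne: "es \<noteq> []" if "es \<in> paths U C N" for es :: "('u \<times> 'u \<times> nat) list" and U C
    using that N by (auto simp: paths_def)
  have pathA: "map (\<eta> g) es \<in> paths V A N" "src (hd (map (\<eta> g) es)) = \<rho> g (src (hd es))"
    "tgt (last (map (\<eta> g) es)) = \<rho> g (tgt (last es))"
    if "g \<in> carrier G" "es \<in> paths V A N" for g es
    using walk_paths[OF A.walk_map[of g "src (hd es)" es "tgt (last es)"]] that ne[OF that(2)]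
    by (auto simp: paths_def)
  have pathB: "map (\<eta>' g) es \<in> paths W B N" "src (hd (map (\<eta>' g) es)) = \<rho>' g (src (hd es))"
    "tgt (last (map (\<eta>' g) es)) = \<rho>' g (tgt (last es))"
    if "g \<in> carrier G" "es \<in> paths W B N" for g es
    using walk_paths[OF B.walk_map[of g "src (hd es)" es "tgt (last es)"]] that ne[OF that(2)]
    by (auto simp: paths_def)
  have Pe: "set u \<subseteq> edges V A" if "u \<in> P z" for u z
    using that by (auto simp: P_def walks_def dest: walk_edges)
  have Qe: "fst (snd t) \<in> paths W B N" if "t \<in> Q z" for t z
    using that by (simp add: Q_def connections_iff)
  have ex: "\<exists>\<Phi>. (\<forall>z\<in>Z. bij_betw (\<Phi> z) (P z) (Q z)) \<and>
    (\<forall>g\<in>carrier G. \<forall>z\<in>Z. \<forall>u\<in>P z. \<Phi> (a g z) (map (\<eta> g) u) = q g (\<Phi> z u))"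
  proof (rule equivariant_bijection)
    show "group G" by (rule A.is_group)
    show "a g z \<in> Z" if "g \<in> carrier G" "z \<in> Z" for g z
      using that pathA(1) by (auto simp: Z_def a_def)
    show "a \<one> z = z" if "z \<in> Z" for z
      using that A.map_one paths_edges by (cases z) (fastforce simp: Z_def a_def)
    show "a (g \<otimes> h) z = a g (a h z)" if "g \<in> carrier G" "h \<in> carrier G" "z \<in> Z" for g h z
      using that A.map_mult[OF that(1,2) paths_edges[of _ V A N]] by (auto simp: Z_def a_def)
    show "g = \<one>" if "g \<in> carrier G" "z \<in> Z" "a g z = z" for g z
      using that free[of g "fst z"] by (cases z) (auto simp: Z_def a_def)
    show "map (\<eta> g) u \<in> P (a g z)" if "g \<in> carrier G" "z \<in> Z" "u \<in> P z" for g z u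
      using that A.walks_map[of g u L] pathA(2,3)[of g] by (auto simp: Z_def a_def P_def)
    show "map (\<eta> \<one>) u = u" if "z \<in> Z" "u \<in> P z" for z u
      using A.map_one[OF Pe[OF that(2)]] .
    show "map (\<eta> (g \<otimes> h)) u = map (\<eta> g) (map (\<eta> h) u)"
      if "g \<in> carrier G" "h \<in> carrier G" "z \<in> Z" "u \<in> P z" for g h z u
      using A.map_mult[OF that(1,2) Pe[OF that(4)]] .
    \<comment> \<open>The labels do not move, and invariance of \<open>R\<close> and
      \<open>S\<close> keeps them below their new bounds.\<close>
    show "q g t \<in> Q (a g z)" if g: "g \<in> carrier G" and z: "z \<in> Z" and t: "t \<in> Q z" for g z t
    proof -
      have zz: "fst z \<in> paths V A N" "snd z \<in> paths V A N" using z by (auto simp: Z_def)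
      then have V: "tgt (last (fst z)) \<in> V" "src (hd (snd z)) \<in> V" using paths_ends by blast+
      have W: "src (hd (fst (snd t))) \<in> W" "tgt (last (fst (snd t))) \<in> W"
        using paths_ends[OF Qe[OF t]] by auto
      show ?thesis
        using t pathB[OF g Qe[OF t]] pathA(3)[OF g zz(1)] pathA(2)[OF g zz(2)] R[OF g V(1) W(1)] S[OF g V(2) W(2)]
        by (simp add: Q_def connections_iff q_def a_def)
    qed
    show "q \<one> t = t" if "z \<in> Z" "t \<in> Q z" for z t
      using B.map_one[OF paths_edges[OF Qe[OF that(2)]]] by (simp add: q_def)
    show "q (g \<otimes> h) t = q g (q h t)"
      if "g \<in> carrier G" "h \<in> carrier G" "z \<in> Z" "t \<in> Q z" for g h z t
      using B.map_mult[OF that(1,2) paths_edges[OF Qe[OF that(4)]]] by (simp add: q_def)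
    show "finite (P z) \<and> finite (Q z) \<and> card (P z) = card (Q z)" if "z \<in> Z" for z
      by (simp add: P_def Q_def card_connections[OF fin(2) N] finite_walks[OF fin(1)]
          num_walks_def[symmetric] count)
  qed
  then obtain \<Phi> where bij: "\<forall>z\<in>Z. bij_betw (\<Phi> z) (P z) (Q z)"
    and equi: "\<forall>g\<in>carrier G. \<forall>z\<in>Z. \<forall>u\<in>P z. \<Phi> (a g z) (map (\<eta> g) u) = q g (\<Phi> z u)" by blast
  define l where "l = N + L"
  have l: "l > 0" using N by (simp add: l_def)
  define X where "X = edge_shift V A"
  define M where "M = interlaced V A W B N R S"
  define frm where "frm x k = (block N (int l * k) x, block N (int l * (k + 1)) x)" for x :: "int \<Rightarrow> 'v \<times> 'v \<times> nat" and k
  define gap where "gap x k = block L (int l * k + int N) x" for x :: "int \<Rightarrow> 'v \<times> 'v \<times> nat" and k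
  define enc where "enc x k = (block N (int l * k) x, \<Phi> (frm x k) (gap x k))" for x k
  \<comment> \<open>The enclosing walks needed to invert the bijection stand unchanged in the
    symbols at \<open>k\<close> and \<open>k + 1\<close>, so decoding is local.\<close>
  define word where "word y k = fst (y k) @
    inv_into (P (fst (y k), fst (y (k + 1)))) (\<Phi> (fst (y k), fst (y (k + 1)))) (snd (y k))" for y and k :: int
  define dec where "dec y = concat_blocks l (word y)" for y
  have frm: "frm x k \<in> Z" "gap x k \<in> P (frm x k)" if "x \<in> X" for x k
  proof -
    note ep = edge_shift_paths[OF that[unfolded X_def] N]
    show "frm x k \<in> Z" using ep by (simp add: frm_def Z_def)
    have "walk V A (src (x (int l * k + int N))) (gap x k) (src (x (int l * k + int N + int L)))"
      using edge_shift_walk[OF that[unfolded X_def]] by (simp add: gap_def block_def)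
    moreover have "int l * k + int N + int L = int l * (k + 1)" by (simp add: l_def algebra_simps)
    ultimately show "gap x k \<in> P (frm x k)"
      using ep by (simp add: P_def frm_def walks_def) (simp add: gap_def)
  qed
  have encM: "enc x \<in> M" if x: "x \<in> X" for x
    unfolding M_def interlaced_def mem_Collect_eq
  proof
    fix k
    have "\<Phi> (frm x k) (gap x k) \<in> Q (frm x k)" using bij frm[OF x, of k] bij_betwE by blast
    then show "fst (enc x k) \<in> paths V A N \<and> snd (enc x k) \<in>
      connections W B N R S (tgt (last (fst (enc x k)))) (src (hd (fst (enc x (k + 1)))))"
      using frm(1)[OF x, of k] by (simp add: enc_def Q_def frm_def Z_def)
  qed
  have dec_enc: "dec (enc x) = x" if x: "x \<in> X" for x
  proof -
    have "word (enc x) k = block l (int l * k) x" for k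
    proof -
      have "inv_into (P (frm x k)) (\<Phi> (frm x k)) (\<Phi> (frm x k) (gap x k)) = gap x k"
        using bij frm[OF x, of k] by (intro inv_into_f_f) (auto dest: bij_betw_imp_inj_on)
      then have "word (enc x) k = block N (int l * k) x @ gap x k" by (simp add: word_def enc_def frm_def)
      then show ?thesis by (simp add: gap_def l_def block_add)
    qed
    then have "word (enc x) = (\<lambda>k. block l (int l * k) x)" by (rule ext)
    then show ?thesis using concat_blocks_block[OF l, of x] by (simp add: dec_def)
  qed
  have Mz: "(fst (y k), fst (y (k + 1))) \<in> Z" "snd (y k) \<in> Q (fst (y k), fst (y (k + 1)))"
    if "y \<in> M" for y k
    using that by (auto simp: M_def interlaced_def Z_def Q_def)
  have wd: "\<exists>u\<in>P (fst (y k), fst (y (k + 1))). word y k = fst (y k) @ u \<and>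
      \<Phi> (fst (y k), fst (y (k + 1))) u = snd (y k)" if y: "y \<in> M" for y k
  proof -
    have "snd (y k) \<in> \<Phi> (fst (y k), fst (y (k + 1))) ` P (fst (y k), fst (y (k + 1)))"
      using bij Mz[OF y, of k] bij_betw_imp_surj_on by blast
    from inv_into_into[OF this] f_inv_into_f[OF this] show ?thesis
      by (intro bexI conjI) (simp_all add: word_def)
  qed
  have wlen: "length (word y k) = l" if "y \<in> M" for y k
    using wd[OF that, of k] Mz(1)[OF that, of k] by (auto simp: P_def walks_def Z_def paths_def l_def)
  have wwalk: "walk V A (src (hd (fst (y k)))) (word y k) (src (hd (fst (y (k + 1)))))" if "y \<in> M" for y k
    using wd[OF that, of k] Mz(1)[OF that, of k]
    by (auto simp: P_def walks_def Z_def paths_def walk_append)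
  have decX: "dec y \<in> X" if "y \<in> M" for y
    unfolding dec_def X_def
    by (rule concat_blocks_edge_shift[OF l wlen[OF that], where p = "\<lambda>k. src (hd (fst (y k)))"]) (rule wwalk[OF that])
  have enc_dec: "enc (dec y) = y" if y: "y \<in> M" for y
  proof
    fix k
    have bl: "block N (int l * k) (dec y) = fst (y k)" "gap (dec y) k = drop N (word y k)" for k
    proof -
      have "block N (int l * k) (dec y) @ gap (dec y) k = word y k"
        using block_concat_blocks[OF l wlen[OF y], of k] by (simp add: dec_def gap_def l_def block_add)
      moreover have "take N (word y k) = fst (y k)"
        using wd[OF y, of k] Mz(1)[OF y, of k] by (auto simp: Z_def paths_def)
      ultimately show "block N (int l * k) (dec y) = fst (y k)" "gap (dec y) k = drop N (word y k)"
        by (metis append_eq_conv_conj length_block)+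
    qed
    obtain u where u: "word y k = fst (y k) @ u" "\<Phi> (fst (y k), fst (y (k + 1))) u = snd (y k)"
      using wd[OF y, of k] by blast
    have "length (fst (y k)) = N" using Mz(1)[OF y, of k] by (simp add: Z_def paths_def)
    then have "gap (dec y) k = u" using bl(2)[of k] u by simp
    then show "enc (dec y) k = y k" using bl(1) u(2) by (simp add: enc_def frm_def)
  qed
  have com: "enc ((shift ^^ l) x) = shift (enc x)" for x
  proof
    fix k
    have e: "int l * k + int l = int l * (k + 1)" "int l * (k + 1) + int l = int l * (k + 1 + 1)"
      "int l * k + int N + int l = int l * (k + 1) + int N" by (simp_all add: algebra_simps)
    show "enc ((shift ^^ l) x) k = shift (enc x) k"
      by (simp only: enc_def frm_def gap_def shift_power_translate block_translate shift_def e)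
  qed
  have fenc: "finite_window X enc" unfolding finite_window_def
  proof
    fix k
    have bc: "block n t x = block n t y" if "\<forall>j\<in>{t..<t + int n}. x j = y j" for n t and x y :: "int \<Rightarrow> 'v \<times> 'v \<times> nat"
      using that by (simp add: block_def)
    have "enc x k = enc y k" if "\<forall>j\<in>{int l * k..<int l * (k + 1) + int N}. x j = y j" for x y
    proof -
      have "int l * (k + 1) = int l * k + int N + int L" by (simp add: l_def algebra_simps)
      then have "block N (int l * k) x = block N (int l * k) y" "gap x k = gap y k"
        "block N (int l * (k + 1)) x = block N (int l * (k + 1)) y"
        unfolding gap_def using that by (auto intro!: bc)
      then show ?thesis by (simp add: enc_def frm_def)
    qed
    then show "\<exists>F. finite F \<and> (\<forall>x\<in>X. \<forall>y\<in>X. (\<forall>k\<in>F. x k = y k) \<longrightarrow> enc x k = enc y k)"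
      by (intro exI[of _ "{int l * k..<int l * (k + 1) + int N}"]) auto
  qed
  have fdec: "finite_window M dec" unfolding finite_window_def
  proof
    fix i
    show "\<exists>F. finite F \<and> (\<forall>x\<in>M. \<forall>y\<in>M. (\<forall>k\<in>F. x k = y k) \<longrightarrow> dec x i = dec y i)"
      by (intro exI[of _ "{i div int l, i div int l + 1}"]) (auto simp: dec_def concat_blocks_def word_def)
  qed
  have "local_conjugacy X (shift ^^ l) M shift enc dec"
    unfolding local_conjugacy_def using encM dec_enc com decX enc_dec fenc fdec by blast
  moreover have "enc (\<eta> g \<circ> x) = pair_map (\<eta> g) (\<eta>' g) \<circ> enc x" if g: "g \<in> carrier G" and x: "x \<in> X" for g x
  proof
    fix k
    have "frm (\<eta> g \<circ> x) k = a g (frm x k)" "gap (\<eta> g \<circ> x) k = map (\<eta> g) (gap x k)"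
      by (simp_all add: frm_def gap_def a_def block_map)
    then have "\<Phi> (frm (\<eta> g \<circ> x) k) (gap (\<eta> g \<circ> x) k) = q g (\<Phi> (frm x k) (gap x k))"
      using equi g frm[OF x, of k] by simp
    then show "enc (\<eta> g \<circ> x) k = (pair_map (\<eta> g) (\<eta>' g) \<circ> enc x) k"
      by (simp add: enc_def block_map pair_map_def q_def split: prod.splits)
  qed
  ultimately show ?thesis unfolding X_def M_def l_def by blast
qed

section \<open>The equivariant conjugacy\<close>

lemma inert_edge_shift_model:
  fixes G :: "('g, 'm) monoid_scheme" (structure)
  assumes Y: "compactin config_topology Y"
    and free: "free_action G Y \<alpha>" and inert: "inert_action G Y \<alpha>"
    and \<alpha>: "\<And>g y. \<lbrakk>g \<in> carrier G; y \<in> Y\<rbrakk> \<Longrightarrow> \<alpha> g y \<in> Y"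
  obtains V :: "nat set" and A \<rho> \<eta> \<psi> \<psi>' where "finite V" "nondegenerate V A"
    "graph_automorphisms G V A \<rho> \<eta>" "local_conjugacy Y shift (edge_shift V A) shift \<psi> \<psi>'"
    "\<And>g y. \<lbrakk>g \<in> carrier G; y \<in> Y\<rbrakk> \<Longrightarrow> \<psi> (\<alpha> g y) = \<eta> g \<circ> \<psi> y"
    "\<And>g c. \<lbrakk>g \<in> carrier G; c \<in> carrier (dimension_group V A)\<rbrakk> \<Longrightarrow> dim_action G V \<rho> g c = c"
    "\<And>g x. \<lbrakk>g \<in> carrier G; g \<noteq> \<one>; x \<in> edge_shift V A\<rbrakk> \<Longrightarrow> \<eta> g \<circ> x \<noteq> x"
proof -
  obtain V :: "nat set" and A \<rho> \<eta> \<psi> where m: "finite V" "nondegenerate V A"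
    "graph_action G V A \<rho> \<eta>" "conjugacy Y shift (edge_shift V A) shift \<psi>"
    "\<forall>g\<in>carrier G. \<forall>y\<in>Y. \<psi> (\<alpha> g y) = \<eta> g \<circ> \<psi> y"
    "\<forall>g\<in>carrier G. \<forall>c\<in>carrier (dimension_group V A). dim_action G V \<rho> g c = c"
    using inert unfolding inert_action_def by (elim exE conjE) (rule that)
  obtain \<psi>' where lc: "local_conjugacy Y shift (edge_shift V A) shift \<psi> \<psi>'"
    by (rule conjugacy_local[OF m(4) Y]) (rule that)
  have ga: "graph_automorphisms G V A \<rho> \<eta>" using m(3) by (simp add: graph_automorphisms_def)
  \<comment> \<open>A fixed point in the edge shift would pull back along the equivariant map
    \<open>\<psi>\<close> to a fixed point of \<open>\<alpha> g\<close>.\<close>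
  have fr: "\<eta> g \<circ> x \<noteq> x" if g: "g \<in> carrier G" "g \<noteq> \<one>" and x: "x \<in> edge_shift V A" for g x
  proof
    assume eq: "\<eta> g \<circ> x = x"
    have y: "\<psi>' x \<in> Y" "\<psi> (\<psi>' x) = x" using lc x by (auto simp: local_conjugacy_def)
    then have "\<psi> (\<alpha> g (\<psi>' x)) = \<psi> (\<psi>' x)" using m(5) g eq by simp
    then have "\<alpha> g (\<psi>' x) = \<psi>' x" using lc y \<alpha>[OF g(1) y(1)] unfolding local_conjugacy_def by metis
    then show False using free g y(1) by (simp add: free_action_def)
  qed
  show thesis by (rule that[OF m(1,2) ga lc]) (simp add: m(5), simp add: m(6), fact fr)
qed

text \<open>Widening puts high powers of A and B on the outside, and by inertness these are constant
  on orbits in each index. For \<open>S\<close> a further power on the right is allowed, since that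
  is where the excess of \<open>l\<close> will be absorbed.\<close>

lemma inert_shift_equivalence:
  fixes G :: "('g, 'm) monoid_scheme" (structure) and V :: "'v set" and W :: "'w set"
  assumes A: "graph_automorphisms G V A \<rho> \<eta>" and B: "graph_automorphisms G W B \<rho>' \<eta>'"
    and fin: "finite V" "finite W" "finite (carrier G)"
    and se: "shift_equivalence V A W B 1 c R0 S0"
    and inertA: "\<And>g c. \<lbrakk>g \<in> carrier G; c \<in> carrier (dimension_group V A)\<rbrakk> \<Longrightarrow> dim_action G V \<rho> g c = c"
    and inertB: "\<And>g c. \<lbrakk>g \<in> carrier G; c \<in> carrier (dimension_group W B)\<rbrakk> \<Longrightarrow> dim_action G W \<rho>' g c = c"
  obtains c R S where "\<And>g i a. \<lbrakk>g \<in> carrier G; i \<in> V; a \<in> W\<rbrakk> \<Longrightarrow> R (\<rho> g i) (\<rho>' g a) = R i a"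
    "\<And>k g i a. \<lbrakk>g \<in> carrier G; i \<in> V; a \<in> W\<rbrakk> \<Longrightarrow>
       mat_mul V S (num_walks V A k) (\<rho>' g a) (\<rho> g i) = mat_mul V S (num_walks V A k) a i"
    "shift_equivalence V A W B 1 c R S"
proof -
  interpret A: graph_automorphisms G V A \<rho> \<eta> by (rule A)
  interpret B: graph_automorphisms G W B \<rho>' \<eta>' by (rule B)
  obtain N where N: "\<And>n g v j. \<lbrakk>n \<ge> N; g \<in> carrier G; v \<in> V\<rbrakk> \<Longrightarrow>
      num_walks V A n (\<rho> g v) j = num_walks V A n v j"
    "\<And>n g i v. \<lbrakk>n \<ge> N; g \<in> carrier G; v \<in> V\<rbrakk> \<Longrightarrow> num_walks V A n i (\<rho> g v) = num_walks V A n i v"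
    by (rule A.inert_num_walks[OF fin(1,3) inertA]) (assumption, assumption, rule that)
  obtain N' where N': "\<And>n g v j. \<lbrakk>n \<ge> N'; g \<in> carrier G; v \<in> W\<rbrakk> \<Longrightarrow>
      num_walks W B n (\<rho>' g v) j = num_walks W B n v j"
    "\<And>n g i v. \<lbrakk>n \<ge> N'; g \<in> carrier G; v \<in> W\<rbrakk> \<Longrightarrow> num_walks W B n i (\<rho>' g v) = num_walks W B n i v"
    by (rule B.inert_num_walks[OF fin(2,3) inertB]) (assumption, assumption, rule that)
  define n where "n = N + N'"
  define R where "R = mat_mul V (num_walks V A n) (mat_mul W R0 (num_walks W B n))"
  define S where "S = mat_mul W (num_walks W B n) (mat_mul V S0 (num_walks V A n))"
  have AR: "mat_mul V (num_walks V A 1) R0 = mat_mul W R0 (num_walks W B 1)"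
    and BS: "mat_mul W (num_walks W B 1) S0 = mat_mul V S0 (num_walks V A 1)"
    using se by (simp_all add: shift_equivalence_def)
  have 1: "mat_mul V (num_walks V A (1 + n)) (mat_mul W R0 (num_walks W B n))
      = mat_mul V (num_walks V A n) (mat_mul W R0 (num_walks W B (n + 1)))"
  proof -
    have "mat_mul V (num_walks V A (n + 1)) (mat_mul W R0 (num_walks W B n))
      = mat_mul V (num_walks V A n) (mat_mul W (mat_mul V (num_walks V A 1) R0) (num_walks W B n))"
      unfolding num_walks_add[OF fin(1)] by (simp only: mat_mul_assoc)
    also have "\<dots> = mat_mul V (num_walks V A n) (mat_mul W R0 (num_walks W B (1 + n)))"
      unfolding AR num_walks_add[OF fin(2)] by (simp only: mat_mul_assoc)
    finally show ?thesis by (simp only: add.commute)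
  qed
  have 2: "mat_mul W (num_walks W B (1 + n)) (mat_mul V S0 (num_walks V A n))
      = mat_mul W (num_walks W B n) (mat_mul V S0 (num_walks V A (n + 1)))"
  proof -
    have "mat_mul W (num_walks W B (n + 1)) (mat_mul V S0 (num_walks V A n))
      = mat_mul W (num_walks W B n) (mat_mul V (mat_mul W (num_walks W B 1) S0) (num_walks V A n))"
      unfolding num_walks_add[OF fin(2)] by (simp only: mat_mul_assoc)
    also have "\<dots> = mat_mul W (num_walks W B n) (mat_mul V S0 (num_walks V A (1 + n)))"
      unfolding BS num_walks_add[OF fin(1)] by (simp only: mat_mul_assoc)
    finally show ?thesis by (simp only: add.commute)
  qed
  show thesis
  proof (rule that)
    show "shift_equivalence V A W B 1 (4 * n + c) R S"
      unfolding R_def S_def by (rule shift_equivalence_widen[OF fin(1,2) se 1 2]) simp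
    show "R (\<rho> g i) (\<rho>' g a) = R i a" if "g \<in> carrier G" "i \<in> V" "a \<in> W" for g i a
      using that by (simp add: R_def mat_mul_def N N' n_def)
    show "mat_mul V S (num_walks V A k) (\<rho>' g a) (\<rho> g i) = mat_mul V S (num_walks V A k) a i"
      if "g \<in> carrier G" "i \<in> V" "a \<in> W" for k g i a
    proof -
      have "mat_mul V S (num_walks V A k) = mat_mul W (num_walks W B n) (mat_mul V S0 (num_walks V A (n + k)))"
        unfolding S_def num_walks_add[OF fin(1)] by (simp only: mat_mul_assoc)
      then show ?thesis using that by (simp add: mat_mul_def N N' n_def)
    qed
  qed
qed

lemma equivariant_inverse:
  assumes "local_conjugacy X f Y g \<phi> \<phi>'" "\<And>x. x \<in> X \<Longrightarrow> a x \<in> X \<and> \<phi> (a x) = b (\<phi> x)" "y \<in> Y"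
  shows "\<phi>' (b y) = a (\<phi>' y)"
proof -
  have "\<phi>' y \<in> X" "\<phi> (\<phi>' y) = y" using assms(1,3) by (auto simp: local_conjugacy_def)
  then have "\<phi> (a (\<phi>' y)) = b y" "a (\<phi>' y) \<in> X" using assms(2) by auto
  then show ?thesis using assms(1) unfolding local_conjugacy_def by metis
qed

lemma equivariant_edge_conjugacy:
  fixes G :: "('g, 'm) monoid_scheme" (structure) and V :: "'v set" and W :: "'w set"
  assumes A: "graph_automorphisms G V A \<rho> \<eta>" and B: "graph_automorphisms G W B \<rho>' \<eta>'"
    and fin: "finite V" "finite W" "finite (carrier G)"
    and se: "shift_equivalence V A W B 1 c0 R0 S0"
    and inertA: "\<And>g c. \<lbrakk>g \<in> carrier G; c \<in> carrier (dimension_group V A)\<rbrakk> \<Longrightarrow> dim_action G V \<rho> g c = c"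
    and inertB: "\<And>g c. \<lbrakk>g \<in> carrier G; c \<in> carrier (dimension_group W B)\<rbrakk> \<Longrightarrow> dim_action G W \<rho>' g c = c"
    and freeA: "\<And>g x. \<lbrakk>g \<in> carrier G; g \<noteq> \<one>; x \<in> edge_shift V A\<rbrakk> \<Longrightarrow> \<eta> g \<circ> x \<noteq> x"
    and freeB: "\<And>g x. \<lbrakk>g \<in> carrier G; g \<noteq> \<one>; x \<in> edge_shift W B\<rbrakk> \<Longrightarrow> \<eta>' g \<circ> x \<noteq> x"
  shows "\<exists>l0. \<forall>l\<ge>l0. \<exists>\<phi> \<phi>'. local_conjugacy (edge_shift V A) (shift ^^ l) (edge_shift W B) (shift ^^ l) \<phi> \<phi>' \<and>
    (\<forall>g\<in>carrier G. \<forall>x\<in>edge_shift V A. \<phi> (\<eta> g \<circ> x) = \<eta>' g \<circ> \<phi> x)"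
proof -
  interpret A: graph_automorphisms G V A \<rho> \<eta> by (rule A)
  interpret B: graph_automorphisms G W B \<rho>' \<eta>' by (rule B)
  obtain c R S where R: "\<And>g i a. \<lbrakk>g \<in> carrier G; i \<in> V; a \<in> W\<rbrakk> \<Longrightarrow> R (\<rho> g i) (\<rho>' g a) = R i a"
    and S: "\<And>k g i a. \<lbrakk>g \<in> carrier G; i \<in> V; a \<in> W\<rbrakk> \<Longrightarrow>
       mat_mul V S (num_walks V A k) (\<rho>' g a) (\<rho> g i) = mat_mul V S (num_walks V A k) a i"
    and SE: "shift_equivalence V A W B 1 c R S"
    by (rule inert_shift_equivalence[OF A B fin se inertA inertB]) (assumption+, rule that)
  \<comment> \<open>Larger than the number of edges of either graph, so that \<open>G\<close> acts
    freely on walks of length \<open>N\<close> in both.\<close>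
  define N where "N = Suc (card (edges V A) + card (edges W B))"
  have N: "N > 0" by (simp add: N_def)
  have fA: "g = \<one>" if "g \<in> carrier G" "es \<in> paths V A N" "map (\<eta> g) es = es" for g es
  proof (rule ccontr)
    assume "g \<noteq> \<one>"
    then have "map (\<eta> g) es \<noteq> es"
      using A.free_on_walks[OF freeA[OF that(1)] fin(1), of "src (hd es)" es "tgt (last es)"] that(2)
      by (simp add: paths_def N_def)
    with that(3) show False by simp
  qed
  have fB: "g = \<one>" if "g \<in> carrier G" "es \<in> paths W B N" "map (\<eta>' g) es = es" for g es
  proof (rule ccontr)
    assume "g \<noteq> \<one>"
    then have "map (\<eta>' g) es \<noteq> es"
      using B.free_on_walks[OF freeB[OF that(1)] fin(2), of "src (hd es)" es "tgt (last es)"] that(2)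
      by (simp add: paths_def N_def)
    with that(3) show False by simp
  qed
  show ?thesis
  \<comment> \<open>A period consists of \<open>N\<close> for the walk that is kept,
    \<open>N\<close> for the walk in the other graph and \<open>c\<close> for the lag; the excess
    \<open>k\<close> goes into \<open>T\<close>.\<close>
  proof (intro exI[of _ "N + N + c"] allI impI)
    fix l assume "N + N + c \<le> l"
    then obtain k where k: "l = N + N + c + k" using le_Suc_ex by blast
    define L where "L = N + c + k"
    define T where "T = mat_mul V S (num_walks V A k)"
    have AR: "mat_mul V (num_walks V A j) R = mat_mul W R (num_walks W B j)"
      and BS: "mat_mul W (num_walks W B j) S = mat_mul V S (num_walks V A j)" for j
      using shift_equivalence_multiple[OF fin(1,2) SE, of j]
        shift_equivalence_multiple[OF fin(2,1) shift_equivalence_sym[OF SE], of j] by simp_all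
    have RS: "mat_mul W R S = num_walks V A c" and SR: "mat_mul V S R = num_walks W B c"
      using SE by (simp_all add: shift_equivalence_def)
    \<comment> \<open>The power of B crosses \<open>S\<close>, so R B^N S A^k = R S A^(N + k), and R
      S is the power of exponent \<open>c\<close>.\<close>
    have cA: "num_walks V A L = mat_mul W R (mat_mul W (num_walks W B N) T)"
    proof -
      have "mat_mul W R (mat_mul W (num_walks W B N) T)
          = mat_mul W R (mat_mul V (mat_mul W (num_walks W B N) S) (num_walks V A k))"
        by (simp only: T_def mat_mul_assoc)
      also have "\<dots> = mat_mul V (mat_mul W R S) (num_walks V A (N + k))"
        unfolding BS num_walks_add[OF fin(1)] by (simp only: mat_mul_assoc)
      also have "\<dots> = num_walks V A L"
        unfolding RS num_walks_add[OF fin(1), symmetric] by (simp add: L_def ac_simps)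
      finally show ?thesis by simp
    qed
    have cB: "num_walks W B L = mat_mul V T (mat_mul V (num_walks V A N) R)"
    proof -
      have "mat_mul V T (mat_mul V (num_walks V A N) R) = mat_mul V S (mat_mul V (num_walks V A (k + N)) R)"
        unfolding num_walks_add[OF fin(1)] by (simp only: T_def mat_mul_assoc)
      also have "\<dots> = mat_mul W (mat_mul V S R) (num_walks W B (k + N))"
        unfolding AR by (simp only: mat_mul_assoc)
      also have "\<dots> = num_walks W B L"
        unfolding SR num_walks_add[OF fin(2), symmetric] by (simp add: L_def ac_simps)
      finally show ?thesis by simp
    qed
    have l: "l = N + L" by (simp add: k L_def)
    have T: "T (\<rho>' g a) (\<rho> g i) = T a i" if "g \<in> carrier G" "i \<in> V" "a \<in> W" for g i a
      unfolding T_def by (rule S[OF that])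
    have "\<exists>enc dec. local_conjugacy (edge_shift V A) (shift ^^ (N + L)) (interlaced V A W B N R T) shift enc dec \<and>
      (\<forall>g\<in>carrier G. \<forall>x\<in>edge_shift V A. enc (\<eta> g \<circ> x) = pair_map (\<eta> g) (\<eta>' g) \<circ> enc x)"
      by (rule interlaced_code[OF A B fin(1,2) N _ _ _ cA]) (fact fA, fact R, fact T)
    then obtain e1 d1 where
      c1: "local_conjugacy (edge_shift V A) (shift ^^ l) (interlaced V A W B N R T) shift e1 d1"
      and q1: "\<forall>g\<in>carrier G. \<forall>x\<in>edge_shift V A. e1 (\<eta> g \<circ> x) = pair_map (\<eta> g) (\<eta>' g) \<circ> e1 x"
      unfolding l by blast
    have "\<exists>enc dec. local_conjugacy (edge_shift W B) (shift ^^ (N + L)) (interlaced W B V A N T R) shift enc dec \<and>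
      (\<forall>g\<in>carrier G. \<forall>x\<in>edge_shift W B. enc (\<eta>' g \<circ> x) = pair_map (\<eta>' g) (\<eta> g) \<circ> enc x)"
      by (rule interlaced_code[OF B A fin(2,1) N _ _ _ cB]) (fact fB, rule T, assumption+, rule R, assumption+)
    then obtain e2 d2 where
      c2: "local_conjugacy (edge_shift W B) (shift ^^ l) (interlaced W B V A N T R) shift e2 d2"
      and q2: "\<forall>g\<in>carrier G. \<forall>x\<in>edge_shift W B. e2 (\<eta>' g \<circ> x) = pair_map (\<eta>' g) (\<eta> g) \<circ> e2 x"
      unfolding l by blast
    \<comment> \<open>Points of the first edge shift are encoded as chains, the chains are cut anew
      at the walks in \<open>B\<close>, and the result is decoded in the second edge shift.\<close>
    note c12 = local_conjugacy_comp[OF c1 exchange_local_conjugacy]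
    note c = local_conjugacy_comp[OF c12 local_conjugacy_sym[OF c2 shift_edge_shift]]
    have "d2 (exchange (e1 (\<eta> g \<circ> x))) = \<eta>' g \<circ> d2 (exchange (e1 x))"
      if g: "g \<in> carrier G" and x: "x \<in> edge_shift V A" for g x
    proof -
      have "exchange (e1 x) \<in> interlaced W B V A N T R"
        using c12 x by (simp add: local_conjugacy_def)
      then have "d2 (pair_map (\<eta>' g) (\<eta> g) \<circ> exchange (e1 x)) = \<eta>' g \<circ> d2 (exchange (e1 x))"
        using g q2 by (intro equivariant_inverse[OF c2, where a = "\<lambda>x. \<eta>' g \<circ> x"
              and b = "\<lambda>y. pair_map (\<eta>' g) (\<eta> g) \<circ> y"]) (auto intro: B.edge_shift_map)
      then show ?thesis using q1 g x by (simp add: exchange_pair_map)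
    qed
    with c show "\<exists>\<phi> \<phi>'. local_conjugacy (edge_shift V A) (shift ^^ l) (edge_shift W B) (shift ^^ l) \<phi> \<phi>' \<and>
      (\<forall>g\<in>carrier G. \<forall>x\<in>edge_shift V A. \<phi> (\<eta> g \<circ> x) = \<eta>' g \<circ> \<phi> x)" by blast
  qed
qed

theorem theorem6p2:
  fixes S1 :: "'a set" and Y1 :: "(int \<Rightarrow> 'a) set"
    and S2 :: "'b set" and Y2 :: "(int \<Rightarrow> 'b) set"
    and G :: "('g, 'm) monoid_scheme"
    and \<alpha>1 :: "'g \<Rightarrow> (int \<Rightarrow> 'a) \<Rightarrow> (int \<Rightarrow> 'a)"
    and \<alpha>2 :: "'g \<Rightarrow> (int \<Rightarrow> 'b) \<Rightarrow> (int \<Rightarrow> 'b)"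
  assumes "SFT S1 Y1" and "SFT S2 Y2"
    and "\<forall>\<^sub>F l in sequentially. conjugate Y1 (shift ^^ l) Y2 (shift ^^ l)"
    and "group G" and "finite (carrier G)"
    and "\<alpha>1 \<in> hom G (Aut Y1 shift)" and "\<alpha>2 \<in> hom G (Aut Y2 shift)"
    and "free_action G Y1 \<alpha>1" and "free_action G Y2 \<alpha>2"
    and "inert_action G Y1 \<alpha>1" and "inert_action G Y2 \<alpha>2"
  shows "\<forall>\<^sub>F l in sequentially. \<exists>\<phi>. conjugacy Y1 (shift ^^ l) Y2 (shift ^^ l) \<phi> \<and>
           (\<forall>g\<in>carrier G. \<forall>x\<in>Y1. \<phi> (\<alpha>1 g x) = \<alpha>2 g (\<phi> x))"
proof -
  have sub: "subshift S1 Y1" "subshift S2 Y2" using assms(1,2) by (auto simp: SFT_def)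
  note comp = subshift_compact[OF sub(1)] subshift_compact[OF sub(2)]
  have sh: "shift ` Y1 = Y1" "shift ` Y2 = Y2" using sub by (auto simp: subshift_def)
  have Aut_in: "\<alpha> g y \<in> Y" if "\<alpha> \<in> hom G (Aut Y shift)" "g \<in> carrier G" "y \<in> Y"
    for \<alpha> g and y :: "int \<Rightarrow> 'c" and Y
  proof -
    have "\<alpha> g \<in> Bij Y" using hom_in_carrier[OF that(1,2)] by (simp add: Aut_def)
    then show ?thesis using that(3) by (auto simp: Bij_def bij_betw_def)
  qed
  obtain V :: "nat set" and A \<rho> \<eta> \<psi> \<psi>' where
    m1: "finite V" "nondegenerate V A" "graph_automorphisms G V A \<rho> \<eta>"
      "local_conjugacy Y1 shift (edge_shift V A) shift \<psi> \<psi>'"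
    and e1: "\<And>g y. \<lbrakk>g \<in> carrier G; y \<in> Y1\<rbrakk> \<Longrightarrow> \<psi> (\<alpha>1 g y) = \<eta> g \<circ> \<psi> y"
    and i1: "\<And>g c. \<lbrakk>g \<in> carrier G; c \<in> carrier (dimension_group V A)\<rbrakk> \<Longrightarrow> dim_action G V \<rho> g c = c"
    and f1: "\<And>g x. \<lbrakk>g \<in> carrier G; g \<noteq> \<one>\<^bsub>G\<^esub>; x \<in> edge_shift V A\<rbrakk> \<Longrightarrow> \<eta> g \<circ> x \<noteq> x"
    by (rule inert_edge_shift_model[OF comp(1) assms(8,10) Aut_in[OF assms(6)]]) (assumption+, rule that)
  obtain W :: "nat set" and B \<rho>' \<eta>' \<chi> \<chi>' where
    m2: "finite W" "nondegenerate W B" "graph_automorphisms G W B \<rho>' \<eta>'"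
      "local_conjugacy Y2 shift (edge_shift W B) shift \<chi> \<chi>'"
    and e2: "\<And>g y. \<lbrakk>g \<in> carrier G; y \<in> Y2\<rbrakk> \<Longrightarrow> \<chi> (\<alpha>2 g y) = \<eta>' g \<circ> \<chi> y"
    and i2: "\<And>g c. \<lbrakk>g \<in> carrier G; c \<in> carrier (dimension_group W B)\<rbrakk> \<Longrightarrow> dim_action G W \<rho>' g c = c"
    and f2: "\<And>g x. \<lbrakk>g \<in> carrier G; g \<noteq> \<one>\<^bsub>G\<^esub>; x \<in> edge_shift W B\<rbrakk> \<Longrightarrow> \<eta>' g \<circ> x \<noteq> x"
    by (rule inert_edge_shift_model[OF comp(2) assms(9,11) Aut_in[OF assms(7)]]) (assumption+, rule that)
  have sl: "(shift ^^ l) y \<in> Y1" if "y \<in> Y1" for l y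
    using that sh(1) by (induction l) auto
  have sl': "(shift ^^ l) y \<in> Y2" if "y \<in> Y2" for l y
    using that sh(2) by (induction l) auto
  have p1: "local_conjugacy Y1 (shift ^^ l) (edge_shift V A) (shift ^^ l) \<psi> \<psi>'" for l
    using local_conjugacy_funpow[OF m1(4)] sh(1) by blast
  have p2: "local_conjugacy Y2 (shift ^^ l) (edge_shift W B) (shift ^^ l) \<chi> \<chi>'" for l
    using local_conjugacy_funpow[OF m2(4)] sh(2) by blast
  have "\<forall>\<^sub>F l in sequentially. \<exists>N \<phi> \<phi>'. coded N (edge_shift V A) (edge_shift W B) \<phi> \<phi>' \<and>
      (\<forall>x\<in>edge_shift V A. \<phi> (translate (int l) x) = translate (int l) (\<phi> x))"
    \<comment> \<open>Uniform windows come from commuting with translation by \<open>l\<close>,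
      hence \<open>l\<close> has to be positive.\<close>
    using assms(3) eventually_gt_at_top[of 0]
  proof eventually_elim
    case (elim l)
    then obtain \<theta> where "conjugacy Y1 (shift ^^ l) Y2 (shift ^^ l) \<theta>" by (auto simp: conjugate_def)
    then obtain \<theta>' where \<theta>: "local_conjugacy Y1 (shift ^^ l) Y2 (shift ^^ l) \<theta> \<theta>'"
      by (rule conjugacy_local[OF _ comp(1)])
    \<comment> \<open>This conjugacy has no relation to the actions; it serves only to obtain the
      shift equivalence.\<close>
    have "local_conjugacy (edge_shift V A) (shift ^^ l) (edge_shift W B) (shift ^^ l)
      (\<lambda>x. \<chi> (\<theta> (\<psi>' x))) (\<lambda>y. \<psi> (\<theta>' (\<chi>' y)))"
      using local_conjugacy_comp[OF local_conjugacy_comp[OF local_conjugacy_sym[OF p1 sl] \<theta>] p2] .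
    from local_conjugacy_coded[OF this elim(2)] show ?case by blast
  qed
  from shift_equivalence_of_eventual_conjugacy[OF m1(1) m2(1) m1(2) m2(2) this]
  obtain R S c where "shift_equivalence V A W B 1 c R S" by blast
  then have "\<exists>l0. \<forall>l\<ge>l0.
    \<exists>\<phi> \<phi>'. local_conjugacy (edge_shift V A) (shift ^^ l) (edge_shift W B) (shift ^^ l) \<phi> \<phi>' \<and>
      (\<forall>g\<in>carrier G. \<forall>x\<in>edge_shift V A. \<phi> (\<eta> g \<circ> x) = \<eta>' g \<circ> \<phi> x)"
    by (rule equivariant_edge_conjugacy[OF m1(3) m2(3) m1(1) m2(1) assms(5)]) (fact i1, fact i2, fact f1, fact f2)
  then obtain l0 where l0: "\<And>l. l \<ge> l0 \<Longrightarrow>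
    \<exists>\<phi> \<phi>'. local_conjugacy (edge_shift V A) (shift ^^ l) (edge_shift W B) (shift ^^ l) \<phi> \<phi>' \<and>
      (\<forall>g\<in>carrier G. \<forall>x\<in>edge_shift V A. \<phi> (\<eta> g \<circ> x) = \<eta>' g \<circ> \<phi> x)" by blast
  show ?thesis unfolding eventually_sequentially
  proof (rule exI[of _ l0], intro allI impI)
    fix l assume "l0 \<le> l"
    then obtain \<phi> \<phi>' where
      \<phi>: "local_conjugacy (edge_shift V A) (shift ^^ l) (edge_shift W B) (shift ^^ l) \<phi> \<phi>'"
      and eq: "\<forall>g\<in>carrier G. \<forall>x\<in>edge_shift V A. \<phi> (\<eta> g \<circ> x) = \<eta>' g \<circ> \<phi> x"
      using l0 by blast
    note c = local_conjugacy_comp[OF local_conjugacy_comp[OF p1 \<phi>] local_conjugacy_sym[OF p2 sl']]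
    have "\<chi>' (\<phi> (\<psi> (\<alpha>1 g x))) = \<alpha>2 g (\<chi>' (\<phi> (\<psi> x)))" if g: "g \<in> carrier G" and x: "x \<in> Y1" for g x
    proof -
      have x': "\<psi> x \<in> edge_shift V A" "\<phi> (\<psi> x) \<in> edge_shift W B"
        using x m1(4) \<phi> by (auto simp: local_conjugacy_def)
      have "\<chi>' (\<eta>' g \<circ> \<phi> (\<psi> x)) = \<alpha>2 g (\<chi>' (\<phi> (\<psi> x)))"
        by (rule equivariant_inverse[OF m2(4), where b = "\<lambda>y. \<eta>' g \<circ> y"])
          (use e2 g Aut_in[OF assms(7)] x' in auto)
      then show ?thesis using eq e1 g x x' by simp
    qed
    with local_conjugacy_imp_conjugacy[OF c]
    show "\<exists>\<phi>. conjugacy Y1 (shift ^^ l) Y2 (shift ^^ l) \<phi> \<and>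
      (\<forall>g\<in>carrier G. \<forall>x\<in>Y1. \<phi> (\<alpha>1 g x) = \<alpha>2 g (\<phi> x))" by blast
  qed
qed

end
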